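(* Let $n$ be a positive integer, let $1\le p<\infty$, and let $\alpha>0$. Let $p'$ denote the conjugate exponent to $p$, $\frac1p+\frac1{p'}=1$. The Bargmann projection $P_\alpha$ is bounded on $L^p(\mathbb{C}^n,\gamma_{\alpha p/2})$, with norm $$\|P_\alpha\colon L^p(\mathbb{C}^n,\gamma_{\alpha p/2})\to L^p_{hol}(\mathbb{C}^n,\gamma_{\alpha p/2})\| = \left(2\,\frac{1}{p^{1/p}}\,\frac{1}{p'^{1/p'}}\right)^n.$$
   Context: For $\beta>0$, $\gamma_\beta$ is the Gaussian probability measure on $\mathbb{C}^n$ given by $\gamma_\beta(dz)=\left(\frac{\beta}{\pi}\right)^n e^{-\beta|z|^2}\,\lambda(dz)$, with $\lambda$ Lebesgue measure on $\mathbb{C}^n$. $L^p_{hol}(\mathbb{C}^n,\gamma_\beta)$ is the subspace of $L^p(\mathbb{C}^n,\gamma_\beta)$ consisting of (entire) holomorphic functions. $\langle z,w\rangle=\sum_{i=1}^n z_i\overline{w_i}$. The Bargmann projection $P_\alpha$ is the orthogonal projection $L^2(\mathbb{C}^n,\gamma_\alpha)\to L^2_{hol}(\mathbb{C}^n,\gamma_\alpha)$; it is given by the integral formula $$P_\alpha f(z)=\int_{\mathbb{C}^n}e^{\alpha\langle z,w\rangle}f(w)\,\gamma_\alpha(dw),$$ and this formula defines its action on $L^p(\mathbb{C}^n,\gamma_{\alpha p/2})$. The norm is the operator norm, both spaces carrying the $L^p(\gamma_{\alpha p/2})$-norm. When $p=1$, $p'=\infty$ and $p'^{1/p'}$ is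 interpreted as $1$ (so the norm is $2^n$). *)

theory Defs
  imports "HOL-Analysis.Analysis"
begin

definition gauss_measure :: "real \<Rightarrow> (complex ^ 'n::finite) measure" where
  "gauss_measure \<beta> =
     density lborel (\<lambda>z. ennreal ((\<beta> / pi) ^ CARD('n) * exp (- \<beta> * (norm z)\<^sup>2)))"

definition herm :: "complex ^ 'n::finite \<Rightarrow> complex ^ 'n \<Rightarrow> complex" where
  "herm z w = (\<Sum>i\<in>UNIV. z $ i * cnj (w $ i))"

text \<open>
  The elements of \<open>Lp_space\<close> are functions rather than classes modulo almost everywhere
  equality, so that \<open>Lp_norm\<close> is a seminorm on it.
\<close>

definition Lp_space :: "real \<Rightarrow> 'a measure \<Rightarrow> ('a \<Rightarrow> complex) set" where
  "Lp_space p M = {f \<in> borel_measurable M. integrable M (\<lambda>x. norm (f x) powr p)}"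

definition Lp_norm :: "real \<Rightarrow> 'a measure \<Rightarrow> ('a \<Rightarrow> complex) \<Rightarrow> real" where
  "Lp_norm p M f = (\<integral>x. norm (f x) powr p \<partial>M) powr (1 / p)"

text \<open>Holomorphy in several variables: the real derivative exists everywhere and is complex linear.\<close>

definition entire_fun :: "(complex ^ 'n::finite \<Rightarrow> complex) \<Rightarrow> bool" where
  "entire_fun f \<longleftrightarrow>
     (\<forall>z. \<exists>D. (f has_derivative D) (at z) \<and> (\<forall>c v. D (c *s v) = c * D v))"

definition Lp_hol :: "real \<Rightarrow> (complex ^ 'n::finite) measure \<Rightarrow> (complex ^ 'n \<Rightarrow> complex) set" where
  "Lp_hol p M = {f \<in> Lp_space p M. entire_fun f}"

definition bargmann_integrand ::
    "real \<Rightarrow> (complex ^ 'n::finite \<Rightarrow> complex) \<Rightarrow> complex ^ 'n \<Rightarrow> complex ^ 'n \<Rightarrow> complex" where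
  "bargmann_integrand \<alpha> f z w = exp (of_real \<alpha> * herm z w) * f w"

definition bargmann ::
    "real \<Rightarrow> (complex ^ 'n::finite \<Rightarrow> complex) \<Rightarrow> complex ^ 'n \<Rightarrow> complex" where
  "bargmann \<alpha> f z = (\<integral>w. bargmann_integrand \<alpha> f z w \<partial>gauss_measure \<alpha>)"

text \<open>
  Bounded linear operators from \<open>Lp_space p M\<close> to a space \<open>W\<close> of functions carrying the same
  \<open>Lp_norm\<close>. Linearity and boundedness make such an operator respect almost everywhere equality.
\<close>

definition Lp_bounded_op ::
    "real \<Rightarrow> 'a measure \<Rightarrow> ('a \<Rightarrow> complex) set \<Rightarrow> (('a \<Rightarrow> complex) \<Rightarrow> 'a \<Rightarrow> complex) \<Rightarrow> bool" where
  "Lp_bounded_op p M W T \<longleftrightarrow>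
     (\<forall>f\<in>Lp_space p M. T f \<in> W) \<and>
     (\<forall>f\<in>Lp_space p M. \<forall>g\<in>Lp_space p M. T (\<lambda>x. f x + g x) = (\<lambda>x. T f x + T g x)) \<and>
     (\<forall>c. \<forall>f\<in>Lp_space p M. T (\<lambda>x. c * f x) = (\<lambda>x. c * T f x)) \<and>
     (\<exists>C. \<forall>f\<in>Lp_space p M. Lp_norm p M (T f) \<le> C * Lp_norm p M f)"

text \<open>
  As in \<^const>\<open>onorm\<close>, null functions contribute the quotient \<open>0\<close>. The supremum is taken in the
  reals and is meaningful only for operators satisfying \<^const>\<open>Lp_bounded_op\<close>.
\<close>

definition Lp_op_norm ::
    "real \<Rightarrow> 'a measure \<Rightarrow> (('a \<Rightarrow> complex) \<Rightarrow> 'a \<Rightarrow> complex) \<Rightarrow> real" where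
  "Lp_op_norm p M T = (SUP f\<in>Lp_space p M. Lp_norm p M (T f) / Lp_norm p M f)"

text \<open>The expression \<open>q powr (1 / q)\<close> for an exponent \<open>q\<close>, with the limit value \<open>1\<close> at infinity.\<close>

definition self_root :: "ennreal \<Rightarrow> real" where
  "self_root q = (if q = top then 1 else enn2real q powr (1 / enn2real q))"

end

theory Submission
  imports Defs "HOL-Probability.Characteristic_Functions" "HOL-Real_Asymp.Real_Asymp"
begin

text \<open>
  The weight can be moved: writing \<open>f(w) = exp ((\<alpha> - l\<^sup>2) \<bar>w\<bar>\<^sup>2) g(l w)\<close> with a suitable \<open>l\<close>
  turns the \<open>L\<^sup>p\<close> norm of \<open>f\<close> into a multiple of the \<open>L\<^sup>p\<close> norm of \<open>g\<close> for the standard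
  Gaussian measure \<open>\<gamma>\<close>, and it turns the Bargmann projection of \<open>f\<close> into a multiple of \<open>Tg(z) =
  (Pg)(r z)\<close>, where \<open>P\<close> is the Bargmann projection for \<open>\<gamma>\<close> and \<open>r = 2 sqrt (p - 1) / p\<close>. The
  multiples combine to the asserted constant, and \<open>T 1 = 1\<close>. So for \<open>p > 1\<close> the theorem says
  that \<open>T\<close> is a contraction of \<open>L\<^sup>p(\<gamma>)\<close> (\<open>Lp_contracted_Lp\<close>), and the norm is attained at the
  Gaussian \<open>f\<close> that corresponds to \<open>g = 1\<close>. For \<open>p = 1\<close> the bound follows by putting the
  modulus of the kernel under the integral (\<open>bargmann_nn_bound_1\<close>), and concentrated Gaussians
  show that it is sharp.

  That \<open>T\<close> is a contraction is proved by a semigroup argument in the spirit of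
  hypercontractivity. A standard Gaussian vector is split into independent parts \<open>X\<close> and \<open>Y\<close> of
  variances \<open>s\<close> and \<open>1 - s\<close>, and the operation \<open>T\<close> is applied to \<open>x \<mapsto> g(x + Y)\<close> with respect to
  the first part only. Let \<open>F(s)\<close> be the \<open>p\<close>-th absolute moment of the result at \<open>(X, Y)\<close>. Then
  \<open>F(0)\<close> is the \<open>p\<close>-th power of the norm of \<open>g\<close> and \<open>F(1)\<close> that of \<open>Tg\<close>, so it suffices that
  \<open>F\<close> does not increase. Moving a piece of variance \<open>h\<close> from \<open>Y\<close> to \<open>X\<close> only involves the
  second-order Taylor expansion of \<open>\<bar>u\<bar>\<^sup>p\<close>. If \<open>D\<close> and \<open>B\<close> are the holomorphic and
  antiholomorphic gradients of the function before the move, then after it the antiholomorphic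
  one is gone and the holomorphic one is multiplied by \<open>r\<close>; the mean is the same. Up to a
  common positive factor the required inequality is \<open>r\<^sup>2 \<bar>D\<bar>\<^sup>2 \<le> \<bar>B\<bar>\<^sup>2 + \<bar>D\<bar>\<^sup>2 - 2 \<bar>1 - 2 / p\<bar>
  \<bar>B\<bar> \<bar>D\<bar>\<close>, and as \<open>r\<^sup>2 = 1 - (1 - 2 / p)\<^sup>2\<close> the difference of the two sides is a perfect
  square (\<open>quadratic_form_bound\<close>). The argument is carried out for sums of exponentials of
  real-linear forms, for which all moments are explicit (\<open>laplace_gauss\<close>), with \<open>\<bar>u\<bar>\<^sup>p\<close>
  regularised at \<open>0\<close>. The interval is divided into steps of length \<open>h\<close> with an error of order
  \<open>h powr (3 / 2)\<close> each (\<open>one_step\<close>, \<open>interp_step\<close>, \<open>interp_monotone\<close>), which takes the place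
  of differentiating \<open>F\<close>. Finally, exponential sums approximate every \<open>L\<^sup>p\<close> function well
  enough (\<open>bounded_continuous_expsums_approx\<close>, \<open>Lp_contracted_limit\<close>).
\<close>

section \<open>The Hermitian form\<close>

lemma herm_add_left: "herm (x + y) w = herm x w + herm y w"
  and herm_add_right: "herm w (x + y) = herm w x + herm w y"
  and herm_scale_left: "herm (c *s x) w = c * herm x w"
  and herm_scale_right: "herm w (c *s x) = cnj c * herm w x"
  and herm_scaleR_left: "herm (t *\<^sub>R x) w = of_real t * herm x w"
  and herm_scaleR_right: "herm w (t *\<^sub>R x) = of_real t * herm w x"
  and herm_zero_left [simp]: "herm 0 w = 0"
  and herm_zero_right [simp]: "herm w 0 = 0"
  and cnj_herm: "cnj (herm x w) = herm w x"
  by (auto simp: herm_def sum.distrib algebra_simps sum_distrib_left scaleR_conv_of_real[where 'a=complex]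
      intro!: sum.cong)

lemma herm_sum_left: "herm (\<Sum>i\<in>A. f i) w = (\<Sum>i\<in>A. herm (f i) w)"
  by (induction A rule: infinite_finite_induct) (auto simp: herm_add_left)

lemma herm_sum_right: "herm w (\<Sum>i\<in>A. f i) = (\<Sum>i\<in>A. herm w (f i))"
  by (induction A rule: infinite_finite_induct) (auto simp: herm_add_right)

lemma Re_herm: "Re (herm z w) = z \<bullet> w"
  by (simp add: herm_def inner_vec_def inner_complex_def)

lemma herm_self: "herm z z = of_real ((norm z)\<^sup>2)"
proof (rule complex_eqI)
  show "Re (herm z z) = Re (of_real ((norm z)\<^sup>2))"
    by (simp add: Re_herm power2_norm_eq_inner)
  have "cnj (herm z z) = herm z z" by (rule cnj_herm)
  then have "Im (cnj (herm z z)) = Im (herm z z)" by simp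
  then show "Im (herm z z) = Im (of_real ((norm z)\<^sup>2))" by simp
qed

lemma norm_herm_le: "norm (herm z w) \<le> norm z * norm w"
proof -
  have "norm (herm z w) \<le> (\<Sum>i\<in>UNIV. \<bar>norm (z $ i) * norm (w $ i)\<bar>)"
    unfolding herm_def by (rule order_trans[OF norm_sum]) (simp add: norm_mult)
  also have "\<dots> = (\<Sum>i\<in>UNIV. \<bar>norm (z $ i)\<bar> * \<bar>norm (w $ i)\<bar>)" by simp
  also have "\<dots> \<le> L2_set (\<lambda>i. norm (z $ i)) UNIV * L2_set (\<lambda>i. norm (w $ i)) UNIV"
    by (rule L2_set_mult_ineq)
  finally show ?thesis by (simp add: norm_vec_def)
qed

lemma continuous_on_herm [continuous_intros]:
  assumes "continuous_on S f" "continuous_on S g"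
  shows "continuous_on S (\<lambda>x. herm (f x) (g x))"
  unfolding herm_def using assms by (intro continuous_intros)

lemma borel_measurable_herm [measurable (raw)]:
  assumes [measurable]: "f \<in> borel_measurable M" "g \<in> borel_measurable M"
  shows "(\<lambda>x. herm (f x) (g x)) \<in> borel_measurable M"
proof -
  have c: "continuous_on UNIV (\<lambda>p. herm (fst p) (snd p :: complex ^ 'n))"
    by (intro continuous_intros)
  have "(\<lambda>x. (\<lambda>p. herm (fst p) (snd p)) (f x, g x)) \<in> borel_measurable M"
    by (rule measurable_compose[OF _ borel_measurable_continuous_onI[OF c]]) simp
  then show ?thesis by simp
qed

section \<open>Gaussian measures and their Laplace transform\<close>

text \<open>
  For nonnegative functions no integrability side condition is needed, so that the Gaussian
  changes of variables can be done without knowing that the integrals are finite.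
\<close>

lemma nn_integral_lborel_affine:
  fixes f :: "'a::euclidean_space \<Rightarrow> ennreal"
  assumes [measurable]: "f \<in> borel_measurable borel" and "c \<noteq> 0"
  shows "(\<integral>\<^sup>+x. f x \<partial>lborel) = ennreal (\<bar>c\<bar> ^ DIM('a)) * (\<integral>\<^sup>+x. f (t + c *\<^sub>R x) \<partial>lborel)"
  by (subst lborel_affine[OF \<open>c \<noteq> 0\<close>, of t])
     (simp add: nn_integral_density nn_integral_distr nn_integral_cmult ennreal_power)

lemma nn_integral_gauss_lborel:
  "(\<integral>\<^sup>+x. ennreal (exp (- (norm x)\<^sup>2)) \<partial>(lborel :: (complex ^ 'n::finite) measure))
     = ennreal (pi ^ CARD('n))"
proof -
  have 1: "(\<integral>\<^sup>+x. ennreal (exp (- x\<^sup>2)) \<partial>(lborel :: real measure)) = ennreal (sqrt pi)"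
  proof -
    have "prob_space (density lborel (normal_density 0 (1 / sqrt 2)))"
      by (rule prob_space_normal_density) simp
    then have "(\<integral>\<^sup>+x. ennreal (normal_density 0 (1 / sqrt 2) x) \<partial>lborel) = 1"
      using prob_space.emeasure_space_1 by (force simp: emeasure_density)
    moreover have "normal_density 0 (1 / sqrt 2) x = (1 / sqrt pi) * exp (- x\<^sup>2)" for x
      by (simp add: normal_density_def power_divide)
    ultimately have "(\<integral>\<^sup>+x. ennreal (1 / sqrt pi) * ennreal (exp (- x\<^sup>2)) \<partial>(lborel :: real measure)) = 1"
      by (simp add: ennreal_mult'[symmetric])
    then have "ennreal (1 / sqrt pi) * (\<integral>\<^sup>+x. ennreal (exp (- x\<^sup>2)) \<partial>(lborel :: real measure)) = 1"
      by (simp add: nn_integral_cmult)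
    then have "ennreal (sqrt pi) * (ennreal (1 / sqrt pi) *
        (\<integral>\<^sup>+x. ennreal (exp (- x\<^sup>2)) \<partial>(lborel :: real measure))) = ennreal (sqrt pi)" by simp
    then show ?thesis
      by (simp add: mult.assoc[symmetric] ennreal_mult'[symmetric])
  qed
  have "exp (- (norm x)\<^sup>2) = (\<Prod>b\<in>Basis. exp (- (x \<bullet> b)\<^sup>2))" for x :: "complex ^ 'n"
    by (simp add: exp_sum[symmetric] sum_negf power2_norm_eq_inner)
       (simp add: euclidean_inner[of x x] power2_eq_square)
  then have "(\<integral>\<^sup>+x. ennreal (exp (- (norm x)\<^sup>2)) \<partial>(lborel :: (complex ^ 'n) measure))
     = (\<integral>\<^sup>+x. (\<Prod>b\<in>Basis. ennreal (exp (- (x \<bullet> b)\<^sup>2))) \<partial>(lborel :: (complex ^ 'n) measure))"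
    by (simp add: prod_ennreal)
  also have "\<dots> = (\<Prod>b\<in>(Basis :: (complex ^ 'n) set). ennreal (sqrt pi))"
    by (subst nn_integral_lborel_prod) (simp_all add: 1)
  also have "\<dots> = ennreal (pi ^ CARD('n))"
    using power_mult[of "sqrt pi" 2 "CARD('n)"] by (simp add: ennreal_power mult.commute[of _ 2])
  finally show ?thesis .
qed

lemma sets_gauss_measure [simp, measurable_cong]: "sets (gauss_measure \<beta>) = sets borel"
  and space_gauss_measure [simp]: "space (gauss_measure \<beta>) = UNIV"
  by (simp_all add: gauss_measure_def)

lemma nn_integral_gauss_measure:
  assumes "f \<in> borel_measurable borel"
  shows "(\<integral>\<^sup>+x. f x \<partial>(gauss_measure \<beta> :: (complex ^ 'n::finite) measure))
    = (\<integral>\<^sup>+x. ennreal ((\<beta> / pi) ^ CARD('n) * exp (- \<beta> * (norm x)\<^sup>2)) * f x \<partial>lborel)"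
  using assms by (simp add: gauss_measure_def nn_integral_density)

abbreviation \<gamma> :: "(complex ^ 'n::finite) measure" where
  "\<gamma> \<equiv> gauss_measure 1"

lemma emeasure_gauss_1: "emeasure \<gamma> (UNIV :: (complex ^ 'n::finite) set) = 1"
proof -
  have "emeasure \<gamma> (UNIV :: (complex ^ 'n::finite) set)
     = (\<integral>\<^sup>+x. ennreal ((1 / pi) ^ CARD('n)) * ennreal (exp (- (norm x)\<^sup>2)) \<partial>(lborel :: (complex ^ 'n) measure))"
    by (simp add: gauss_measure_def emeasure_density ennreal_mult')
  also have "\<dots> = ennreal ((1 / pi) ^ CARD('n)) * ennreal (pi ^ CARD('n))"
    by (simp add: nn_integral_cmult nn_integral_gauss_lborel)
  also have "\<dots> = 1"
    by (simp add: ennreal_mult'[symmetric] power_mult_distrib[symmetric] del: power_mult_distrib)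
  finally show ?thesis .
qed

text \<open>
  Dilation reduces every Gaussian measure to the one with parameter \<open>1\<close>, for which each complex
  coordinate has second absolute moment \<open>1\<close>.
\<close>

lemma gauss_measure_eq_distr:
  assumes "\<beta> > 0"
  shows "gauss_measure \<beta> = distr \<gamma> borel (\<lambda>x. (1 / sqrt \<beta>) *\<^sub>R (x :: complex ^ 'n::finite))"
proof (rule measure_eqI)
  fix A :: "(complex ^ 'n) set" assume "A \<in> sets (gauss_measure \<beta>)"
  then have [measurable]: "A \<in> sets borel" by simp
  let ?g = "\<lambda>x :: complex ^ 'n. ennreal ((\<beta> / pi) ^ CARD('n) * exp (- \<beta> * (norm x)\<^sup>2)) * indicator A x"
  have "emeasure (gauss_measure \<beta>) A = (\<integral>\<^sup>+x. ?g x \<partial>lborel)"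
    by (simp add: gauss_measure_def emeasure_density)
  also have "\<dots> = ennreal (\<bar>1 / sqrt \<beta>\<bar> ^ DIM(complex ^ 'n)) * (\<integral>\<^sup>+x. ?g (0 + (1 / sqrt \<beta>) *\<^sub>R x) \<partial>lborel)"
    using assms by (intro nn_integral_lborel_affine) auto
  also have "\<dots> = (\<integral>\<^sup>+x. ennreal (\<bar>1 / sqrt \<beta>\<bar> ^ DIM(complex ^ 'n)) * ?g (0 + (1 / sqrt \<beta>) *\<^sub>R x) \<partial>lborel)"
    by (subst nn_integral_cmult) auto
  also have "\<dots> = (\<integral>\<^sup>+x. ennreal ((1 / pi) ^ CARD('n) * exp (- (norm x)\<^sup>2)) * indicator A ((1 / sqrt \<beta>) *\<^sub>R x) \<partial>lborel)"
  proof (intro nn_integral_cong)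
    fix x :: "complex ^ 'n"
    have "\<bar>1 / sqrt \<beta>\<bar> ^ DIM(complex ^ 'n) * ((\<beta> / pi) ^ CARD('n) * exp (- \<beta> * (norm ((1 / sqrt \<beta>) *\<^sub>R x))\<^sup>2))
      = (1 / pi) ^ CARD('n) * exp (- (norm x)\<^sup>2)"
      using assms power_mult[of "sqrt \<beta>" 2 "CARD('n)"]
      by (simp add: power_divide power_mult_distrib power_mult[symmetric] mult.commute[of _ 2])
    then show "ennreal (\<bar>1 / sqrt \<beta>\<bar> ^ DIM(complex ^ 'n)) * ?g (0 + (1 / sqrt \<beta>) *\<^sub>R x)
      = ennreal ((1 / pi) ^ CARD('n) * exp (- (norm x)\<^sup>2)) * indicator A ((1 / sqrt \<beta>) *\<^sub>R x)"
      by (simp only: add_0_left mult.assoc[symmetric] ennreal_mult'[symmetric] abs_ge_zero zero_le_power)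
  qed
  also have "\<dots> = (\<integral>\<^sup>+x. indicator A ((1 / sqrt \<beta>) *\<^sub>R x) \<partial>\<gamma>)"
    by (subst nn_integral_gauss_measure) auto
  also have "\<dots> = (\<integral>\<^sup>+x. indicator A x \<partial>distr \<gamma> borel (\<lambda>x. (1 / sqrt \<beta>) *\<^sub>R (x :: complex ^ 'n)))"
    by (subst nn_integral_distr) auto
  finally show "emeasure (gauss_measure \<beta>) A = emeasure (distr \<gamma> borel (\<lambda>x. (1 / sqrt \<beta>) *\<^sub>R x)) A"
    by simp
qed simp

lemma prob_space_gauss_measure: "\<beta> > 0 \<Longrightarrow> prob_space (gauss_measure \<beta> :: (complex ^ 'n::finite) measure)"
  by (subst gauss_measure_eq_distr)
     (auto intro!: prob_space.prob_space_distr[OF prob_spaceI] simp: emeasure_gauss_1)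

interpretation gauss: prob_space "\<gamma> :: (complex ^ 'n::finite) measure"
  by (rule prob_space_gauss_measure) simp

lemma integral_gauss_measure:
  fixes f :: "complex ^ 'n::finite \<Rightarrow> 'b::{banach, second_countable_topology}"
  assumes [measurable]: "f \<in> borel_measurable borel" and "\<beta> > 0"
  shows "(\<integral>x. f x \<partial>gauss_measure \<beta>)
     = (\<integral>x. ((\<beta> / pi) ^ CARD('n) * exp (- \<beta> * (norm x)\<^sup>2)) *\<^sub>R f x \<partial>lborel)"
    and "integrable (gauss_measure \<beta>) f
     \<longleftrightarrow> integrable lborel (\<lambda>x. ((\<beta> / pi) ^ CARD('n) * exp (- \<beta> * (norm x)\<^sup>2)) *\<^sub>R f x)"
proof -
  show "(\<integral>x. f x \<partial>gauss_measure \<beta>)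
     = (\<integral>x. ((\<beta> / pi) ^ CARD('n) * exp (- \<beta> * (norm x)\<^sup>2)) *\<^sub>R f x \<partial>lborel)"
    unfolding gauss_measure_def using \<open>\<beta> > 0\<close>
    by (subst integral_density) auto
  show "integrable (gauss_measure \<beta>) f
     \<longleftrightarrow> integrable lborel (\<lambda>x. ((\<beta> / pi) ^ CARD('n) * exp (- \<beta> * (norm x)\<^sup>2)) *\<^sub>R f x)"
    unfolding gauss_measure_def using \<open>\<beta> > 0\<close>
    by (subst integrable_density) auto
qed

lemma fourier_gauss_real:
  "integrable lborel (\<lambda>x::real. exp (- x\<^sup>2) *\<^sub>R cis (t * x))"
  "(\<integral>x. exp (- x\<^sup>2) *\<^sub>R cis (t * x) \<partial>lborel) = sqrt pi * exp (- t\<^sup>2 / 4)"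
proof -
  let ?f = "\<lambda>x. std_normal_density x *\<^sub>R cis (t / sqrt 2 * x)"
  have f: "integrable lborel ?f" "integral\<^sup>L lborel ?f = exp (- t\<^sup>2 / 4)"
  proof -
    interpret real_distribution std_normal_distribution by (rule real_dist_normal_dist)
    have "integrable std_normal_distribution (\<lambda>x. cis (t / sqrt 2 * x))"
      by (rule integrable_const_bound[where B=1]) (auto simp: cis_conv_exp)
    then show "integrable lborel ?f"
      by (subst (asm) integrable_density) (auto simp: cis_conv_exp)
    have "char std_normal_distribution (t / sqrt 2) = exp (- t\<^sup>2 / 4)"
      by (simp add: char_std_normal_distribution power_divide)
    then show "integral\<^sup>L lborel ?f = exp (- t\<^sup>2 / 4)"
      unfolding char_def by (subst (asm) integral_density) (auto simp: cis_conv_exp)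
  qed
  have eq: "?f (0 + sqrt 2 * x) = (1 / sqrt (2 * pi)) *\<^sub>R (exp (- x\<^sup>2) *\<^sub>R cis (t * x))" for x
    by (simp add: std_normal_density_def power_mult_distrib)
  have "integrable lborel (\<lambda>x. ?f (0 + sqrt 2 * x))"
    using f(1) by (rule lborel_integrable_real_affine) simp
  then show "integrable lborel (\<lambda>x::real. exp (- x\<^sup>2) *\<^sub>R cis (t * x))"
    unfolding eq using integrable_scaleR_right[of "sqrt (2 * pi)" lborel] by force
  have "exp (- t\<^sup>2 / 4) = \<bar>sqrt 2\<bar> *\<^sub>R integral\<^sup>L lborel (\<lambda>x. ?f (0 + sqrt 2 * x))"
    unfolding f(2)[symmetric] by (rule lborel_integral_real_affine) simp
  also have "\<dots> = (1 / sqrt pi) *\<^sub>R (\<integral>x. exp (- x\<^sup>2) *\<^sub>R cis (t * x) \<partial>lborel)"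
    unfolding eq integral_scaleR_right by (simp add: real_sqrt_mult)
  finally show "(\<integral>x. exp (- x\<^sup>2) *\<^sub>R cis (t * x) \<partial>lborel) = sqrt pi * exp (- t\<^sup>2 / 4)"
    by (simp add: scaleR_conv_of_real field_simps)
qed

text \<open>
  The density and the character are both products over the real coordinates, so the
  one-dimensional transform suffices.
\<close>

lemma fourier_gauss:
  fixes v :: "complex ^ 'n::finite"
  shows "(\<integral>w. cis (v \<bullet> w) \<partial>\<gamma>) = exp (- (norm v)\<^sup>2 / 4)"
proof -
  let ?B = "Basis :: (complex ^ 'n) set"
  let ?h = "\<lambda>b x. exp (- x\<^sup>2) *\<^sub>R cis ((v \<bullet> b) * x)"
  interpret product_sigma_finite "\<lambda>_::complex ^ 'n. lborel :: real measure" ..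
  have meas[measurable]: "cis \<in> borel_measurable borel"
    by (intro borel_measurable_continuous_onI continuous_intros)
  have prod: "exp (- (norm w)\<^sup>2) *\<^sub>R cis (v \<bullet> w) = (\<Prod>b\<in>?B. ?h b (w \<bullet> b))" for w
  proof -
    have "- (norm w)\<^sup>2 = (\<Sum>b\<in>?B. - (w \<bullet> b)\<^sup>2)"
      unfolding power2_norm_eq_inner euclidean_inner[of w w] by (simp add: sum_negf power2_eq_square)
    moreover have "v \<bullet> w = (\<Sum>b\<in>?B. (v \<bullet> b) * (w \<bullet> b))"
      by (rule euclidean_inner)
    moreover have "cis (\<Sum>b\<in>A. f b) = (\<Prod>b\<in>A. cis (f b))" for A and f :: "complex ^ 'n \<Rightarrow> real"
    proof (induction A rule: infinite_finite_induct)
      case (insert x A)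
      then show ?case using cis_mult[of "f x" "sum f A"] by simp
    qed simp_all
    ultimately show ?thesis
      by (simp add: exp_sum prod.distrib scaleR_conv_of_real)
  qed
  have "(\<integral>w. cis (v \<bullet> w) \<partial>\<gamma>)
     = (\<integral>w. (1 / pi) ^ CARD('n) *\<^sub>R (\<Prod>b\<in>?B. ?h b (w \<bullet> b)) \<partial>lborel)"
    by (subst integral_gauss_measure) (auto simp flip: prod)
  also have "\<dots> = (1 / pi) ^ CARD('n) *\<^sub>R (\<integral>w. (\<Prod>b\<in>?B. ?h b (w \<bullet> b)) \<partial>lborel)"
    by simp
  also have "(\<integral>w. (\<Prod>b\<in>?B. ?h b (w \<bullet> b)) \<partial>lborel)
     = (\<integral>x. (\<Prod>b\<in>?B. ?h b (x b)) \<partial>(\<Pi>\<^sub>M b\<in>?B. lborel))"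
    by (subst lborel_eq, subst integral_distr) (auto simp: inner_sum_left inner_Basis if_distrib cong: if_cong)
  also have "\<dots> = (\<Prod>b\<in>?B. (\<integral>x. ?h b x \<partial>lborel))"
    by (rule product_integral_prod) (auto simp: fourier_gauss_real)
  also have "\<dots> = (\<Prod>b\<in>?B. complex_of_real (sqrt pi)) * (\<Prod>b\<in>?B. exp (- (v \<bullet> b)\<^sup>2 / 4))"
    by (simp add: fourier_gauss_real prod.distrib del: prod_constant)
  also have "(\<Prod>b\<in>?B. complex_of_real (sqrt pi)) = of_real (pi ^ CARD('n))"
    using power_mult[of "sqrt pi" 2 "CARD('n)"] by (simp add: mult.commute[of _ 2] flip: of_real_power)
  also have "(\<Prod>b\<in>?B. exp (- (v \<bullet> b)\<^sup>2 / 4)) = exp (- (norm v)\<^sup>2 / 4)"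
    unfolding power2_norm_eq_inner euclidean_inner[of v v]
    by (simp add: exp_sum[symmetric] sum_negf sum_divide_distrib[symmetric] power2_eq_square)
  finally show ?thesis
    by (simp add: scaleR_conv_of_real power_divide)
qed

text \<open>
  All moments of exponential sums reduce to this integral. The exponent is real-linear in \<open>w\<close>,
  say \<open>u \<bullet> w + \<i> (v \<bullet> w)\<close> with real-linear functionals given by \<open>u = a + b\<close> and \<open>v = \<i> (a -
  b)\<close>. Completing the square removes the real part by the translation \<open>w \<mapsto> w + u / 2\<close> and
  leaves the Fourier transform at \<open>v\<close>. In particular an exponential that is holomorphic in \<open>w\<close>
  (\<open>b = 0\<close>) has mean \<open>1\<close>, which is the mean value property.
\<close>

lemma laplace_gauss:
  fixes a b :: "complex ^ 'n::finite"
  shows "integrable \<gamma> (\<lambda>w. exp (herm w a + herm b w))"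
    and "(\<integral>w. exp (herm w a + herm b w) \<partial>\<gamma>) = exp (herm b a)"
proof -
  define u where "u = a + b"
  define v where "v = \<i> *s (a - b)"
  have meas[measurable]: "cis \<in> borel_measurable borel"
    by (intro borel_measurable_continuous_onI continuous_intros)
  let ?c = "(1 / pi) ^ CARD('n)"
  define G where "G = (\<lambda>w :: complex ^ 'n. (?c * exp (- (norm w)\<^sup>2)) *\<^sub>R cis (v \<bullet> w))"
  define K where "K = exp ((norm u)\<^sup>2 / 4) *\<^sub>R cis (v \<bullet> u / 2)"
  have arg: "herm w a + herm b w = of_real (u \<bullet> w) + \<i> * of_real (v \<bullet> w)" for w
  proof (rule complex_eqI)
    have "Im (herm w a) = (\<i> *s a) \<bullet> w"
      using cnj_herm[of w a] by (simp add: Re_herm[symmetric] herm_scale_left complex_eq_iff)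
    moreover have "Im (herm b w) = - ((\<i> *s b) \<bullet> w)"
      by (simp add: Re_herm[symmetric] herm_scale_left)
    moreover have "v = \<i> *s a - \<i> *s b" unfolding v_def by (simp add: vec_eq_iff right_diff_distrib)
    ultimately show "Im (herm w a + herm b w) = Im (of_real (u \<bullet> w) + \<i> * of_real (v \<bullet> w))"
      by (simp add: inner_diff_left)
    show "Re (herm w a + herm b w) = Re (of_real (u \<bullet> w) + \<i> * of_real (v \<bullet> w))"
      by (simp add: Re_herm u_def inner_add_left inner_commute[of w])
  qed
  have e: "exp (herm w a + herm b w) = exp (u \<bullet> w) *\<^sub>R cis (v \<bullet> w)" for w
    unfolding arg exp_add by (simp add: cis_conv_exp scaleR_conv_of_real exp_of_real)
  have shift: "(?c * exp (- (norm w)\<^sup>2)) *\<^sub>R exp (herm w a + herm b w) = K * G (- (1/2) *\<^sub>R u + w)" for w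
  proof -
    have 1: "(norm (- (1/2) *\<^sub>R u + w))\<^sup>2 = (norm w)\<^sup>2 - u \<bullet> w + (norm u)\<^sup>2 / 4"
      by (simp add: power2_norm_eq_inner algebra_simps inner_commute)
    have 2: "v \<bullet> (- (1/2) *\<^sub>R u + w) = v \<bullet> w - v \<bullet> u / 2"
      by (simp add: algebra_simps)
    have 3: "exp (- (norm w)\<^sup>2) * exp (u \<bullet> w) = exp ((norm u)\<^sup>2 / 4) * exp (- ((norm w)\<^sup>2 - u \<bullet> w + (norm u)\<^sup>2 / 4))"
      by (simp add: exp_add[symmetric])
    have 4: "cis (v \<bullet> w) = cis (v \<bullet> u / 2) * cis (v \<bullet> w - v \<bullet> u / 2)"
      by (simp add: cis_mult)
    have "(?c * exp (- (norm w)\<^sup>2)) *\<^sub>R exp (herm w a + herm b w)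
      = ?c *\<^sub>R (exp (- (norm w)\<^sup>2) * exp (u \<bullet> w)) *\<^sub>R cis (v \<bullet> w)"
      by (simp add: e)
    also have "\<dots> = K * G (- (1/2) *\<^sub>R u + w)"
      unfolding 3 4 G_def K_def 1 2 by simp
    finally show ?thesis .
  qed
  have [measurable]: "G \<in> borel_measurable borel" unfolding G_def by measurable
  have "integrable \<gamma> (\<lambda>w. cis (v \<bullet> w))"
    by (rule gauss.integrable_const_bound[where B=1]) auto
  then have "integrable lborel G"
    by (subst (asm) integral_gauss_measure) (simp_all add: G_def)
  then have "integrable (distr lborel borel ((+) (- (1/2) *\<^sub>R u))) G"
    by (simp only: lborel_distr_plus)
  then have "integrable lborel (\<lambda>w. G (- (1/2) *\<^sub>R u + w))"
    by (subst (asm) integrable_distr_eq) auto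
  then show "integrable \<gamma> (\<lambda>w. exp (herm w a + herm b w))"
    by (subst integral_gauss_measure) (auto simp only: shift minus_mult_left[symmetric] mult_1 zero_less_one
      intro!: integrable_mult_right, measurable)
  have "(\<integral>w. exp (herm w a + herm b w) \<partial>\<gamma>) = (\<integral>w. K * G (- (1/2) *\<^sub>R u + w) \<partial>lborel)"
    unfolding shift[symmetric] by (subst integral_gauss_measure) simp_all
  also have "\<dots> = K * (\<integral>w. G (- (1/2) *\<^sub>R u + w) \<partial>lborel)"
    by simp
  also have "(\<integral>w. G (- (1/2) *\<^sub>R u + w) \<partial>lborel) = integral\<^sup>L (distr lborel borel ((+) (- (1/2) *\<^sub>R u))) G"
    by (subst integral_distr) auto
  also have "\<dots> = (\<integral>w. cis (v \<bullet> w) \<partial>\<gamma>)"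
    unfolding lborel_distr_plus by (subst integral_gauss_measure) (auto simp: G_def)
  also have "K * \<dots> = exp (of_real ((norm u)\<^sup>2 / 4 - (norm v)\<^sup>2 / 4) + \<i> * of_real (v \<bullet> u / 2))"
    unfolding fourier_gauss K_def
    unfolding exp_add exp_of_real cis_conv_exp scaleR_conv_of_real diff_conv_add_uminus exp_add of_real_mult
    by (simp add: mult_ac)
  also have "of_real ((norm u)\<^sup>2 / 4 - (norm v)\<^sup>2 / 4) + \<i> * of_real (v \<bullet> u / 2) = herm b a"
  proof (rule complex_eqI)
    have nv: "(norm v)\<^sup>2 = (norm (a - b))\<^sup>2"
      by (simp add: v_def norm_vec_def L2_set_def norm_mult flip: right_diff_distrib)
    show "Re (of_real ((norm u)\<^sup>2 / 4 - (norm v)\<^sup>2 / 4) + \<i> * of_real (v \<bullet> u / 2)) = Re (herm b a)"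
      unfolding nv by (simp add: u_def power2_norm_eq_inner Re_herm algebra_simps inner_commute add_divide_distrib diff_divide_distrib)
    have "v \<bullet> u = - Im (herm (a - b) (a + b))"
      by (simp only: v_def u_def Re_herm[symmetric] herm_scale_left) simp
    also have "herm (a - b) (a + b) = herm a a + herm a b - herm b a - herm b b"
      using herm_add_left[of "a - b" b "a + b"] by (simp add: herm_add_right)
    also have "- Im \<dots> = 2 * Im (herm b a)"
      using cnj_herm[of a b] by (simp add: herm_self complex_eq_iff)
    finally show "Im (of_real ((norm u)\<^sup>2 / 4 - (norm v)\<^sup>2 / 4) + \<i> * of_real (v \<bullet> u / 2)) = Im (herm b a)"
      by simp
  qed
  finally show "(\<integral>w. exp (herm w a + herm b w) \<partial>\<gamma>) = exp (herm b a)" .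
qed

section \<open>Sums of independent Gaussian vectors\<close>

text \<open>
  The rotation of \<open>(x, y)\<close> that makes \<open>sqrt s x + sqrt h y\<close> a coordinate is carried out as two
  successive affine substitutions, one in each variable. The identity \<open>key\<close> in the proof
  expresses the invariance of \<open>\<bar>x\<bar>\<^sup>2 + \<bar>y\<bar>\<^sup>2\<close> under this rotation, and \<open>h > 0\<close> makes the
  substitutions invertible.
\<close>

lemma nn_integral_gauss_add:
  fixes f :: "complex ^ 'n::finite \<Rightarrow> ennreal"
  assumes [measurable]: "f \<in> borel_measurable borel" and "s \<ge> 0" "h > 0"
  shows "(\<integral>\<^sup>+x. \<integral>\<^sup>+y. f (sqrt s *\<^sub>R x + sqrt h *\<^sub>R y) \<partial>\<gamma> \<partial>\<gamma>)
    = (\<integral>\<^sup>+x. f (sqrt (s + h) *\<^sub>R x) \<partial>\<gamma>)"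
proof -
  define R where "R = sqrt (s + h)"
  define c where "c = sqrt s / R"
  define d where "d = sqrt h / R"
  have R: "R > 0" using assms by (simp add: R_def)
  have d: "d > 0" using assms R by (simp add: d_def)
  have cd: "c\<^sup>2 + d\<^sup>2 = 1"
    using assms by (simp add: c_def d_def R_def power_divide add_divide_distrib[symmetric])
  have sc: "sqrt s = R * c" "sqrt h = R * d" using R by (simp_all add: c_def d_def)
  let ?C = "(1 / pi) ^ CARD('n)" and ?D = "(1 / d) ^ DIM(complex ^ 'n)"
  define g where "g = (\<lambda>t :: complex ^ 'n. f (R *\<^sub>R t))"
  have [measurable]: "g \<in> borel_measurable borel" unfolding g_def by measurable
  define k where "k = (\<lambda>x :: complex ^ 'n. ennreal (?C * exp (- (norm x)\<^sup>2)))"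
  have [measurable]: "k \<in> borel_measurable borel" unfolding k_def by measurable
  have G: "(\<integral>\<^sup>+x. F x \<partial>\<gamma>) = (\<integral>\<^sup>+x. k x * F x \<partial>lborel)"
    if "F \<in> borel_measurable borel" for F :: "complex ^ 'n \<Rightarrow> ennreal"
    using nn_integral_gauss_measure[OF that, of 1] by (simp add: k_def)
  have key: "k x * k ((1 / d) *\<^sub>R (t - c *\<^sub>R x)) = k t * k ((1 / d) *\<^sub>R (x - c *\<^sub>R t))" for x t
  proof -
    have "(norm ((1 / d) *\<^sub>R (t - c *\<^sub>R x)))\<^sup>2 + (norm x)\<^sup>2 = (norm ((1 / d) *\<^sub>R (x - c *\<^sub>R t)))\<^sup>2 + (norm t)\<^sup>2"
    proof -
      have "(norm (t - c *\<^sub>R x))\<^sup>2 + d\<^sup>2 * (norm x)\<^sup>2 = (norm (x - c *\<^sub>R t))\<^sup>2 + d\<^sup>2 * (norm t)\<^sup>2"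
      proof -
        have d2: "d\<^sup>2 = 1 - c\<^sup>2" using cd by simp
        show ?thesis unfolding d2 power2_norm_eq_inner
          by (simp add: algebra_simps inner_commute power2_eq_square)
      qed
      then show ?thesis
        using d unfolding norm_scaleR power_mult_distrib
        by (simp add: power_divide divide_simps) (simp add: algebra_simps del: scaleR_diff_right)
    qed
    then have e: "exp (- (norm x)\<^sup>2) * exp (- (norm ((1 / d) *\<^sub>R (t - c *\<^sub>R x)))\<^sup>2)
        = exp (- (norm t)\<^sup>2) * exp (- (norm ((1 / d) *\<^sub>R (x - c *\<^sub>R t)))\<^sup>2)"
      unfolding exp_add[symmetric] by (intro arg_cong[where f=exp]) linarith
    have "ennreal (?C * A) * ennreal (?C * B) = ennreal (?C\<^sup>2 * (A * B))" if "A \<ge> 0" "B \<ge> 0" for A B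
      using that by (simp add: ennreal_mult'[symmetric] power2_eq_square mult_ac)
    then show ?thesis
      unfolding k_def by (simp only: e exp_ge_zero)
  qed
  have "(\<integral>\<^sup>+x. \<integral>\<^sup>+y. f (sqrt s *\<^sub>R x + sqrt h *\<^sub>R y) \<partial>\<gamma> \<partial>\<gamma>)
    = (\<integral>\<^sup>+x. k x * (\<integral>\<^sup>+y. k y * g (c *\<^sub>R x + d *\<^sub>R y) \<partial>lborel) \<partial>lborel)"
    by (subst G, measurable)
       (auto intro!: nn_integral_cong arg_cong2[where f="(*)"] simp: G g_def sc scaleR_add_right)
  also have "\<dots> = (\<integral>\<^sup>+x. k x * (\<integral>\<^sup>+t. ennreal ?D * (k ((1 / d) *\<^sub>R (t - c *\<^sub>R x)) * g t) \<partial>lborel) \<partial>lborel)"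
  proof (rule nn_integral_cong, rule arg_cong2[where f="(*)"], rule refl)
    fix x :: "complex ^ 'n"
    have eq: "c *\<^sub>R x + d *\<^sub>R (- (c / d) *\<^sub>R x + (1 / d) *\<^sub>R t) = t" 
      "- (c / d) *\<^sub>R x + (1 / d) *\<^sub>R t = (1 / d) *\<^sub>R (t - c *\<^sub>R x)" for t
      using d by (simp_all add: algebra_simps)
    have "(\<integral>\<^sup>+y. k y * g (c *\<^sub>R x + d *\<^sub>R y) \<partial>lborel) = ennreal (\<bar>1 / d\<bar> ^ DIM(complex ^ 'n)) *
       (\<integral>\<^sup>+t. k (- (c / d) *\<^sub>R x + (1 / d) *\<^sub>R t) * g (c *\<^sub>R x + d *\<^sub>R (- (c / d) *\<^sub>R x + (1 / d) *\<^sub>R t)) \<partial>lborel)"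
      using d by (intro nn_integral_lborel_affine) auto
    also have "\<dots> = ennreal ?D * (\<integral>\<^sup>+t. k ((1 / d) *\<^sub>R (t - c *\<^sub>R x)) * g t \<partial>lborel)"
      unfolding eq using d by simp
    finally show "(\<integral>\<^sup>+y. k y * g (c *\<^sub>R x + d *\<^sub>R y) \<partial>lborel)
       = (\<integral>\<^sup>+t. ennreal ?D * (k ((1 / d) *\<^sub>R (t - c *\<^sub>R x)) * g t) \<partial>lborel)"
      by (simp add: nn_integral_cmult)
  qed
  also have "\<dots> = (\<integral>\<^sup>+x. \<integral>\<^sup>+t. ennreal ?D * (k x * k ((1 / d) *\<^sub>R (t - c *\<^sub>R x))) * g t \<partial>lborel \<partial>lborel)"
    by (intro nn_integral_cong, subst nn_integral_cmult[symmetric]) (auto simp: mult_ac)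
  also have "\<dots> = (\<integral>\<^sup>+t. \<integral>\<^sup>+x. ennreal ?D * (k x * k ((1 / d) *\<^sub>R (t - c *\<^sub>R x))) * g t \<partial>lborel \<partial>lborel)"
    by (rule lborel_pair.Fubini'[symmetric]) measurable
  also have "\<dots> = (\<integral>\<^sup>+t. k t * g t * (ennreal ?D * (\<integral>\<^sup>+x. k ((1 / d) *\<^sub>R (x - c *\<^sub>R t)) \<partial>lborel)) \<partial>lborel)"
    unfolding key by (subst nn_integral_cmult[symmetric], measurable, subst nn_integral_cmult[symmetric], measurable)
       (simp add: mult_ac)
  also have "\<dots> = (\<integral>\<^sup>+t. k t * g t \<partial>lborel)"
  proof (intro nn_integral_cong)
    fix t :: "complex ^ 'n"
    have "1 = (\<integral>\<^sup>+x. k x \<partial>lborel)"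
      using G[of "\<lambda>_. 1"] by (simp add: emeasure_gauss_1)
    also have "\<dots> = ennreal (\<bar>1 / d\<bar> ^ DIM(complex ^ 'n)) *
       (\<integral>\<^sup>+x. k (- (c / d) *\<^sub>R t + (1 / d) *\<^sub>R x) \<partial>lborel)"
      using d by (intro nn_integral_lborel_affine) auto
    also have "(\<lambda>x. k (- (c / d) *\<^sub>R t + (1 / d) *\<^sub>R x)) = (\<lambda>x. k ((1 / d) *\<^sub>R (x - c *\<^sub>R t)))"
      using d by (simp add: algebra_simps)
    finally have "ennreal ?D * (\<integral>\<^sup>+x. k ((1 / d) *\<^sub>R (x - c *\<^sub>R t)) \<partial>lborel) = 1"
      using d by simp
    then show "k t * g t * (ennreal ?D * (\<integral>\<^sup>+x. k ((1 / d) *\<^sub>R (x - c *\<^sub>R t)) \<partial>lborel)) = k t * g t"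
      by simp
  qed
  also have "\<dots> = (\<integral>\<^sup>+x. f (sqrt (s + h) *\<^sub>R x) \<partial>\<gamma>)"
    by (subst G) (auto simp: g_def R_def)
  finally show ?thesis .
qed

section \<open>A smooth substitute for the p-th power of the modulus\<close>

text \<open>
  The function \<open>u \<mapsto> \<bar>u\<bar>\<^sup>p\<close> is in general not smooth at the origin. Adding \<open>\<epsilon>\<close> inside makes it
  smooth, with third derivatives controlled by its own growth, and, as it turns out, does not
  spoil the quadratic-form inequality on which the theorem rests.
\<close>

definition regnorm :: "real \<Rightarrow> real \<Rightarrow> complex \<Rightarrow> real" where
  "regnorm \<epsilon> p u = ((norm u)\<^sup>2 + \<epsilon>) powr (p / 2)"

text \<open>
  Put \<open>\<psi>(s) = (s + \<epsilon>) powr (p / 2)\<close>, so that \<open>regnorm\<close> is \<open>\<psi>(\<bar>u\<bar>\<^sup>2)\<close>. The next three functions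
  are \<open>\<psi>'\<close>, \<open>\<psi>''\<close> and \<open>\<psi>' + \<psi>'' \<bar>u\<bar>\<^sup>2\<close> at \<open>\<bar>u\<bar>\<^sup>2\<close>. The last one is the mixed Wirtinger
  derivative of \<open>regnorm\<close>, a quarter of its Laplacian, and \<open>anti_coeff\<close> times \<open>(cnj u)\<^sup>2\<close> is
  its second holomorphic derivative.
\<close>

definition lin_coeff :: "real \<Rightarrow> real \<Rightarrow> complex \<Rightarrow> real" where
  "lin_coeff \<epsilon> p u = p / 2 * ((norm u)\<^sup>2 + \<epsilon>) powr (p / 2 - 1)"

definition anti_coeff :: "real \<Rightarrow> real \<Rightarrow> complex \<Rightarrow> real" where
  "anti_coeff \<epsilon> p u = p / 2 * (p / 2 - 1) * ((norm u)\<^sup>2 + \<epsilon>) powr (p / 2 - 2)"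

definition lap_coeff :: "real \<Rightarrow> real \<Rightarrow> complex \<Rightarrow> real" where
  "lap_coeff \<epsilon> p u = lin_coeff \<epsilon> p u + anti_coeff \<epsilon> p u * (norm u)\<^sup>2"

lemma regnorm_nonneg [simp]: "regnorm \<epsilon> p u \<ge> 0"
  by (simp add: regnorm_def)

lemma regnorm_le:
  assumes "0 < \<epsilon>" "\<epsilon> \<le> 1" "0 \<le> p" "norm u \<le> s"
  shows "regnorm \<epsilon> p u \<le> (1 + s) powr p"
proof -
  have s: "0 \<le> s" using assms(4) norm_ge_zero[of u] by linarith
  have "(norm u)\<^sup>2 \<le> s\<^sup>2" using assms by (simp add: power_mono)
  then have "(norm u)\<^sup>2 + \<epsilon> \<le> (1 + s)\<^sup>2"
    using assms s by (simp add: power2_eq_square algebra_simps)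
  then have "regnorm \<epsilon> p u \<le> ((1 + s)\<^sup>2) powr (p / 2)"
    unfolding regnorm_def using assms by (intro powr_mono2) auto
  also have "\<dots> = (1 + s) powr p"
    using s by (simp add: powr_powr flip: powr_numeral)
  finally show ?thesis .
qed

text \<open>
  Taylor's formula along the segment from \<open>u\<close> to \<open>u + d\<close>, where \<open>regnorm\<close> is a power of the
  quadratic polynomial \<open>Q\<close>. The first derivative \<open>Q1\<close> of \<open>Q\<close> is at most \<open>2 \<bar>d\<bar> sqrt Q\<close>, so the
  third derivative of the power is at most a multiple of \<open>\<bar>d\<bar>\<^sup>3 Q powr ((p - 3) / 2)\<close>, and \<open>Q \<ge>
  \<epsilon>\<close> bounds the missing power.
\<close>

lemma regnorm_taylor:
  assumes \<epsilon>: "0 < \<epsilon>" "\<epsilon> \<le> 1" and p: "0 \<le> p"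
  shows "\<exists>M\<ge>0. \<forall>u d. \<bar>regnorm \<epsilon> p (u + d) - (regnorm \<epsilon> p u + 2 * lin_coeff \<epsilon> p u * Re (cnj u * d)
      + lap_coeff \<epsilon> p u * (norm d)\<^sup>2 + anti_coeff \<epsilon> p u * Re ((cnj u)\<^sup>2 * d\<^sup>2))\<bar>
      \<le> M * (1 + norm u + norm d) powr p * norm d ^ 3"
proof -
  define q where "q = p / 2"
  define C1 where "C1 = \<bar>q * (q - 1) * (q - 2)\<bar>"
  define C2 where "C2 = \<bar>q * (q - 1)\<bar>"
  define M where "M = (8 * C1 + 12 * C2) * \<epsilon> powr (- 3 / 2)"
  have M0: "M \<ge> 0" by (simp add: M_def C1_def C2_def)
  have "\<bar>regnorm \<epsilon> p (u + d) - (regnorm \<epsilon> p u + 2 * lin_coeff \<epsilon> p u * Re (cnj u * d)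
      + lap_coeff \<epsilon> p u * (norm d)\<^sup>2 + anti_coeff \<epsilon> p u * Re ((cnj u)\<^sup>2 * d\<^sup>2))\<bar>
      \<le> M * (1 + norm u + norm d) powr p * norm d ^ 3" for u d :: complex
  proof -
    define Q where "Q = (\<lambda>t. (norm (u + of_real t * d))\<^sup>2 + \<epsilon>)"
    define B where "B = Re (cnj u * d)"
    define Q1 where "Q1 = (\<lambda>t. 2 * B + 2 * t * (norm d)\<^sup>2)"
    have Qeq: "Q t = (norm u)\<^sup>2 + 2 * B * t + t\<^sup>2 * (norm d)\<^sup>2 + \<epsilon>" for t
      unfolding Q_def B_def cmod_power2 by (simp add: algebra_simps power2_eq_square)
    have Qpos: "Q t \<ge> \<epsilon>" "Q t > 0" for t
      using \<epsilon> by (simp_all add: Q_def add_nonneg_pos)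
    have dQ: "(Q has_real_derivative Q1 t) (at t)" for t
      unfolding Qeq[abs_def] Q1_def by (auto intro!: derivative_eq_intros simp: power2_eq_square)
    have dQ1: "(Q1 has_real_derivative 2 * (norm d)\<^sup>2) (at t)" for t
      unfolding Q1_def by (auto intro!: derivative_eq_intros)
    have dP: "((\<lambda>t. Q t powr r) has_real_derivative r * Q t powr (r - 1) * Q1 t) (at t)" for t r
      by (rule derivative_eq_intros dQ | simp add: Qpos)+
    define D where "D = (\<lambda>m::nat. if m = 0 then (\<lambda>t. Q t powr q)
      else if m = 1 then (\<lambda>t. q * Q t powr (q - 1) * Q1 t)
      else if m = 2 then (\<lambda>t. q * (q - 1) * Q t powr (q - 2) * (Q1 t)\<^sup>2 + q * Q t powr (q - 1) * (2 * (norm d)\<^sup>2))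
      else (\<lambda>t. q * (q - 1) * (q - 2) * Q t powr (q - 3) * Q1 t ^ 3
          + 3 * (q * (q - 1)) * Q t powr (q - 2) * Q1 t * (2 * (norm d)\<^sup>2)))"
    have D0: "D 0 = (\<lambda>t. Q t powr q)" 
      and D1: "D 1 = (\<lambda>t. q * Q t powr (q - 1) * Q1 t)"
      and D2: "D 2 = (\<lambda>t. q * (q - 1) * Q t powr (q - 2) * (Q1 t)\<^sup>2 + q * Q t powr (q - 1) * (2 * (norm d)\<^sup>2))"
      and D3: "D 3 = (\<lambda>t. q * (q - 1) * (q - 2) * Q t powr (q - 3) * Q1 t ^ 3
          + 3 * (q * (q - 1)) * Q t powr (q - 2) * Q1 t * (2 * (norm d)\<^sup>2))"
      by (simp_all add: D_def)
    have der0: "(D 0 has_real_derivative D 1 t) (at t)" for t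
      unfolding D0 D1 by (rule dP)
    have der1: "(D 1 has_real_derivative D 2 t) (at t)" for t
      unfolding D1 D2
      by (rule derivative_eq_intros dP dQ1 refl | simp add: Qpos)+ (simp add: algebra_simps power2_eq_square)
    have der2: "(D 2 has_real_derivative D 3 t) (at t)" for t
      unfolding D2 D3
      by (rule derivative_eq_intros dP dQ1 refl | simp add: Qpos)+
         (simp add: algebra_simps power2_eq_square power3_eq_cube)
    have "\<forall>m t. m < 3 \<and> 0 \<le> t \<and> t \<le> 1 \<longrightarrow> (D m has_real_derivative D (Suc m) t) (at t)"
    proof (intro allI impI)
      fix m :: nat and t :: real assume "m < 3 \<and> 0 \<le> t \<and> t \<le> 1"
      then have "m = 0 \<or> m = 1 \<or> m = 2" by auto
      then show "(D m has_real_derivative D (Suc m) t) (at t)"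
        using der0[of t] der1[of t] der2[of t] by (auto simp: numeral_2_eq_2 numeral_3_eq_3)
    qed
    then obtain t where t: "0 < t" "t < 1"
      and eq: "D 0 1 = (\<Sum>m<3. D m 0 / fact m * 1 ^ m) + D 3 t / fact 3 * 1 ^ 3"
      using Maclaurin[of 1 3 D "D 0"] by auto
    have s3: "(\<Sum>m<3. D m 0 / fact m * 1 ^ m) = D 0 0 + D 1 0 + D 2 0 / 2"
      by (simp add: numeral_3_eq_3 numeral_2_eq_2)
    \<comment> \<open>Splits the square of a real part into its Hermitian and its holomorphic half.\<close>
    have B2: "2 * B\<^sup>2 = (norm u)\<^sup>2 * (norm d)\<^sup>2 + Re ((cnj u)\<^sup>2 * d\<^sup>2)"
      unfolding B_def cmod_power2 by (simp add: power2_eq_square algebra_simps)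
    have Q0: "Q 0 = (norm u)\<^sup>2 + \<epsilon>" by (simp add: Q_def)
    have main: "D 0 0 + D 1 0 + D 2 0 / 2 = regnorm \<epsilon> p u + 2 * lin_coeff \<epsilon> p u * Re (cnj u * d)
      + lap_coeff \<epsilon> p u * (norm d)\<^sup>2 + anti_coeff \<epsilon> p u * Re ((cnj u)\<^sup>2 * d\<^sup>2)"
    proof -
      have "D 2 0 / 2 = anti_coeff \<epsilon> p u * (2 * B\<^sup>2) + lin_coeff \<epsilon> p u * (norm d)\<^sup>2"
        by (simp add: D2 Q1_def anti_coeff_def lin_coeff_def Q0 q_def power2_eq_square)
      then show ?thesis
        unfolding B2 by (simp add: D0 D1[unfolded One_nat_def] Q0 Q1_def regnorm_def lin_coeff_def lap_coeff_def q_def B_def algebra_simps)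
    qed
    have Q1le: "\<bar>Q1 t\<bar> \<le> 2 * norm d * sqrt (Q t)"
    proof -
      have "Q1 t = 2 * Re (cnj (u + of_real t * d) * d)"
        unfolding Q1_def B_def cmod_power2 by (simp add: algebra_simps power2_eq_square)
      moreover have "\<bar>Re (cnj (u + of_real t * d) * d)\<bar> \<le> norm (cnj (u + of_real t * d) * d)"
        by (rule abs_Re_le_cmod)
      moreover have "norm (cnj (u + of_real t * d) * d) \<le> sqrt (Q t) * norm d"
        unfolding norm_mult complex_mod_cnj Q_def using \<epsilon>
        by (intro mult_right_mono real_le_rsqrt) auto
      ultimately have "\<bar>Re (cnj (u + of_real t * d) * d)\<bar> \<le> norm d * sqrt (Q t)"
        and "\<bar>Q1 t\<bar> = 2 * \<bar>Re (cnj (u + of_real t * d) * d)\<bar>"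
        by (simp_all only: abs_mult mult.commute[of "norm d"] order_trans)
      then show ?thesis by linarith
    qed
    have Qh: "sqrt (Q t) = Q t powr (1/2)" using Qpos[of t] by (simp add: powr_half_sqrt)
    have b3: "\<bar>D 3 t\<bar> \<le> (8 * C1 + 12 * C2) * norm d ^ 3 * Q t powr (q - 3/2)"
    proof -
      have e1: "Q t powr (q - 3) * (sqrt (Q t)) ^ 3 = Q t powr (q - 3/2)"
        unfolding Qh using Qpos[of t] by (simp add: powr_powr powr_add[symmetric] flip: powr_realpow)
      have e2: "Q t powr (q - 2) * sqrt (Q t) = Q t powr (q - 3/2)"
        unfolding Qh using Qpos[of t] by (simp add: powr_add[symmetric])
      have "\<bar>q * (q - 1) * (q - 2) * Q t powr (q - 3) * Q1 t ^ 3\<bar> = C1 * Q t powr (q - 3) * \<bar>Q1 t\<bar> ^ 3"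
        by (simp add: C1_def abs_mult power_abs)
      also have "\<dots> \<le> C1 * Q t powr (q - 3) * (2 * norm d * sqrt (Q t)) ^ 3"
        using Q1le by (intro mult_left_mono power_mono) (auto simp: C1_def)
      also have "\<dots> = 8 * C1 * norm d ^ 3 * (Q t powr (q - 3) * (sqrt (Q t)) ^ 3)"
        by (simp add: power_mult_distrib mult_ac)
      finally have 1: "\<bar>q * (q - 1) * (q - 2) * Q t powr (q - 3) * Q1 t ^ 3\<bar> \<le> 8 * C1 * norm d ^ 3 * Q t powr (q - 3/2)"
        unfolding e1 .
      have "\<bar>3 * (q * (q - 1)) * Q t powr (q - 2) * Q1 t * (2 * (norm d)\<^sup>2)\<bar> = 6 * C2 * (norm d)\<^sup>2 * Q t powr (q - 2) * \<bar>Q1 t\<bar>"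
        by (simp add: C2_def abs_mult)
      also have "\<dots> \<le> 6 * C2 * (norm d)\<^sup>2 * Q t powr (q - 2) * (2 * norm d * sqrt (Q t))"
        using Q1le by (intro mult_left_mono) (auto simp: C2_def)
      also have "\<dots> = 12 * C2 * norm d ^ 3 * (Q t powr (q - 2) * sqrt (Q t))"
        by (simp add: power2_eq_square power3_eq_cube mult_ac)
      finally have 2: "\<bar>3 * (q * (q - 1)) * Q t powr (q - 2) * Q1 t * (2 * (norm d)\<^sup>2)\<bar> \<le> 12 * C2 * norm d ^ 3 * Q t powr (q - 3/2)"
        unfolding e2 .
      have "\<bar>D 3 t\<bar> \<le> 8 * C1 * norm d ^ 3 * Q t powr (q - 3/2) + 12 * C2 * norm d ^ 3 * Q t powr (q - 3/2)"
        unfolding D3 by (rule order_trans[OF abs_triangle_ineq add_mono[OF 1 2]])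
      then show ?thesis by (simp add: algebra_simps)
    qed
    have Qq: "Q t powr (q - 3/2) \<le> (1 + norm u + norm d) powr p * \<epsilon> powr (- 3/2)"
    proof -
      have "norm (u + of_real t * d) \<le> norm u + t * norm d"
        using t norm_triangle_ineq[of u "of_real t * d"] by (simp add: norm_mult)
      also have "\<dots> \<le> norm u + norm d" using t by (simp add: mult_left_le_one_le)
      finally have "regnorm \<epsilon> p (u + of_real t * d) \<le> (1 + (norm u + norm d)) powr p"
        by (intro regnorm_le \<epsilon> p)
      then have "Q t powr q \<le> (1 + norm u + norm d) powr p"
        by (simp add: regnorm_def Q_def q_def add.assoc)
      moreover have "Q t powr (- 3/2) \<le> \<epsilon> powr (- 3/2)"
        using Qpos[of t] \<epsilon> by (intro powr_mono2') auto
      moreover have "Q t powr (q - 3/2) = Q t powr q * Q t powr (- 3/2)"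
        by (simp add: powr_add[symmetric])
      ultimately show ?thesis by (simp add: mult_mono)
    qed
    have "\<bar>D 3 t / 6\<bar> \<le> (8 * C1 + 12 * C2) * norm d ^ 3 * Q t powr (q - 3/2)"
      using b3 by simp
    also have "\<dots> \<le> (8 * C1 + 12 * C2) * norm d ^ 3 * ((1 + norm u + norm d) powr p * \<epsilon> powr (- 3/2))"
      using Qq by (intro mult_left_mono) (auto simp: C1_def C2_def)
    finally have fin: "\<bar>D 3 t / 6\<bar> \<le> M * (1 + norm u + norm d) powr p * norm d ^ 3"
      by (simp add: M_def mult_ac)
    have "regnorm \<epsilon> p (u + d) = D 0 1" by (simp add: D0 Q_def regnorm_def q_def)
    also have "\<dots> = D 0 0 + D 1 0 + D 2 0 / 2 + D 3 t / 6"
      unfolding eq s3 by (simp add: fact_numeral)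
    finally show ?thesis unfolding main using fin by simp
  qed
  then show ?thesis using M0 by blast
qed

text \<open>
  This is where the value of the dilation comes from. With \<open>q = p / 2\<close> and \<open>\<rho> = \<bar>1 - 2 / p\<bar>\<close>
  the coefficients satisfy \<open>\<bar>anti_coeff\<bar> \<bar>u\<bar>\<^sup>2 \<le> \<rho> lap_coeff\<close>, which for \<open>\<epsilon> = 0\<close> is an
  equality. Hence the mixed term is absorbed by \<open>2 \<rho> x y \<le> x\<^sup>2 + \<rho>\<^sup>2 y\<^sup>2\<close>, and what is left of
  \<open>y\<^sup>2\<close> is \<open>(1 - \<rho>\<^sup>2) y\<^sup>2 = (r y)\<^sup>2\<close>. In the application \<open>y\<close> and \<open>x\<close> are the lengths of the
  holomorphic and the antiholomorphic gradient of a function, \<open>X\<close> is their product, and \<open>r y\<close>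
  is the length of the gradient of the dilated holomorphic part.
\<close>

lemma quadratic_form_bound:
  assumes \<epsilon>: "0 < \<epsilon>" and p: "1 \<le> p" and r: "r\<^sup>2 = 1 - (1 - 2 / p)\<^sup>2"
    and X: "norm X \<le> x * y" and "0 \<le> x" "0 \<le> y"
  shows "lap_coeff \<epsilon> p u * (r * y)\<^sup>2 \<le>
     lap_coeff \<epsilon> p u * (x\<^sup>2 + y\<^sup>2) + 2 * anti_coeff \<epsilon> p u * Re ((cnj u)\<^sup>2 * X)"
proof -
  define q where "q = p / 2"
  define t where "t = (norm u)\<^sup>2"
  define Q where "Q = t + \<epsilon>"
  define R where "R = Q powr (q - 2)"
  define \<rho> where "\<rho> = \<bar>1 - 2 / p\<bar>"
  have q: "q > 0" using p by (simp add: q_def)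
  have Q: "Q > 0" "t \<le> Q" "0 \<le> t" using \<epsilon> by (simp_all add: Q_def t_def add_nonneg_pos)
  have R: "R \<ge> 0" by (simp add: R_def)
  have a: "anti_coeff \<epsilon> p u = q * (q - 1) * R"
    by (simp add: anti_coeff_def q_def R_def Q_def t_def)
  have "Q powr (q - 1) = Q powr ((q - 2) + 1)" by simp
  also have "\<dots> = R * Q" unfolding R_def powr_add using Q by simp
  finally have "lin_coeff \<epsilon> p u = q * (R * Q)"
    by (simp add: lin_coeff_def q_def Q_def t_def)
  then have c: "lap_coeff \<epsilon> p u = q * R * (Q + (q - 1) * t)"
    unfolding lap_coeff_def a t_def[symmetric] by (simp add: algebra_simps)
  have \<rho>: "\<rho> = \<bar>q - 1\<bar> / q"
    using p by (simp add: \<rho>_def q_def abs_if field_simps)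
  have "0 \<le> Q - t + q * t" using Q q by simp
  then have c0: "lap_coeff \<epsilon> p u \<ge> 0" unfolding c using q R by (intro mult_nonneg_nonneg) (auto simp: algebra_simps)
  have key: "\<bar>anti_coeff \<epsilon> p u\<bar> * t \<le> \<rho> * lap_coeff \<epsilon> p u"
  proof -
    have "\<bar>q - 1\<bar> * R * (q * t) \<le> \<bar>q - 1\<bar> * R * (Q + (q - 1) * t)"
      using Q R by (intro mult_left_mono) (auto simp: algebra_simps)
    moreover have "\<bar>q * (q - 1) * R\<bar> * t = \<bar>q - 1\<bar> * R * (q * t)"
      using q R by (simp add: abs_mult)
    moreover have "\<bar>q - 1\<bar> / q * (q * R * (Q + (q - 1) * t)) = \<bar>q - 1\<bar> * R * (Q + (q - 1) * t)"
      using q by simp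
    ultimately show ?thesis unfolding a c \<rho> by linarith
  qed
  have "\<bar>Re ((cnj u)\<^sup>2 * X)\<bar> \<le> norm ((cnj u)\<^sup>2 * X)" by (rule abs_Re_le_cmod)
  also have "\<dots> = t * norm X" by (simp add: norm_mult norm_power t_def)
  also have "\<dots> \<le> t * (x * y)" using X Q by (intro mult_left_mono)
  finally have ReX: "\<bar>Re ((cnj u)\<^sup>2 * X)\<bar> \<le> t * (x * y)" .
  have "\<bar>2 * anti_coeff \<epsilon> p u * Re ((cnj u)\<^sup>2 * X)\<bar> \<le> 2 * \<bar>anti_coeff \<epsilon> p u\<bar> * (t * (x * y))"
    unfolding abs_mult using ReX by (intro mult_mono) auto
  also have "\<dots> = 2 * (\<bar>anti_coeff \<epsilon> p u\<bar> * t) * (x * y)" by simp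
  also have "\<dots> \<le> 2 * (\<rho> * lap_coeff \<epsilon> p u) * (x * y)"
    using key assms by (intro mult_right_mono mult_left_mono) auto
  also have "\<dots> = lap_coeff \<epsilon> p u * (2 * x * (\<rho> * y))" by simp
  also have "\<dots> \<le> lap_coeff \<epsilon> p u * (x\<^sup>2 + (\<rho> * y)\<^sup>2)"
    using c0 sum_squares_bound[of x "\<rho> * y"] by (intro mult_left_mono) auto
  finally have "- (lap_coeff \<epsilon> p u * (x\<^sup>2 + (\<rho> * y)\<^sup>2)) \<le> 2 * anti_coeff \<epsilon> p u * Re ((cnj u)\<^sup>2 * X)"
    by linarith
  moreover have "(r * y)\<^sup>2 = y\<^sup>2 - (\<rho> * y)\<^sup>2"
    unfolding power_mult_distrib r \<rho>_def by (simp add: algebra_simps)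
  ultimately show ?thesis by (simp only: distrib_left right_diff_distrib)
qed

section \<open>Moments of small exponential increments\<close>

lemma norm_exp_minus_one_le:
  fixes x :: complex
  shows "norm (exp x - 1) \<le> norm x * exp (norm x)"
proof -
  have "norm (exp x - exp 0) \<le> exp (norm x) * norm (x - 0)"
  proof (intro field_differentiable_bound[where S="cball 0 (norm x)" and f'=exp])
    show "norm (exp y) \<le> exp (norm x)" if "y \<in> cball 0 (norm x)" for y :: complex
      using that norm_exp[of y] by (auto intro: order_trans)
  qed (auto intro!: derivative_eq_intros)
  then show ?thesis by (simp add: mult.commute)
qed

lemma norm_exp_minus_one_minus_le:
  fixes x :: complex
  shows "norm (exp x - 1 - x) \<le> (norm x)\<^sup>2 * exp (norm x)"
proof -
  have "norm ((exp x - x) - (exp 0 - 0)) \<le> (norm x * exp (norm x)) * norm (x - 0)"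
  proof (intro field_differentiable_bound[where S="cball 0 (norm x)" and f'="\<lambda>y. exp y - 1" and f="\<lambda>y. exp y - y"])
    show "norm (exp y - 1) \<le> norm x * exp (norm x)" if "y \<in> cball 0 (norm x)" for y :: complex
      using that norm_exp_minus_one_le[of y]
      by (auto intro!: order_trans[OF norm_exp_minus_one_le] mult_mono)
  qed (auto intro!: derivative_eq_intros)
  then show ?thesis by (simp add: mult_ac power2_eq_square diff_diff_eq add.commute)
qed

lemma integrable_exp_norm_gauss:
  "integrable (\<gamma> :: (complex ^ 'n::finite) measure) (\<lambda>w. exp (c * norm w))"
proof -
  let ?L = "lborel :: (complex ^ 'n) measure"
  let ?k = "\<lambda>b w :: complex ^ 'n. (b / pi) ^ CARD('n) * exp (- b * (norm w)\<^sup>2)"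
  have int: "(\<integral>\<^sup>+w. ennreal (exp (c * norm w)) \<partial>(\<gamma> :: (complex ^ 'n) measure))
     \<le> (\<integral>\<^sup>+w. ennreal (2 ^ CARD('n) * exp (c\<^sup>2 / 2)) * ennreal (?k (1/2) w) \<partial>?L)"
  proof (subst nn_integral_gauss_measure, simp, intro nn_integral_mono)
    fix w :: "complex ^ 'n"
    have "0 \<le> (c - norm w)\<^sup>2" by simp
    then have "- (norm w)\<^sup>2 + c * norm w \<le> c\<^sup>2 / 2 - 1 / 2 * (norm w)\<^sup>2"
      by (simp add: power2_eq_square algebra_simps)
    then have "exp (- (norm w)\<^sup>2) * exp (c * norm w) \<le> exp (c\<^sup>2 / 2) * exp (- (1 / 2) * (norm w)\<^sup>2)"
      unfolding exp_add[symmetric] by (simp add: algebra_simps)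
    then have "(1 / pi) ^ CARD('n) * (exp (- (norm w)\<^sup>2) * exp (c * norm w))
       \<le> (1 / pi) ^ CARD('n) * (exp (c\<^sup>2 / 2) * exp (- (1 / 2) * (norm w)\<^sup>2))"
      by (intro mult_left_mono) auto
    also have "(1 / pi) ^ CARD('n) = 2 ^ CARD('n) * (1/2 / pi) ^ CARD('n)"
      by (simp add: power_mult_distrib[symmetric])
    finally show "ennreal (?k 1 w) * ennreal (exp (c * norm w))
       \<le> ennreal (2 ^ CARD('n) * exp (c\<^sup>2 / 2)) * ennreal (?k (1/2) w)"
      by (simp add: ennreal_mult'[symmetric] mult_ac power_divide)
  qed
  also have "\<dots> = ennreal (2 ^ CARD('n) * exp (c\<^sup>2 / 2)) * (\<integral>\<^sup>+w. 1 \<partial>(gauss_measure (1/2) :: (complex ^ 'n) measure))"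
    by (subst nn_integral_gauss_measure) (simp_all add: nn_integral_cmult)
  also have "(\<integral>\<^sup>+w. 1 \<partial>(gauss_measure (1/2) :: (complex ^ 'n) measure)) = 1"
    using prob_space.emeasure_space_1[OF prob_space_gauss_measure[of "1/2"]] by simp
  finally have "(\<integral>\<^sup>+w. ennreal (exp (c * norm w)) \<partial>(\<gamma> :: (complex ^ 'n) measure)) < \<infinity>"
    by (simp add: order_le_less_trans)
  then show ?thesis
    by (intro integrableI_nonneg) auto
qed

definition exp_sum :: "nat \<Rightarrow> (nat \<Rightarrow> complex) \<Rightarrow> (nat \<Rightarrow> complex ^ 'n::finite) \<Rightarrow> (nat \<Rightarrow> complex ^ 'n)
    \<Rightarrow> complex ^ 'n \<Rightarrow> complex" where
  "exp_sum m A a b w = (\<Sum>i<m. A i * exp (herm w (a i) + herm (b i) w))"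

lemma borel_measurable_exp_sum [measurable]: "exp_sum m A a b \<in> borel_measurable borel"
  unfolding exp_sum_def by measurable

text \<open>
  The deviation from the value at the origin of an exponential sum with an extra factor \<open>exp (h
  k)\<close>, evaluated at a Gaussian vector of variance \<open>h\<close>. Both sides of the comparison below are
  of this form and differ only in \<open>a\<close>, \<open>b\<close> and \<open>k\<close>.
\<close>

definition incr :: "real \<Rightarrow> nat \<Rightarrow> (nat \<Rightarrow> complex) \<Rightarrow> (nat \<Rightarrow> complex ^ 'n::finite) \<Rightarrow> (nat \<Rightarrow> complex ^ 'n)
    \<Rightarrow> (nat \<Rightarrow> complex) \<Rightarrow> complex ^ 'n \<Rightarrow> complex" where
  "incr h m A a b k \<zeta> = (\<Sum>i<m. A i * (exp (h * k i + sqrt h * (herm \<zeta> (a i) + herm (b i) \<zeta>)) - 1))"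

lemma borel_measurable_incr [measurable]: "incr h m A a b k \<in> borel_measurable borel"
  unfolding incr_def by measurable

lemma cnj_incr: "cnj (incr h m A a b k \<zeta>) = incr h m (\<lambda>i. cnj (A i)) b a (\<lambda>i. cnj (k i)) \<zeta>"
  by (simp add: incr_def exp_cnj cnj_herm add.commute)

lemma laplace_gauss_scaled:
  fixes a b :: "complex ^ 'n::finite"
  assumes "h \<ge> 0"
  shows "integrable \<gamma> (\<lambda>w. exp (of_real h * k + of_real (sqrt h) * (herm w a + herm b w)))" (is ?I)
    and "(\<integral>w. exp (of_real h * k + of_real (sqrt h) * (herm w a + herm b w)) \<partial>\<gamma>)
      = exp (of_real h * (k + herm b a))"
proof -
  have eq: "exp (of_real h * k + of_real (sqrt h) * (herm w a + herm b w))
    = exp (of_real h * k) * exp (herm w (sqrt h *\<^sub>R a) + herm (sqrt h *\<^sub>R b) w)" for w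
    by (simp add: exp_add herm_scaleR_left herm_scaleR_right distrib_left)
  show ?I unfolding eq using laplace_gauss(1) by (rule integrable_mult_right)
  have "herm (sqrt h *\<^sub>R b) (sqrt h *\<^sub>R a) = of_real (sqrt h * sqrt h) * herm b a"
    by (simp only: herm_scaleR_left herm_scaleR_right of_real_mult mult.assoc)
  then have "herm (sqrt h *\<^sub>R b) (sqrt h *\<^sub>R a) = of_real h * herm b a"
    using assms by simp
  then show "(\<integral>w. exp (of_real h * k + of_real (sqrt h) * (herm w a + herm b w)) \<partial>\<gamma>)
      = exp (of_real h * (k + herm b a))"
    unfolding eq integral_mult_right_zero laplace_gauss(2) by (simp add: exp_add distrib_left)
qed

lemma incr_mean:
  assumes "h \<ge> 0"
  shows "integrable \<gamma> (incr h m A a b k)"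
    and "(\<integral>\<zeta>. incr h m A a b k \<zeta> \<partial>\<gamma>) = (\<Sum>i<m. A i * (exp (h * (k i + herm (b i) (a i))) - 1))"
proof -
  have int: "integrable \<gamma> (\<lambda>\<zeta>. A i * (exp (h * k i + sqrt h * (herm \<zeta> (a i) + herm (b i) \<zeta>)) - 1))" for i
    using laplace_gauss_scaled(1)[OF assms]
    by (intro integrable_mult_right Bochner_Integration.integrable_diff) auto
  have val: "(\<integral>\<zeta>. A i * (exp (h * k i + sqrt h * (herm \<zeta> (a i) + herm (b i) \<zeta>)) - 1) \<partial>\<gamma>)
     = A i * (exp (h * (k i + herm (b i) (a i))) - 1)" for i
    unfolding integral_mult_right_zero laplace_gauss_scaled(2)[OF assms, symmetric]
    by (subst Bochner_Integration.integral_diff) (use laplace_gauss_scaled(1)[OF assms] in \<open>auto simp: gauss.prob_space[simplified]\<close>)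
  show "integrable \<gamma> (incr h m A a b k)"
    unfolding incr_def[abs_def] by (intro Bochner_Integration.integrable_sum int)
  show "(\<integral>\<zeta>. incr h m A a b k \<zeta> \<partial>\<gamma>) = (\<Sum>i<m. A i * (exp (h * (k i + herm (b i) (a i))) - 1))"
    unfolding incr_def by (subst Bochner_Integration.integral_sum) (simp_all only: int val)
qed

text \<open>
  The coefficient of \<open>h\<close> in the mixed second moment of two increments.
\<close>

definition pairing :: "nat \<Rightarrow> (nat \<Rightarrow> complex) \<Rightarrow> (nat \<Rightarrow> complex ^ 'n::finite) \<Rightarrow> (nat \<Rightarrow> complex ^ 'n) \<Rightarrow>
    (nat \<Rightarrow> complex) \<Rightarrow> (nat \<Rightarrow> complex ^ 'n) \<Rightarrow> (nat \<Rightarrow> complex ^ 'n) \<Rightarrow> complex" where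
  "pairing m A a b A' a' b' = (\<Sum>i<m. \<Sum>j<m. A i * A' j * (herm (b i) (a' j) + herm (b' j) (a i)))"

lemma pairing_eq:
  "pairing m A a b A' a' b' =
     herm (\<Sum>i<m. A i *s b i) (\<Sum>j<m. cnj (A' j) *s a' j) + herm (\<Sum>j<m. A' j *s b' j) (\<Sum>i<m. cnj (A i) *s a i)"
proof -
  have "herm (\<Sum>i<m. A i *s b i) (\<Sum>j<m. cnj (A' j) *s a' j) = (\<Sum>i<m. \<Sum>j<m. A i * A' j * herm (b i) (a' j))"
    by (subst herm_sum_left)
       (simp add: herm_sum_right herm_scale_left herm_scale_right sum_distrib_left mult_ac)
  moreover have "herm (\<Sum>j<m. A' j *s b' j) (\<Sum>i<m. cnj (A i) *s a i) = (\<Sum>i<m. \<Sum>j<m. A i * A' j * herm (b' j) (a i))"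
    by (subst sum.swap, subst herm_sum_left)
       (simp add: herm_sum_right herm_scale_left herm_scale_right sum_distrib_left mult_ac)
  ultimately show ?thesis
    by (simp add: pairing_def distrib_left sum.distrib)
qed

text \<open>
  Products of exponentials are exponentials, so the moment is an explicit double sum of terms
  \<open>exp x - exp y - exp z + 1\<close> whose exponents are of order \<open>h\<close>. The linear part of such a term
  is \<open>x - y - z\<close>, in which the \<open>k\<close> and the diagonal products cancel.
\<close>

lemma incr_second_moment:
  fixes a b :: "nat \<Rightarrow> complex ^ 'n::finite"
  assumes h: "0 < h" "h \<le> 1" and L: "L \<ge> 0"
    and bd: "\<And>i. i < m \<Longrightarrow> norm (k i) \<le> L \<and> norm (a i) \<le> L \<and> norm (b i) \<le> L"
    and bd': "\<And>i. i < m \<Longrightarrow> norm (k' i) \<le> L \<and> norm (a' i) \<le> L \<and> norm (b' i) \<le> L"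
    and S: "(\<Sum>i<m. norm (A i)) \<le> S" "(\<Sum>i<m. norm (A' i)) \<le> S"
  defines "c \<equiv> 2 * L + 4 * L\<^sup>2"
  shows "integrable \<gamma> (\<lambda>\<zeta>. incr h m A a b k \<zeta> * incr h m A' a' b' k' \<zeta>)"
    and "norm ((\<integral>\<zeta>. incr h m A a b k \<zeta> * incr h m A' a' b' k' \<zeta> \<partial>\<gamma>) - h * pairing m A a b A' a' b')
       \<le> h\<^sup>2 * (3 * c\<^sup>2 * exp c) * S\<^sup>2"
proof -
  let ?e = "\<lambda>k a b \<zeta>. exp (of_real h * k + of_real (sqrt h) * (herm \<zeta> a + herm b \<zeta>)) :: complex"
  have c0: "c \<ge> 0" using L by (simp add: c_def)
  define F where "F = (\<lambda>i j (\<zeta> :: complex ^ 'n). ?e (k i + k' j) (a i + a' j) (b i + b' j) \<zeta> - ?e (k i) (a i) (b i) \<zeta> - ?e (k' j) (a' j) (b' j) \<zeta> + 1)"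
  have prod: "incr h m A a b k \<zeta> * incr h m A' a' b' k' \<zeta> = (\<Sum>i<m. \<Sum>j<m. A i * A' j * F i j \<zeta>)" for \<zeta>
  proof -
    have "(?e (k i) (a i) (b i) \<zeta> - 1) * (?e (k' j) (a' j) (b' j) \<zeta> - 1) = F i j \<zeta>" for i j
    proof -
      have "?e (k i) (a i) (b i) \<zeta> * ?e (k' j) (a' j) (b' j) \<zeta> = ?e (k i + k' j) (a i + a' j) (b i + b' j) \<zeta>"
        unfolding exp_add[symmetric] by (simp add: herm_add_left herm_add_right algebra_simps)
      then show ?thesis unfolding F_def by (simp add: algebra_simps)
    qed
    then show ?thesis
      unfolding incr_def sum_product
      by (intro sum.cong refl) (metis (no_types, lifting) mult.assoc mult.left_commute)
  qed
  have Fint: "integrable \<gamma> (F i j)" for i j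
    unfolding F_def using h
    by (intro Bochner_Integration.integrable_add Bochner_Integration.integrable_diff laplace_gauss_scaled) auto
  let ?x = "\<lambda>i j. h * (k i + k' j + herm (b i + b' j) (a i + a' j)) :: complex"
  let ?y = "\<lambda>i. h * (k i + herm (b i) (a i)) :: complex"
  let ?z = "\<lambda>j. h * (k' j + herm (b' j) (a' j)) :: complex"
  have Fval: "(\<integral>\<zeta>. F i j \<zeta> \<partial>\<gamma>) = exp (?x i j) - exp (?y i) - exp (?z j) + 1" for i j
    unfolding F_def using h
    by (simp add: laplace_gauss_scaled gauss.prob_space[simplified])
  show "integrable \<gamma> (\<lambda>\<zeta>. incr h m A a b k \<zeta> * incr h m A' a' b' k' \<zeta>)"
    unfolding prod using Fint by (intro Bochner_Integration.integrable_sum integrable_mult_right)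
  have "(\<integral>\<zeta>. incr h m A a b k \<zeta> * incr h m A' a' b' k' \<zeta> \<partial>\<gamma>)
     = (\<Sum>i<m. \<Sum>j<m. A i * A' j * (exp (?x i j) - exp (?y i) - exp (?z j) + 1))"
    unfolding prod using Fint by (simp add: Bochner_Integration.integral_sum Fval)
  then have "norm ((\<integral>\<zeta>. incr h m A a b k \<zeta> * incr h m A' a' b' k' \<zeta> \<partial>\<gamma>) - h * pairing m A a b A' a' b')
     = norm (\<Sum>i<m. \<Sum>j<m. A i * A' j * (exp (?x i j) - exp (?y i) - exp (?z j) + 1 - h * (herm (b i) (a' j) + herm (b' j) (a i))))"
    by (simp add: pairing_def sum_distrib_left sum_subtractf[symmetric] right_diff_distrib mult_ac)
  also have "\<dots> \<le> (\<Sum>i<m. \<Sum>j<m. norm (A i) * norm (A' j) * (h\<^sup>2 * (3 * c\<^sup>2 * exp c)))"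
  proof (rule order_trans[OF norm_sum], rule sum_mono, rule order_trans[OF norm_sum], rule sum_mono)
    fix i j assume ij: "i \<in> {..<m}" "j \<in> {..<m}"
    have e: "norm (exp x - 1 - x) \<le> h\<^sup>2 * (c\<^sup>2 * exp c)" if "norm x \<le> h * c" for x :: complex
    proof -
      have "norm (exp x - 1 - x) \<le> (norm x)\<^sup>2 * exp (norm x)" by (rule norm_exp_minus_one_minus_le)
      also have "\<dots> \<le> (h * c)\<^sup>2 * exp c"
        using that h c0 mult_right_mono[of h 1 c] by (intro mult_mono power_mono) auto
      finally show ?thesis by (simp add: power_mult_distrib mult_ac)
    qed
    have hb: "norm (herm (b i + b' j) (a i + a' j)) \<le> 4 * L\<^sup>2"
    proof -
      have "norm (b i + b' j) \<le> 2 * L" "norm (a i + a' j) \<le> 2 * L"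
        using bd[of i] bd'[of j] ij norm_triangle_ineq[of "b i" "b' j"] norm_triangle_ineq[of "a i" "a' j"] by auto
      then have "norm (b i + b' j) * norm (a i + a' j) \<le> (2 * L) * (2 * L)"
        using L by (intro mult_mono) auto
      then show ?thesis
        using norm_herm_le[of "b i + b' j" "a i + a' j"] by (simp add: power2_eq_square)
    qed
    have hb1: "norm (herm x y) \<le> 4 * L\<^sup>2" if "norm x \<le> L" "norm y \<le> L" for x y :: "complex ^ 'n"
    proof -
      have "norm x * norm y \<le> L * L" using that L by (intro mult_mono) auto
      moreover have "0 \<le> L * L" by simp
      ultimately show ?thesis using norm_herm_le[of x y] unfolding power2_eq_square by linarith
    qed
    have x: "norm (?x i j) \<le> h * c"
      unfolding norm_mult using h ij hb bd[of i] bd'[of j] norm_triangle_ineq[of "k i + k' j" "herm (b i + b' j) (a i + a' j)"]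
        norm_triangle_ineq[of "k i" "k' j"] by (auto simp: c_def intro!: mult_left_mono)
    have y: "norm (?y i) \<le> h * c"
      unfolding norm_mult using h ij L hb1[of "b i" "a i"] bd[of i] norm_triangle_ineq[of "k i" "herm (b i) (a i)"]
      by (auto simp: c_def intro!: mult_left_mono)
    have z: "norm (?z j) \<le> h * c"
      unfolding norm_mult using h ij L hb1[of "b' j" "a' j"] bd'[of j] norm_triangle_ineq[of "k' j" "herm (b' j) (a' j)"]
      by (auto simp: c_def intro!: mult_left_mono)
    have split: "exp (?x i j) - exp (?y i) - exp (?z j) + 1 - h * (herm (b i) (a' j) + herm (b' j) (a i))
      = (exp (?x i j) - 1 - ?x i j) - (exp (?y i) - 1 - ?y i) - (exp (?z j) - 1 - ?z j)"
      by (simp add: herm_add_left herm_add_right algebra_simps)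
    have tri: "norm (P - Q - R) \<le> norm P + norm Q + norm R" for P Q R :: complex
      by (meson norm_triangle_ineq4 norm_triangle_le_diff add_right_mono order_trans norm_triangle_le)
    have "norm (exp (?x i j) - exp (?y i) - exp (?z j) + 1 - h * (herm (b i) (a' j) + herm (b' j) (a i))) \<le> h\<^sup>2 * (3 * c\<^sup>2 * exp c)"
      unfolding split using e[OF x] e[OF y] e[OF z]
      by (intro order_trans[OF tri]) (simp add: algebra_simps)
    then show "norm (A i * A' j * (exp (?x i j) - exp (?y i) - exp (?z j) + 1 - h * (herm (b i) (a' j) + herm (b' j) (a i))))
       \<le> norm (A i) * norm (A' j) * (h\<^sup>2 * (3 * c\<^sup>2 * exp c))"
      unfolding norm_mult by (intro mult_left_mono) auto
  qed
  also have "\<dots> = h\<^sup>2 * (3 * c\<^sup>2 * exp c) * ((\<Sum>i<m. norm (A i)) * (\<Sum>j<m. norm (A' j)))"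
    unfolding sum_product by (simp add: sum_distrib_left mult_ac)
  also have "\<dots> \<le> h\<^sup>2 * (3 * c\<^sup>2 * exp c) * (S * S)"
    using S sum_nonneg[of "{..<m}" "\<lambda>i. norm (A i)"] sum_nonneg[of "{..<m}" "\<lambda>i. norm (A' i)"]
    by (intro mult_left_mono mult_mono) (auto intro: order_trans)
  finally show "norm ((\<integral>\<zeta>. incr h m A a b k \<zeta> * incr h m A' a' b' k' \<zeta> \<partial>\<gamma>) - h * pairing m A a b A' a' b')
       \<le> h\<^sup>2 * (3 * c\<^sup>2 * exp c) * S\<^sup>2"
    by (simp add: power2_eq_square)
qed

lemma regnorm_measurable [measurable]: "regnorm \<epsilon> p \<in> borel_measurable borel"
  unfolding regnorm_def[abs_def] by measurable

section \<open>Small-variance expansion of the regularised p-th moment\<close>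

lemma coeff_bounds:
  assumes \<epsilon>: "0 < \<epsilon>" "\<epsilon> \<le> 1" and p: "0 \<le> p" and s: "norm u \<le> s"
  defines "G \<equiv> (p + p * \<bar>p - 2\<bar>) / \<epsilon>"
  shows "\<bar>lap_coeff \<epsilon> p u\<bar> \<le> G * (1 + s) powr p"
    and "\<bar>anti_coeff \<epsilon> p u\<bar> * (norm u)\<^sup>2 \<le> G * (1 + s) powr p"
proof -
  define Q where "Q = (norm u)\<^sup>2 + \<epsilon>"
  define R where "R = Q powr (p / 2)"
  have Q: "Q \<ge> \<epsilon>" "Q > 0" "(norm u)\<^sup>2 \<le> Q" using \<epsilon> by (simp_all add: Q_def add_nonneg_pos)
  have R: "0 \<le> R" "R \<le> (1 + s) powr p"
    using regnorm_le[OF \<epsilon> p s] by (simp_all add: R_def Q_def regnorm_def)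
  have RQ: "R / Q \<le> (1 + s) powr p / \<epsilon>" using R Q \<epsilon> by (intro frac_le) auto
  have RQ0: "0 \<le> R / Q" using R Q by simp
  have "Q powr (p / 2 - 1) = R / Q" using Q by (simp add: R_def powr_diff)
  then have "lin_coeff \<epsilon> p u = p / 2 * (R / Q)" by (simp add: lin_coeff_def flip: Q_def)
  then have l: "\<bar>lin_coeff \<epsilon> p u\<bar> = p / 2 * (R / Q)"
    using mult_nonneg_nonneg[OF _ RQ0, of "p / 2"] p by (simp only: abs_of_nonneg)
  have "Q powr (p / 2 - 2) = R / Q\<^sup>2" using Q by (simp add: R_def powr_diff)
  then have "\<bar>anti_coeff \<epsilon> p u\<bar> = p / 2 * \<bar>p / 2 - 1\<bar> * (R / Q\<^sup>2)"
    using p R by (simp add: anti_coeff_def Q_def abs_mult)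
  then have "\<bar>anti_coeff \<epsilon> p u\<bar> * (norm u)\<^sup>2 = p / 2 * \<bar>p / 2 - 1\<bar> * (R / Q) * ((norm u)\<^sup>2 / Q)"
    by (simp add: power2_eq_square)
  also have "\<dots> \<le> p / 2 * \<bar>p / 2 - 1\<bar> * (R / Q) * 1"
    using Q R p by (intro mult_left_mono) auto
  also have "p / 2 * \<bar>p / 2 - 1\<bar> = p * \<bar>p - 2\<bar> / 4"
    by (simp add: abs_if field_simps)
  finally have a: "\<bar>anti_coeff \<epsilon> p u\<bar> * (norm u)\<^sup>2 \<le> p * \<bar>p - 2\<bar> / 4 * (R / Q)"
    by simp
  have step: "C * (R / Q) \<le> G * (1 + s) powr p" if "0 \<le> C" "C \<le> p + p * \<bar>p - 2\<bar>" for C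
  proof -
    have "C * (R / Q) \<le> (p + p * \<bar>p - 2\<bar>) * ((1 + s) powr p / \<epsilon>)"
      using that RQ RQ0 p by (intro mult_mono) auto
    then show ?thesis by (simp add: G_def)
  qed
  have p0: "0 \<le> p * \<bar>p - 2\<bar>" using p by simp
  show "\<bar>anti_coeff \<epsilon> p u\<bar> * (norm u)\<^sup>2 \<le> G * (1 + s) powr p"
    using p p0 by (intro order_trans[OF a] step) auto
  have "\<bar>lap_coeff \<epsilon> p u\<bar> \<le> \<bar>lin_coeff \<epsilon> p u\<bar> + \<bar>anti_coeff \<epsilon> p u * (norm u)\<^sup>2\<bar>"
    unfolding lap_coeff_def by (rule abs_triangle_ineq)
  also have "\<dots> \<le> p / 2 * (R / Q) + p * \<bar>p - 2\<bar> / 4 * (R / Q)"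
    using a l by (simp add: abs_mult)
  also have "\<dots> = (p / 2 + p * \<bar>p - 2\<bar> / 4) * (R / Q)" by (simp only: distrib_right)
  also have "\<dots> \<le> G * (1 + s) powr p" using p p0 by (intro step) linarith+
  finally show "\<bar>lap_coeff \<epsilon> p u\<bar> \<le> G * (1 + s) powr p" .
qed

text \<open>
  The increments have size \<open>sqrt h\<close>; the exponential factor is harmless because it is Gaussian
  integrable to every power.
\<close>

lemma norm_incr_le:
  fixes a b :: "nat \<Rightarrow> complex ^ 'n::finite"
  assumes h: "0 < h" "h \<le> 1" and L: "L \<ge> 0"
    and bd: "\<And>i. i < m \<Longrightarrow> norm (k i) \<le> L \<and> norm (a i) \<le> L \<and> norm (b i) \<le> L"
  shows "norm (incr h m A a b k \<zeta>) \<le> (\<Sum>i<m. norm (A i)) * (sqrt h * exp (4 * L * (1 + norm \<zeta>)))"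
proof -
  define l where "l = 2 * L * (1 + norm \<zeta>)"
  have l0: "l \<ge> 0" using L by (simp add: l_def)
  have sh: "h \<le> sqrt h" "0 \<le> sqrt h" "sqrt h \<le> 1"
    using h by (auto intro!: real_le_rsqrt simp: power2_eq_square mult_left_le_one_le)
  have "norm (incr h m A a b k \<zeta>)
    \<le> (\<Sum>i<m. norm (A i) * norm (exp (h * k i + sqrt h * (herm \<zeta> (a i) + herm (b i) \<zeta>)) - 1))"
    unfolding incr_def by (rule order_trans[OF norm_sum]) (simp add: norm_mult)
  also have "\<dots> \<le> (\<Sum>i<m. norm (A i) * (sqrt h * exp (4 * L * (1 + norm \<zeta>))))"
  proof (intro sum_mono mult_left_mono)
    fix i assume "i \<in> {..<m}"
    then have i: "norm (k i) \<le> L" "norm (a i) \<le> L" "norm (b i) \<le> L" using bd by auto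
    let ?x = "h * k i + sqrt h * (herm \<zeta> (a i) + herm (b i) \<zeta>)"
    have 1: "norm (herm \<zeta> (a i)) \<le> L * norm \<zeta>" "norm (herm (b i) \<zeta>) \<le> L * norm \<zeta>"
      using norm_herm_le[of \<zeta> "a i"] norm_herm_le[of "b i" \<zeta>] i
        mult_left_mono[of "norm (a i)" L "norm \<zeta>"] mult_right_mono[of "norm (b i)" L "norm \<zeta>"]
      by (auto simp: mult.commute)
    have "norm ?x \<le> norm (h * k i) + norm (sqrt h * (herm \<zeta> (a i) + herm (b i) \<zeta>))"
      by (rule norm_triangle_ineq)
    also have "\<dots> = h * norm (k i) + sqrt h * norm (herm \<zeta> (a i) + herm (b i) \<zeta>)"
      using h by (simp add: norm_mult)
    also have "\<dots> \<le> sqrt h * L + sqrt h * (2 * L * norm \<zeta>)"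
      using 1 i sh h L norm_triangle_ineq[of "herm \<zeta> (a i)" "herm (b i) \<zeta>"]
      by (intro add_mono mult_mono) auto
    also have "\<dots> \<le> sqrt h * l"
      unfolding distrib_left[symmetric] using sh L by (intro mult_left_mono) (auto simp: l_def algebra_simps)
    finally have x: "norm ?x \<le> sqrt h * l" .
    have x1: "norm ?x \<le> l" using x sh l0 mult_right_mono[of "sqrt h" 1 l] by simp
    have "norm (exp ?x - 1) \<le> norm ?x * exp (norm ?x)" by (rule norm_exp_minus_one_le)
    also have "\<dots> \<le> (sqrt h * l) * exp l"
      using x x1 sh l0 by (intro mult_mono) auto
    also have "\<dots> \<le> (sqrt h * exp l) * exp l"
      using order_trans[OF _ exp_ge_add_one_self[of l], of l] sh by (intro mult_right_mono mult_left_mono) auto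
    also have "\<dots> = sqrt h * exp (4 * L * (1 + norm \<zeta>))"
      by (simp add: l_def exp_add[symmetric])
    finally show "norm (exp ?x - 1) \<le> sqrt h * exp (4 * L * (1 + norm \<zeta>))" .
  qed simp
  finally show ?thesis by (simp add: sum_distrib_right)
qed

text \<open>
  The expected second-order expansion, in the increment, of the regularised moment of an
  exponential sum. The vectors \<open>D\<close> and \<open>B\<close> are, up to conjugation, the holomorphic and
  antiholomorphic gradients of the sum at the origin.
\<close>

definition second_order :: "real \<Rightarrow> real \<Rightarrow> real \<Rightarrow> nat \<Rightarrow> (nat \<Rightarrow> complex) \<Rightarrow> (nat \<Rightarrow> complex ^ 'n::finite)
    \<Rightarrow> (nat \<Rightarrow> complex ^ 'n) \<Rightarrow> (nat \<Rightarrow> complex) \<Rightarrow> real" where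
  "second_order \<epsilon> p h m A a b k =
     (let u = (\<Sum>i<m. A i); B = (\<Sum>i<m. A i *s b i); D = (\<Sum>i<m. cnj (A i) *s a i) in
      regnorm \<epsilon> p u
      + 2 * lin_coeff \<epsilon> p u * Re (cnj u * (\<Sum>i<m. A i * (exp (h * (k i + herm (b i) (a i))) - 1)))
      + h * (lap_coeff \<epsilon> p u * ((norm B)\<^sup>2 + (norm D)\<^sup>2) + 2 * anti_coeff \<epsilon> p u * Re ((cnj u)\<^sup>2 * herm B D)))"

text \<open>
  Taylor's formula is integrated term by term: the mean of the increment is exact, the two
  second moments are known up to \<open>h\<^sup>2\<close>, and the remainder is of third order in an increment of
  size \<open>sqrt h\<close>. The constant \<open>C\<close> depends on the exponents only through the bound \<open>L\<close>, while
  the dependence on the coefficients is a power of the sum of their moduli. This uniformity is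
  needed because the coefficients will themselves be random.
\<close>

lemma regnorm_expansion:
  fixes p \<epsilon> L :: real
  assumes \<epsilon>: "0 < \<epsilon>" "\<epsilon> \<le> 1" and p: "1 \<le> p" and L: "L \<ge> 0"
  shows "\<exists>C\<ge>0. \<forall>h m A a b k. 0 < h \<longrightarrow> h \<le> 1 \<longrightarrow>
     (\<forall>i<m. norm (k i) \<le> L \<and> norm (a i :: complex ^ 'n::finite) \<le> L \<and> norm (b i) \<le> L) \<longrightarrow>
     integrable \<gamma> (\<lambda>\<zeta>. regnorm \<epsilon> p (sum A {..<m} + incr h m A a b k \<zeta>)) \<and>
     \<bar>(\<integral>\<zeta>. regnorm \<epsilon> p (sum A {..<m} + incr h m A a b k \<zeta>) \<partial>\<gamma>) - second_order \<epsilon> p h m A a b k\<bar>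
       \<le> C * (h * sqrt h) * (1 + 2 * (\<Sum>i<m. norm (A i))) powr (p + 3)"
proof -
  obtain M where M: "M \<ge> 0" and taylor: "\<And>u d. \<bar>regnorm \<epsilon> p (u + d) - (regnorm \<epsilon> p u + 2 * lin_coeff \<epsilon> p u * Re (cnj u * d)
      + lap_coeff \<epsilon> p u * (norm d)\<^sup>2 + anti_coeff \<epsilon> p u * Re ((cnj u)\<^sup>2 * d\<^sup>2))\<bar>
      \<le> M * (1 + norm u + norm d) powr p * norm d ^ 3"
    using regnorm_taylor[OF \<epsilon>, of p] p by auto
  define c where "c = 2 * L + 4 * L\<^sup>2"
  define J where "J = 3 * c\<^sup>2 * exp c"
  define E where "E = (\<lambda>\<zeta> :: complex ^ 'n. exp (4 * L * (1 + norm \<zeta>)))"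
  define W where "W = (\<lambda>\<zeta>. E \<zeta> powr (p + 3))"
  define I where "I = (\<integral>\<zeta>. W \<zeta> \<partial>\<gamma>)"
  define G where "G = (p + p * \<bar>p - 2\<bar>) / \<epsilon>"
  have G0: "G \<ge> 0" using \<epsilon> p by (simp add: G_def)
  have J0: "J \<ge> 0" by (simp add: J_def)
  have W_eq: "W \<zeta> = exp (4 * L * (p + 3)) * exp ((4 * L * (p + 3)) * norm \<zeta>)" for \<zeta>
    by (simp add: W_def E_def exp_powr_real exp_add[symmetric] algebra_simps)
  have Wint: "integrable \<gamma> W"
    unfolding W_eq by (intro integrable_mult_right integrable_exp_norm_gauss)
  have I0: "I \<ge> 0" unfolding I_def by (rule integral_nonneg_AE) (simp add: W_def)
  define C where "C = M * I + 2 * (G * J)"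
  have C0: "C \<ge> 0" using M I0 G0 J0 by (simp add: C_def)
  have main: "integrable \<gamma> (\<lambda>\<zeta>. regnorm \<epsilon> p (sum A {..<m} + incr h m A a b k \<zeta>)) \<and>
     \<bar>(\<integral>\<zeta>. regnorm \<epsilon> p (sum A {..<m} + incr h m A a b k \<zeta>) \<partial>\<gamma>) - second_order \<epsilon> p h m A a b k\<bar>
       \<le> C * (h * sqrt h) * (1 + 2 * (\<Sum>i<m. norm (A i))) powr (p + 3)"
    if h: "0 < h" "h \<le> 1" and bd: "\<And>i. i < m \<Longrightarrow> norm (k i) \<le> L \<and> norm (a i) \<le> L \<and> norm (b i) \<le> L"
    for h m A and a b :: "nat \<Rightarrow> complex ^ 'n" and k
  proof -
    define S where S: "S = (\<Sum>i<m. norm (A i))"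
    define u where u: "u = (\<Sum>i<m. A i)"
    define B where B: "B = (\<Sum>i<m. A i *s b i)"
    define D where D: "D = (\<Sum>i<m. cnj (A i) *s a i)"
    have so: "second_order \<epsilon> p h m A a b k = regnorm \<epsilon> p u
       + 2 * lin_coeff \<epsilon> p u * Re (cnj u * (\<Sum>i<m. A i * (exp (h * (k i + herm (b i) (a i))) - 1)))
       + h * (lap_coeff \<epsilon> p u * ((norm B)\<^sup>2 + (norm D)\<^sup>2) + 2 * anti_coeff \<epsilon> p u * Re ((cnj u)\<^sup>2 * herm B D))"
      unfolding second_order_def Let_def u B D ..
    have S0: "S \<ge> 0" unfolding S by (intro sum_nonneg) auto
    have uS: "norm u \<le> S" unfolding u S by (rule norm_sum)
    define d where "d = incr h m A a b k"
    have [measurable]: "d \<in> borel_measurable borel" unfolding d_def by measurable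
    have sh: "h \<le> sqrt h" "0 \<le> sqrt h" "sqrt h \<le> 1"
      using h by (auto intro!: real_le_rsqrt simp: power2_eq_square mult_left_le_one_le)
    have E1: "E \<zeta> \<ge> 1" for \<zeta> using L by (simp add: E_def)
    have dle: "norm (d \<zeta>) \<le> S * (sqrt h * E \<zeta>)" for \<zeta>
      unfolding d_def S E_def by (rule norm_incr_le[OF h L bd])
    have d1: "integrable \<gamma> d"
      "(\<integral>\<zeta>. d \<zeta> \<partial>\<gamma>) = (\<Sum>i<m. A i * (exp (h * (k i + herm (b i) (a i))) - 1))"
      unfolding d_def using h by (auto intro: incr_mean)
    have d2: "integrable \<gamma> (\<lambda>\<zeta>. (d \<zeta>)\<^sup>2)"
      "norm ((\<integral>\<zeta>. (d \<zeta>)\<^sup>2 \<partial>\<gamma>) - h * (2 * herm B D)) \<le> h\<^sup>2 * J * S\<^sup>2"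
    proof -
      have "pairing m A a b A a b = 2 * herm B D"
        unfolding pairing_eq B D by simp
      then show "integrable \<gamma> (\<lambda>\<zeta>. (d \<zeta>)\<^sup>2)"
        "norm ((\<integral>\<zeta>. (d \<zeta>)\<^sup>2 \<partial>\<gamma>) - h * (2 * herm B D)) \<le> h\<^sup>2 * J * S\<^sup>2"
        using incr_second_moment[OF h L, of m k a b k a b A S A, OF bd bd] S
        by (simp_all add: d_def power2_eq_square[of "incr _ _ _ _ _ _ _"] J_def c_def)
    qed
    have d3: "integrable \<gamma> (\<lambda>\<zeta>. (norm (d \<zeta>))\<^sup>2)"
      "\<bar>(\<integral>\<zeta>. (norm (d \<zeta>))\<^sup>2 \<partial>\<gamma>) - h * ((norm B)\<^sup>2 + (norm D)\<^sup>2)\<bar> \<le> h\<^sup>2 * J * S\<^sup>2"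
    proof -
      let ?A' = "\<lambda>i. cnj (A i)"
      have pe: "pairing m A a b ?A' b a = of_real ((norm B)\<^sup>2 + (norm D)\<^sup>2)"
        unfolding pairing_eq B D by (simp add: herm_self)
      have bd': "norm (cnj (k i)) \<le> L \<and> norm (b i) \<le> L \<and> norm (a i) \<le> L" if "i < m" for i
        using bd[OF that] by simp
      have prod: "incr h m A a b k \<zeta> * incr h m ?A' b a (\<lambda>i. cnj (k i)) \<zeta> = of_real ((norm (d \<zeta>))\<^sup>2)" for \<zeta>
        unfolding cnj_incr[symmetric] d_def complex_norm_square by simp
      note M2 = incr_second_moment[OF h L, of m k a b "\<lambda>i. cnj (k i)" b a A S "?A'", OF bd bd', unfolded prod pe]
      have Sle: "(\<Sum>i<m. norm (A i)) \<le> S" "(\<Sum>i<m. norm (cnj (A i))) \<le> S" by (simp_all add: S)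
      have "integrable \<gamma> (\<lambda>\<zeta>. Re (of_real ((norm (d \<zeta>))\<^sup>2)))"
        by (intro integrable_Re M2(1)) (use Sle in auto)
      then show "integrable \<gamma> (\<lambda>\<zeta>. (norm (d \<zeta>))\<^sup>2)" by simp
      have "norm (of_real ((\<integral>\<zeta>. (norm (d \<zeta>))\<^sup>2 \<partial>\<gamma>) - h * ((norm B)\<^sup>2 + (norm D)\<^sup>2)) :: complex) \<le> h\<^sup>2 * J * S\<^sup>2"
        using M2(2) Sle by (simp add: J_def c_def del: of_real_power)
      then show "\<bar>(\<integral>\<zeta>. (norm (d \<zeta>))\<^sup>2 \<partial>\<gamma>) - h * ((norm B)\<^sup>2 + (norm D)\<^sup>2)\<bar> \<le> h\<^sup>2 * J * S\<^sup>2"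
        unfolding norm_of_real .
    qed
    define T where "T = (\<lambda>\<zeta>. regnorm \<epsilon> p u + 2 * lin_coeff \<epsilon> p u * Re (cnj u * d \<zeta>)
      + lap_coeff \<epsilon> p u * (norm (d \<zeta>))\<^sup>2 + anti_coeff \<epsilon> p u * Re ((cnj u)\<^sup>2 * (d \<zeta>)\<^sup>2))"
    define R where "R = (\<lambda>\<zeta>. regnorm \<epsilon> p (u + d \<zeta>) - T \<zeta>)"
    have Tint: "integrable \<gamma> T"
      unfolding T_def using d1 d2 d3
      by (intro Bochner_Integration.integrable_add integrable_mult_right integrable_Re) auto
    have Tval: "(\<integral>\<zeta>. T \<zeta> \<partial>\<gamma>) = regnorm \<epsilon> p u
      + 2 * lin_coeff \<epsilon> p u * Re (cnj u * (\<Sum>i<m. A i * (exp (h * (k i + herm (b i) (a i))) - 1)))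
      + lap_coeff \<epsilon> p u * (\<integral>\<zeta>. (norm (d \<zeta>))\<^sup>2 \<partial>\<gamma>)
      + anti_coeff \<epsilon> p u * Re ((cnj u)\<^sup>2 * (\<integral>\<zeta>. (d \<zeta>)\<^sup>2 \<partial>\<gamma>))"
    proof -
      have r1: "(\<integral>\<zeta>. Re (cnj u * d \<zeta>) \<partial>\<gamma>) = Re (cnj u * (\<integral>\<zeta>. d \<zeta> \<partial>\<gamma>))"
        using d1 by (subst integral_Re) auto
      have r2: "(\<integral>\<zeta>. Re ((cnj u)\<^sup>2 * (d \<zeta>)\<^sup>2) \<partial>\<gamma>) = Re ((cnj u)\<^sup>2 * (\<integral>\<zeta>. (d \<zeta>)\<^sup>2 \<partial>\<gamma>))"
        using d2 by (subst integral_Re) auto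
      have i1: "integrable \<gamma> (\<lambda>\<zeta>. Re (cnj u * d \<zeta>))"
        and i2: "integrable \<gamma> (\<lambda>\<zeta>. Re ((cnj u)\<^sup>2 * (d \<zeta>)\<^sup>2))"
        using d1 d2 by (intro integrable_Re; simp)+
      show ?thesis
        unfolding T_def d1(2)[symmetric] r1[symmetric] r2[symmetric] using i1 i2 d3(1)
        by (simp add: gauss.prob_space[simplified] del: times_complex.sel)
    qed
    have Rle: "\<bar>R \<zeta>\<bar> \<le> M * (h * sqrt h) * (1 + 2 * S) powr (p + 3) * W \<zeta>" for \<zeta>
    proof -
      have dl: "norm (d \<zeta>) \<le> S * E \<zeta>"
      proof -
        have "S * (sqrt h * E \<zeta>) \<le> S * (1 * E \<zeta>)"
          using sh S0 E1[of \<zeta>] by (intro mult_left_mono mult_right_mono) auto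
        then show ?thesis using dle[of \<zeta>] by simp
      qed
      have "1 + norm u + norm (d \<zeta>) \<le> 1 * E \<zeta> + S * E \<zeta> + S * E \<zeta>"
        using dl uS E1[of \<zeta>] mult_left_mono[OF E1[of \<zeta>] S0] by simp
      then have 1: "1 + norm u + norm (d \<zeta>) \<le> (1 + 2 * S) * E \<zeta>" by (simp add: algebra_simps)
      have "norm (d \<zeta>) \<le> sqrt h * ((1 + 2 * S) * E \<zeta>)"
      proof -
        have "S * (sqrt h * E \<zeta>) \<le> (1 + 2 * S) * (sqrt h * E \<zeta>)"
          using sh S0 E1[of \<zeta>] by (intro mult_right_mono) auto
        then show ?thesis using dle[of \<zeta>] by (simp add: mult_ac)
      qed
      then have "norm (d \<zeta>) ^ 3 \<le> (sqrt h * ((1 + 2 * S) * E \<zeta>)) ^ 3"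
        by (intro power_mono) auto
      also have "\<dots> = (h * sqrt h) * ((1 + 2 * S) * E \<zeta>) ^ 3"
        using h by (simp add: power_mult_distrib power3_eq_cube)
      finally have 2: "norm (d \<zeta>) ^ 3 \<le> (h * sqrt h) * ((1 + 2 * S) * E \<zeta>) ^ 3" .
      have pos: "(1 + 2 * S) * E \<zeta> > 0" using S0 E1[of \<zeta>] by (intro mult_pos_pos) auto
      have "\<bar>R \<zeta>\<bar> \<le> M * (1 + norm u + norm (d \<zeta>)) powr p * norm (d \<zeta>) ^ 3"
        unfolding R_def T_def by (rule taylor)
      also have "\<dots> \<le> M * ((1 + 2 * S) * E \<zeta>) powr p * ((h * sqrt h) * ((1 + 2 * S) * E \<zeta>) ^ 3)"
        using 1 2 M p by (intro mult_mono powr_mono2) auto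
      also have "\<dots> = M * (h * sqrt h) * (((1 + 2 * S) * E \<zeta>) powr p * ((1 + 2 * S) * E \<zeta>) ^ 3)"
        by (simp only: mult_ac)
      also have "((1 + 2 * S) * E \<zeta>) powr p * ((1 + 2 * S) * E \<zeta>) ^ 3 = ((1 + 2 * S) * E \<zeta>) powr (p + 3)"
        using powr_realpow[OF pos, of 3] unfolding powr_add by simp
      also have "\<dots> = (1 + 2 * S) powr (p + 3) * W \<zeta>"
        unfolding W_def using S0 E1[of \<zeta>] by (intro powr_mult)
      also have "M * (h * sqrt h) * ((1 + 2 * S) powr (p + 3) * W \<zeta>) = M * (h * sqrt h) * (1 + 2 * S) powr (p + 3) * W \<zeta>"
        by (simp only: mult.assoc)
      finally show ?thesis .
    qed
    have Rint: "integrable \<gamma> R"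
    proof (rule Bochner_Integration.integrable_bound)
      show "integrable \<gamma> (\<lambda>\<zeta>. M * (h * sqrt h) * (1 + 2 * S) powr (p + 3) * W \<zeta>)"
        using Wint by simp
      show "R \<in> borel_measurable \<gamma>" unfolding R_def T_def by measurable
      show "AE \<zeta> in \<gamma>. norm (R \<zeta>) \<le> norm (M * (h * sqrt h) * (1 + 2 * S) powr (p + 3) * W \<zeta>)"
        using Rle by (auto intro!: AE_I2 intro: order_trans abs_ge_self)
    qed
    have "\<bar>\<integral>\<zeta>. R \<zeta> \<partial>\<gamma>\<bar> \<le> (\<integral>\<zeta>. M * (h * sqrt h) * (1 + 2 * S) powr (p + 3) * W \<zeta> \<partial>\<gamma>)"
      using Rle Rint Wint by (intro order_trans[OF integral_abs_bound] integral_mono) auto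
    then have Rb: "\<bar>\<integral>\<zeta>. R \<zeta> \<partial>\<gamma>\<bar> \<le> M * (h * sqrt h) * (1 + 2 * S) powr (p + 3) * I"
      by (simp add: I_def)
    have f_eq: "(\<lambda>\<zeta>. regnorm \<epsilon> p (u + d \<zeta>)) = (\<lambda>\<zeta>. T \<zeta> + R \<zeta>)" by (simp add: R_def)
    have fint: "integrable \<gamma> (\<lambda>\<zeta>. regnorm \<epsilon> p (u + d \<zeta>))"
      unfolding f_eq using Tint Rint by (rule Bochner_Integration.integrable_add)
    have fval: "(\<integral>\<zeta>. regnorm \<epsilon> p (u + d \<zeta>) \<partial>\<gamma>) = (\<integral>\<zeta>. T \<zeta> \<partial>\<gamma>) + (\<integral>\<zeta>. R \<zeta> \<partial>\<gamma>)"
      unfolding f_eq using Tint Rint by simp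
    have hS: "h\<^sup>2 * J * S\<^sup>2 * (G * (1 + S) powr p) \<le> G * J * ((h * sqrt h) * (1 + 2 * S) powr (p + 3))"
    proof -
      have "h\<^sup>2 \<le> h * sqrt h" using sh h by (simp add: power2_eq_square)
      moreover have "S\<^sup>2 * (1 + S) powr p \<le> (1 + 2 * S) powr 3 * (1 + 2 * S) powr p"
      proof (intro mult_mono powr_mono2)
        have "S\<^sup>2 \<le> (1 + 2 * S)\<^sup>2" using S0 by (intro power_mono) auto
        also have "\<dots> \<le> (1 + 2 * S) ^ 3" using S0 by (intro power_increasing) auto
        finally show "S\<^sup>2 \<le> (1 + 2 * S) powr 3" using S0 by simp
      qed (use S0 p in auto)
      ultimately have "h\<^sup>2 * (S\<^sup>2 * (1 + S) powr p) \<le> (h * sqrt h) * (1 + 2 * S) powr (p + 3)"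
        using sh h by (intro mult_mono) (auto simp: powr_add mult.commute)
      then have "G * J * (h\<^sup>2 * (S\<^sup>2 * (1 + S) powr p)) \<le> G * J * ((h * sqrt h) * (1 + 2 * S) powr (p + 3))"
        using G0 J0 by (intro mult_left_mono) auto
      then show ?thesis by (simp add: mult_ac)
    qed
    have e1: "\<bar>lap_coeff \<epsilon> p u * (\<integral>\<zeta>. (norm (d \<zeta>))\<^sup>2 \<partial>\<gamma>) - lap_coeff \<epsilon> p u * (h * ((norm B)\<^sup>2 + (norm D)\<^sup>2))\<bar>
       \<le> G * J * ((h * sqrt h) * (1 + 2 * S) powr (p + 3))"
    proof -
      have "\<bar>lap_coeff \<epsilon> p u\<bar> * \<bar>(\<integral>\<zeta>. (norm (d \<zeta>))\<^sup>2 \<partial>\<gamma>) - h * ((norm B)\<^sup>2 + (norm D)\<^sup>2)\<bar>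
        \<le> (G * (1 + S) powr p) * (h\<^sup>2 * J * S\<^sup>2)"
        using coeff_bounds(1)[OF \<epsilon> _ uS, of p] p d3(2) G0 by (intro mult_mono) (auto simp: G_def)
      then show ?thesis using hS by (simp add: abs_mult[symmetric] right_diff_distrib mult.commute)
    qed
    have e2: "\<bar>anti_coeff \<epsilon> p u * Re ((cnj u)\<^sup>2 * (\<integral>\<zeta>. (d \<zeta>)\<^sup>2 \<partial>\<gamma>)) - anti_coeff \<epsilon> p u * Re ((cnj u)\<^sup>2 * (h * (2 * herm B D)))\<bar>
       \<le> G * J * ((h * sqrt h) * (1 + 2 * S) powr (p + 3))"
    proof -
      let ?X = "(\<integral>\<zeta>. (d \<zeta>)\<^sup>2 \<partial>\<gamma>) - h * (2 * herm B D)"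
      have "\<bar>anti_coeff \<epsilon> p u * Re ((cnj u)\<^sup>2 * (\<integral>\<zeta>. (d \<zeta>)\<^sup>2 \<partial>\<gamma>)) - anti_coeff \<epsilon> p u * Re ((cnj u)\<^sup>2 * (h * (2 * herm B D)))\<bar>
         = \<bar>anti_coeff \<epsilon> p u\<bar> * \<bar>Re ((cnj u)\<^sup>2 * ?X)\<bar>"
        unfolding abs_mult[symmetric] right_diff_distrib minus_complex.sel ..
      also have "\<dots> \<le> \<bar>anti_coeff \<epsilon> p u\<bar> * norm ((cnj u)\<^sup>2 * ?X)"
        by (intro mult_left_mono abs_Re_le_cmod) auto
      also have "\<dots> = \<bar>anti_coeff \<epsilon> p u\<bar> * (norm u)\<^sup>2 * norm ?X"
        by (simp add: norm_mult norm_power mult_ac)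
      also have "\<dots> \<le> (G * (1 + S) powr p) * (h\<^sup>2 * J * S\<^sup>2)"
        by (rule mult_mono[OF coeff_bounds(2)[OF \<epsilon> _ uS, of p, folded G_def] d2(2)]) (use p G0 in auto)
      finally show ?thesis using hS by (simp add: mult.commute)
    qed
    have "Re ((cnj u)\<^sup>2 * (h * (2 * herm B D))) = Re (of_real (2 * h) * ((cnj u)\<^sup>2 * herm B D))"
      by (simp add: mult_ac)
    also have "\<dots> = 2 * h * Re ((cnj u)\<^sup>2 * herm B D)" by (simp only: Re_complex_of_real times_complex.sel) simp
    finally have Re2: "anti_coeff \<epsilon> p u * Re ((cnj u)\<^sup>2 * (h * (2 * herm B D))) = h * (2 * anti_coeff \<epsilon> p u * Re ((cnj u)\<^sup>2 * herm B D))"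
      by simp
    have "\<bar>(\<integral>\<zeta>. regnorm \<epsilon> p (u + d \<zeta>) \<partial>\<gamma>) - second_order \<epsilon> p h m A a b k\<bar>
      \<le> M * (h * sqrt h) * (1 + 2 * S) powr (p + 3) * I + 2 * (G * J * ((h * sqrt h) * (1 + 2 * S) powr (p + 3)))"
      unfolding fval Tval so using Rb e1 e2[unfolded Re2] unfolding distrib_left mult.left_commute[of h "lap_coeff \<epsilon> p u"]
      by linarith
    also have "\<dots> = C * (h * sqrt h) * (1 + 2 * S) powr (p + 3)"
      unfolding C_def by (simp add: algebra_simps)
    finally show ?thesis using fint unfolding d_def u S by blast
  qed
  show ?thesis
    using C0 main by (intro exI[of _ C]) blast
qed

section \<open>The interpolation between a function and its holomorphic part\<close>

interpretation gauss_pair: pair_sigma_finite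
  "\<gamma> :: (complex ^ 'n::finite) measure" "\<gamma> :: (complex ^ 'n) measure" ..

text \<open>
  The comparison for small variance. Replacing an exponential sum by its dilated holomorphic
  part means passing from \<open>(a, b)\<close> to \<open>(r a, 0)\<close> with the extra exponent \<open>k = herm b a\<close>. This
  leaves the mean unchanged, so the two expansions differ in first order of \<open>h\<close> only by the
  quadratic form of \<open>quadratic_form_bound\<close>.
\<close>

lemma one_step:
  fixes p \<epsilon> L r :: real
  assumes \<epsilon>: "0 < \<epsilon>" "\<epsilon> \<le> 1" and p: "1 \<le> p" and L: "L \<ge> 0"
    and r: "0 \<le> r" "r \<le> 1" "r\<^sup>2 = 1 - (1 - 2 / p)\<^sup>2"
  shows "\<exists>C\<ge>0. \<forall>h (m :: nat) A a b. 0 < h \<longrightarrow> h \<le> 1 \<longrightarrow>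
     (\<forall>i<m. norm (a i :: complex ^ 'n::finite) \<le> L \<and> norm (b i) \<le> L) \<longrightarrow>
     (\<integral>\<^sup>+\<zeta>. regnorm \<epsilon> p (\<Sum>i<m. A i * exp (h * herm (b i) (a i) + sqrt h * (r * herm \<zeta> (a i)))) \<partial>\<gamma>)
     \<le> (\<integral>\<^sup>+\<zeta>. regnorm \<epsilon> p (\<Sum>i<m. A i * exp (sqrt h * (herm \<zeta> (a i) + herm (b i) \<zeta>))) \<partial>\<gamma>)
       + ennreal (C * (h * sqrt h) * (1 + 2 * (\<Sum>i<m. norm (A i))) powr (p + 3))"
proof -
  have L2: "0 \<le> L + L\<^sup>2" using L by simp
  obtain C where C0: "C \<ge> 0" and C: "\<And>h m A a b k. 0 < h \<Longrightarrow> h \<le> 1 \<Longrightarrow>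
     \<forall>i<m. norm (k i) \<le> L + L\<^sup>2 \<and> norm (a i :: complex ^ 'n) \<le> L + L\<^sup>2 \<and> norm (b i) \<le> L + L\<^sup>2 \<Longrightarrow>
     integrable \<gamma> (\<lambda>\<zeta>. regnorm \<epsilon> p (sum A {..<m} + incr h m A a b k \<zeta>)) \<and>
     \<bar>(\<integral>\<zeta>. regnorm \<epsilon> p (sum A {..<m} + incr h m A a b k \<zeta>) \<partial>\<gamma>) - second_order \<epsilon> p h m A a b k\<bar>
       \<le> C * (h * sqrt h) * (1 + 2 * (\<Sum>i<m. norm (A i))) powr (p + 3)"
    using regnorm_expansion[OF \<epsilon> p L2, where 'n='n] by blast
  show ?thesis
  proof (intro exI[of _ "2 * C"] conjI allI impI)
    show "0 \<le> 2 * C" using C0 by simp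
    fix h :: real and m and A :: "nat \<Rightarrow> complex" and a b :: "nat \<Rightarrow> complex ^ 'n"
    assume h: "0 < h" "h \<le> 1" and bd: "\<forall>i<m. norm (a i) \<le> L \<and> norm (b i) \<le> L"
    define S where "S = (\<Sum>i<m. norm (A i))"
    define u where "u = (\<Sum>i<m. A i)"
    define B where "B = (\<Sum>i<m. A i *s b i)"
    define D where "D = (\<Sum>i<m. cnj (A i) *s a i)"
    define lin where "lin = regnorm \<epsilon> p u + 2 * lin_coeff \<epsilon> p u * Re (cnj u * (\<Sum>i<m. A i * (exp (h * herm (b i) (a i)) - 1)))"
    define rem where "rem = C * (h * sqrt h) * (1 + 2 * S) powr (p + 3)"
    let ?k = "\<lambda>i. herm (b i) (a i)" and ?a = "\<lambda>i. r *\<^sub>R a i" and ?b = "\<lambda>_::nat. 0 :: complex ^ 'n"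
    define f1 where "f1 = (\<lambda>\<zeta>. regnorm \<epsilon> p (u + incr h m A a b (\<lambda>_. 0) \<zeta>))"
    define f2 where "f2 = (\<lambda>\<zeta>. regnorm \<epsilon> p (u + incr h m A ?a ?b ?k \<zeta>))"
    have sum_incr: "u + incr h m A a' b' k \<zeta> = (\<Sum>i<m. A i * exp (h * k i + sqrt h * (herm \<zeta> (a' i) + herm (b' i) \<zeta>)))"
      for a' b' :: "nat \<Rightarrow> complex ^ 'n" and k :: "nat \<Rightarrow> complex" and \<zeta>
      unfolding u_def incr_def by (simp add: right_diff_distrib sum_subtractf)
    have bd1: "\<forall>i<m. norm (0::complex) \<le> L + L\<^sup>2 \<and> norm (a i) \<le> L + L\<^sup>2 \<and> norm (b i) \<le> L + L\<^sup>2"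
      using bd L by (auto intro: order_trans)
    have bd2: "\<forall>i<m. norm (?k i) \<le> L + L\<^sup>2 \<and> norm (?a i) \<le> L + L\<^sup>2 \<and> norm (?b i) \<le> L + L\<^sup>2"
    proof (intro allI impI conjI)
      fix i assume "i < m"
      then have i: "norm (a i) \<le> L" "norm (b i) \<le> L" using bd by auto
      have "norm (b i) * norm (a i) \<le> L * L" using i L by (intro mult_mono) auto
      then show "norm (?k i) \<le> L + L\<^sup>2"
        using norm_herm_le[of "b i" "a i"] L unfolding power2_eq_square by linarith
      have "r * norm (a i) \<le> 1 * L" using r i by (intro mult_mono) auto
      then show "norm (?a i) \<le> L + L\<^sup>2" using r L by (simp add: order_trans)
      show "norm (?b i) \<le> L + L\<^sup>2" using L2 by simp
    qed
    have 1: "integrable \<gamma> f1"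
      "\<bar>(\<integral>\<zeta>. f1 \<zeta> \<partial>\<gamma>) - (lin + h * (lap_coeff \<epsilon> p u * ((norm B)\<^sup>2 + (norm D)\<^sup>2)
                + 2 * anti_coeff \<epsilon> p u * Re ((cnj u)\<^sup>2 * herm B D)))\<bar> \<le> rem"
      using C[OF h bd1, of A]
      unfolding second_order_def Let_def f1_def lin_def B_def D_def rem_def S_def u_def by simp_all
    have D2: "(\<Sum>i<m. cnj (A i) *s ?a i) = r *\<^sub>R D"
      by (simp add: D_def scaleR_sum_right vec_eq_iff scaleR_conv_of_real[where 'a=complex] sum_distrib_left mult_ac)
    have 2: "integrable \<gamma> f2"
      "\<bar>(\<integral>\<zeta>. f2 \<zeta> \<partial>\<gamma>) - (lin + h * (lap_coeff \<epsilon> p u * (r * norm D)\<^sup>2))\<bar> \<le> rem"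
      using C[OF h bd2, of A] r
      unfolding second_order_def Let_def f2_def lin_def rem_def S_def u_def D2 by (simp_all add: power_mult_distrib)
    have "lap_coeff \<epsilon> p u * (r * norm D)\<^sup>2 \<le> lap_coeff \<epsilon> p u * ((norm B)\<^sup>2 + (norm D)\<^sup>2)
        + 2 * anti_coeff \<epsilon> p u * Re ((cnj u)\<^sup>2 * herm B D)"
      using \<epsilon> p r norm_herm_le by (intro quadratic_form_bound) auto
    then have "h * (lap_coeff \<epsilon> p u * (r * norm D)\<^sup>2) \<le> h * (lap_coeff \<epsilon> p u * ((norm B)\<^sup>2 + (norm D)\<^sup>2)
        + 2 * anti_coeff \<epsilon> p u * Re ((cnj u)\<^sup>2 * herm B D))"
      using h by (intro mult_left_mono) auto
    then have le: "(\<integral>\<zeta>. f2 \<zeta> \<partial>\<gamma>) \<le> (\<integral>\<zeta>. f1 \<zeta> \<partial>\<gamma>) + 2 * rem"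
      using 1(2) 2(2) by linarith
    have rem0: "rem \<ge> 0" using C0 h by (simp add: rem_def)
    have "(\<integral>\<^sup>+\<zeta>. f2 \<zeta> \<partial>\<gamma>) = ennreal (\<integral>\<zeta>. f2 \<zeta> \<partial>\<gamma>)"
      by (rule nn_integral_eq_integral[OF 2(1)]) (simp add: f2_def)
    also have "\<dots> \<le> ennreal ((\<integral>\<zeta>. f1 \<zeta> \<partial>\<gamma>) + 2 * rem)"
      using le by (rule ennreal_leI)
    also have "\<dots> = ennreal (\<integral>\<zeta>. f1 \<zeta> \<partial>\<gamma>) + ennreal (2 * rem)"
      using rem0 by (intro ennreal_plus integral_nonneg_AE) (auto simp: f1_def)
    also have "ennreal (\<integral>\<zeta>. f1 \<zeta> \<partial>\<gamma>) = (\<integral>\<^sup>+\<zeta>. f1 \<zeta> \<partial>\<gamma>)"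
      by (rule nn_integral_eq_integral[OF 1(1), symmetric]) (simp add: f1_def)
    finally show "(\<integral>\<^sup>+\<zeta>. regnorm \<epsilon> p (\<Sum>i<m. A i * exp (h * herm (b i) (a i) + sqrt h * (r * herm \<zeta> (a i)))) \<partial>\<gamma>)
     \<le> (\<integral>\<^sup>+\<zeta>. regnorm \<epsilon> p (\<Sum>i<m. A i * exp (sqrt h * (herm \<zeta> (a i) + herm (b i) \<zeta>))) \<partial>\<gamma>)
       + ennreal (2 * C * (h * sqrt h) * (1 + 2 * (\<Sum>i<m. norm (A i))) powr (p + 3))"
      unfolding f1_def f2_def sum_incr by (simp add: rem_def S_def herm_scaleR_right mult.assoc add.commute)
  qed
qed

text \<open>
  The function obtained from the exponential sum with data \<open>c\<close>, \<open>a\<close>, \<open>b\<close> by splitting its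
  Gaussian argument into independent summands of variances \<open>s\<close> and \<open>1 - s\<close> and taking the
  dilated holomorphic part in the first summand only; \<open>x\<close> stands for the first and \<open>y\<close> for the
  second.
\<close>

definition interp :: "real \<Rightarrow> nat \<Rightarrow> (nat \<Rightarrow> complex) \<Rightarrow> (nat \<Rightarrow> complex ^ 'n::finite) \<Rightarrow> (nat \<Rightarrow> complex ^ 'n)
    \<Rightarrow> real \<Rightarrow> complex ^ 'n \<Rightarrow> complex ^ 'n \<Rightarrow> complex" where
  "interp r m c a b s x y =
     (\<Sum>i<m. c i * exp (s * herm (b i) (a i) + herm y (a i) + herm (b i) y + r * herm x (a i)))"

lemma interp_measurable [measurable (raw)]:
  assumes [measurable]: "f \<in> borel_measurable M" "g \<in> borel_measurable M"
  shows "(\<lambda>x. interp r m c a b s (f x) (g x)) \<in> borel_measurable M"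
  unfolding interp_def by measurable

text \<open>
  Moving a Gaussian increment \<open>\<zeta>\<close> of variance \<open>h\<close> from the second summand to the first.
  Conditionally on the remaining parts \<open>x\<close> and \<open>y\<close> this is \<open>one_step\<close> for the coefficients \<open>A\<close>;
  since \<open>A\<close> grows exponentially in \<open>x\<close> and \<open>y\<close>, the error has a finite expectation, bounded
  independently of \<open>s\<close>.
\<close>

lemma interp_step:
  fixes a b :: "nat \<Rightarrow> complex ^ 'n::finite" and m :: nat and c :: "nat \<Rightarrow> complex"
  assumes \<epsilon>: "0 < \<epsilon>" "\<epsilon> \<le> 1" and p: "1 \<le> p"
    and r: "0 \<le> r" "r \<le> 1" "r\<^sup>2 = 1 - (1 - 2 / p)\<^sup>2"
  defines "F \<equiv> \<lambda>s. (\<integral>\<^sup>+x. \<integral>\<^sup>+y. ennreal (regnorm \<epsilon> p (interp r m c a b s (sqrt s *\<^sub>R x) (sqrt (1 - s) *\<^sub>R y)))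
     \<partial>\<gamma> \<partial>\<gamma>)"
  shows "\<exists>K\<ge>0. \<forall>s h. 0 \<le> s \<longrightarrow> 0 < h \<longrightarrow> s + h \<le> 1 \<longrightarrow> F (s + h) \<le> F s + ennreal (K * (h * sqrt h))"
proof -
  define L where "L = (\<Sum>i<m. norm (a i) + norm (b i))"
  have L: "norm (a i) \<le> L \<and> norm (b i) \<le> L" if "i < m" for i
  proof -
    have "norm (a i) + norm (b i) \<le> L"
      unfolding L_def using that by (intro member_le_sum[of i "{..<m}" "\<lambda>i. norm (a i) + norm (b i)"]) auto
    then show ?thesis using norm_ge_zero[of "a i"] norm_ge_zero[of "b i"] by linarith
  qed
  have L0: "L \<ge> 0" unfolding L_def by (intro sum_nonneg) auto
  obtain C where C0: "C \<ge> 0" and C: "\<And>h (m :: nat) A a b. 0 < h \<Longrightarrow> h \<le> 1 \<Longrightarrow>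
     (\<And>i. i < m \<Longrightarrow> norm (a i :: complex ^ 'n::finite) \<le> L \<and> norm (b i) \<le> L) \<Longrightarrow>
     (\<integral>\<^sup>+\<zeta>. regnorm \<epsilon> p (\<Sum>i<m. A i * exp (h * herm (b i) (a i) + sqrt h * (r * herm \<zeta> (a i)))) \<partial>\<gamma>)
     \<le> (\<integral>\<^sup>+\<zeta>. regnorm \<epsilon> p (\<Sum>i<m. A i * exp (sqrt h * (herm \<zeta> (a i) + herm (b i) \<zeta>))) \<partial>\<gamma>)
       + ennreal (C * (h * sqrt h) * (1 + 2 * (\<Sum>i<m. norm (A i))) powr (p + 3))"
    using one_step[OF \<epsilon> p L0 r, where 'n='n] by blast
  define c1 where "c1 = (\<Sum>i<m. norm (c i))"
  have c10: "c1 \<ge> 0" unfolding c1_def by (intro sum_nonneg) auto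
  define q where "q = p + 3"
  define E1 where "E1 = (\<lambda>x :: complex ^ 'n. exp (L * q * norm x))"
  define E2 where "E2 = (\<lambda>y :: complex ^ 'n. exp (2 * L * q * norm y))"
  define G where "G = ((1 + 2 * c1) * exp (L\<^sup>2)) powr q"
  define I1 where "I1 = (\<integral>x. E1 x \<partial>\<gamma>)"
  define I2 where "I2 = (\<integral>x. E2 x \<partial>\<gamma>)"
  have I1: "(\<integral>\<^sup>+x. ennreal (E1 x) \<partial>\<gamma>) = ennreal I1" "I1 \<ge> 0"
    unfolding I1_def E1_def
    by (intro nn_integral_eq_integral integrable_exp_norm_gauss integral_nonneg_AE; simp)+
  have I2: "(\<integral>\<^sup>+x. ennreal (E2 x) \<partial>\<gamma>) = ennreal I2" "I2 \<ge> 0"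
    unfolding I2_def E2_def
    by (intro nn_integral_eq_integral integrable_exp_norm_gauss integral_nonneg_AE; simp)+
  have [measurable]: "E1 \<in> borel_measurable borel" "E2 \<in> borel_measurable borel"
    unfolding E1_def E2_def by measurable
  define K where "K = C * G * I1 * I2"
  have "F (s + h) \<le> F s + ennreal (K * (h * sqrt h))" if s: "0 \<le> s" and h: "0 < h" "s + h \<le> 1" for s h
  proof -
    have h1: "h \<le> 1" using s h by simp
    define t where "t = sqrt (1 - (s + h))"
    have t: "0 \<le> t" "t \<le> 1" using s h by (auto simp: t_def)
    let ?N = "\<lambda>s x y. ennreal (regnorm \<epsilon> p (interp r m c a b s x y))"
    have lhs: "F (s + h) = (\<integral>\<^sup>+x. \<integral>\<^sup>+y. \<integral>\<^sup>+\<zeta>. ?N (s + h) (sqrt s *\<^sub>R x + sqrt h *\<^sub>R \<zeta>) (t *\<^sub>R y)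
        \<partial>\<gamma> \<partial>\<gamma> \<partial>\<gamma>)"
    proof -
      have "F (s + h) = (\<integral>\<^sup>+x. \<integral>\<^sup>+\<zeta>. \<integral>\<^sup>+y. ?N (s + h) (sqrt s *\<^sub>R x + sqrt h *\<^sub>R \<zeta>) (t *\<^sub>R y)
        \<partial>\<gamma> \<partial>\<gamma> \<partial>\<gamma>)"
        unfolding F_def t_def
        by (rule nn_integral_gauss_add[symmetric, where f="\<lambda>x. \<integral>\<^sup>+y. ?N (s + h) x (sqrt (1 - (s + h)) *\<^sub>R y) \<partial>\<gamma>"])
           (use s h in measurable)
      then show ?thesis
        by (subst gauss_pair.Fubini') measurable
    qed
    have rhs: "F s = (\<integral>\<^sup>+x. \<integral>\<^sup>+y. \<integral>\<^sup>+\<zeta>. ?N s (sqrt s *\<^sub>R x) (t *\<^sub>R y + sqrt h *\<^sub>R \<zeta>)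
        \<partial>\<gamma> \<partial>\<gamma> \<partial>\<gamma>)"
      unfolding F_def
    proof (rule nn_integral_cong)
      fix x :: "complex ^ 'n"
      show "(\<integral>\<^sup>+y. ?N s (sqrt s *\<^sub>R x) (sqrt (1 - s) *\<^sub>R y) \<partial>\<gamma>)
        = (\<integral>\<^sup>+y. \<integral>\<^sup>+\<zeta>. ?N s (sqrt s *\<^sub>R x) (t *\<^sub>R y + sqrt h *\<^sub>R \<zeta>) \<partial>\<gamma> \<partial>\<gamma>)"
        using nn_integral_gauss_add[where f="\<lambda>y. ?N s (sqrt s *\<^sub>R x) y" and s="1 - (s + h)" and h=h] s h
        by (simp add: t_def)
    qed
    have inner: "(\<integral>\<^sup>+\<zeta>. ?N (s + h) (sqrt s *\<^sub>R x + sqrt h *\<^sub>R \<zeta>) (t *\<^sub>R y) \<partial>\<gamma>)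
       \<le> (\<integral>\<^sup>+\<zeta>. ?N s (sqrt s *\<^sub>R x) (t *\<^sub>R y + sqrt h *\<^sub>R \<zeta>) \<partial>\<gamma>)
         + ennreal (C * (h * sqrt h) * G) * ennreal (E1 x) * ennreal (E2 y)" for x y
    proof -
      define A where "A = (\<lambda>i. c i * exp (s * herm (b i) (a i) + herm (t *\<^sub>R y) (a i) + herm (b i) (t *\<^sub>R y) + r * herm (sqrt s *\<^sub>R x) (a i)))"
      have e1: "interp r m c a b (s + h) (sqrt s *\<^sub>R x + sqrt h *\<^sub>R \<zeta>) (t *\<^sub>R y)
        = (\<Sum>i<m. A i * exp (h * herm (b i) (a i) + sqrt h * (r * herm \<zeta> (a i))))" for \<zeta>
        unfolding interp_def A_def mult.assoc exp_add[symmetric]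
        by (intro sum.cong arg_cong2[where f="(*)"] arg_cong[where f=exp] refl)
           (simp add: herm_add_left herm_scaleR_left algebra_simps)
      have e2: "interp r m c a b s (sqrt s *\<^sub>R x) (t *\<^sub>R y + sqrt h *\<^sub>R \<zeta>)
        = (\<Sum>i<m. A i * exp (sqrt h * (herm \<zeta> (a i) + herm (b i) \<zeta>)))" for \<zeta>
        unfolding interp_def A_def mult.assoc exp_add[symmetric]
        by (intro sum.cong arg_cong2[where f="(*)"] arg_cong[where f=exp] refl)
           (simp add: herm_add_left herm_add_right herm_scaleR_left herm_scaleR_right algebra_simps)
      have Ab: "norm (A i) \<le> norm (c i) * exp (L\<^sup>2 + 2 * L * norm y + L * norm x)" if "i < m" for i
      proof -
        have LL: "norm (a i) \<le> L" "norm (b i) \<le> L" using L[OF that] by auto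
        have bnd: "norm (herm v w) \<le> L * l" if "norm v \<le> L" "norm w \<le> l" for v w :: "complex ^ 'n" and l
          using norm_herm_le[of v w] mult_mono[of "norm v" L "norm w" l] that L0 by auto
        have bnd': "norm (herm w v) \<le> L * l" if "norm v \<le> L" "norm w \<le> l" for v w :: "complex ^ 'n" and l
          using norm_herm_le[of w v] mult_mono[of "norm v" L "norm w" l] that L0 by (auto simp: mult.commute)
        have ss: "sqrt s \<le> 1" using s h by simp
        have ty: "norm (t *\<^sub>R y) \<le> norm y" using t by (simp add: mult_left_le_one_le)
        have sx: "norm (sqrt s *\<^sub>R x) \<le> norm x" using ss s by (simp add: mult_left_le_one_le)
        have "norm (s * herm (b i) (a i)) \<le> 1 * L\<^sup>2"
          unfolding norm_mult power2_eq_square using s h bnd[of "b i" "a i" L] LL by (intro mult_mono) auto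
        moreover have "norm (herm (t *\<^sub>R y) (a i)) \<le> L * norm y" using bnd'[OF LL(1) ty] .
        moreover have "norm (herm (b i) (t *\<^sub>R y)) \<le> L * norm y" using bnd[OF LL(2) ty] .
        moreover have "norm (r * herm (sqrt s *\<^sub>R x) (a i)) \<le> 1 * (L * norm x)"
          unfolding norm_mult using r bnd'[OF LL(1) sx] by (intro mult_mono) auto
        ultimately have "norm (s * herm (b i) (a i) + herm (t *\<^sub>R y) (a i) + herm (b i) (t *\<^sub>R y) + r * herm (sqrt s *\<^sub>R x) (a i))
           \<le> L\<^sup>2 + L * norm y + L * norm y + L * norm x"
          by (intro norm_triangle_le add_mono) auto
        then have "norm (exp (s * herm (b i) (a i) + herm (t *\<^sub>R y) (a i) + herm (b i) (t *\<^sub>R y) + r * herm (sqrt s *\<^sub>R x) (a i)))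
           \<le> exp (L\<^sup>2 + 2 * L * norm y + L * norm x)"
          by (intro order_trans[OF norm_exp]) (simp add: mult.assoc)
        then show ?thesis unfolding A_def norm_mult by (intro mult_left_mono) auto
      qed
      define X where "X = exp (L\<^sup>2 + 2 * L * norm y + L * norm x)"
      have X1: "X \<ge> 1" unfolding X_def using L0 by simp
      have "(\<Sum>i<m. norm (A i)) \<le> c1 * X"
        unfolding c1_def sum_distrib_right X_def using Ab by (intro sum_mono) auto
      then have "1 + 2 * (\<Sum>i<m. norm (A i)) \<le> (1 + 2 * c1) * X"
        using X1 by (simp add: algebra_simps)
      then have "(1 + 2 * (\<Sum>i<m. norm (A i))) powr q \<le> ((1 + 2 * c1) * X) powr q"
        using p by (intro powr_mono2) (auto simp: q_def intro!: add_nonneg_nonneg sum_nonneg)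
      also have "(1 + 2 * c1) * X = ((1 + 2 * c1) * exp (L\<^sup>2)) * exp (L * norm x) * exp (2 * L * norm y)"
        unfolding X_def by (simp add: exp_add)
      also have "\<dots> powr q = G * E1 x * E2 y"
        using c10 by (simp add: powr_mult G_def E1_def E2_def exp_powr_real mult_ac)
      finally have Sq: "(1 + 2 * (\<Sum>i<m. norm (A i))) powr q \<le> G * E1 x * E2 y" .
      have "C * (h * sqrt h) * (1 + 2 * (\<Sum>i<m. norm (A i))) powr (p + 3) \<le> C * (h * sqrt h) * (G * E1 x * E2 y)"
        using Sq C0 h unfolding q_def by (intro mult_left_mono) auto
      then have "ennreal (C * (h * sqrt h) * (1 + 2 * (\<Sum>i<m. norm (A i))) powr (p + 3))
         \<le> ennreal (C * (h * sqrt h) * G) * ennreal (E1 x) * ennreal (E2 y)"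
        using C0 h by (simp add: ennreal_mult'[symmetric] E1_def E2_def G_def mult.assoc ennreal_leI)
      then show ?thesis
        unfolding e1 e2 using C[OF h(1) h1, of m a b A] L by (auto intro: order_trans add_left_mono)
    qed
    have "F (s + h) \<le> (\<integral>\<^sup>+x. \<integral>\<^sup>+y. (\<integral>\<^sup>+\<zeta>. ?N s (sqrt s *\<^sub>R x) (t *\<^sub>R y + sqrt h *\<^sub>R \<zeta>) \<partial>\<gamma>)
         + ennreal (C * (h * sqrt h) * G) * ennreal (E1 x) * ennreal (E2 y) \<partial>\<gamma> \<partial>\<gamma>)"
      unfolding lhs by (intro nn_integral_mono inner)
    also have "\<dots> = F s + (\<integral>\<^sup>+x. \<integral>\<^sup>+y. ennreal (C * (h * sqrt h) * G) * ennreal (E1 x) * ennreal (E2 y) \<partial>\<gamma> \<partial>\<gamma>)"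
      unfolding rhs by (subst nn_integral_add, measurable, subst nn_integral_add, measurable)
    also have "(\<integral>\<^sup>+x. \<integral>\<^sup>+y. ennreal (C * (h * sqrt h) * G) * ennreal (E1 x) * ennreal (E2 y) \<partial>\<gamma> \<partial>\<gamma>)
      = ennreal (C * (h * sqrt h) * G) * ennreal I1 * ennreal I2"
      by (simp add: nn_integral_cmult nn_integral_multc I1 I2)
    also have "\<dots> = ennreal (K * (h * sqrt h))"
      using C0 h I1 I2 by (simp add: K_def G_def ennreal_mult'[symmetric] mult_ac)
    finally show ?thesis .
  qed
  moreover have "K \<ge> 0" using C0 I1 I2 by (simp add: K_def G_def)
  ultimately show ?thesis by blast
qed

text \<open>
  The interval from \<open>0\<close> to \<open>1\<close> is divided into \<open>n\<close> steps, each of which increases the moment by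
  at most a constant times \<open>n powr (- 3 / 2)\<close>, so the total increase tends to \<open>0\<close>.
\<close>

lemma interp_monotone:
  fixes a b :: "nat \<Rightarrow> complex ^ 'n::finite" and m :: nat and c :: "nat \<Rightarrow> complex" and r :: real
  assumes \<epsilon>: "0 < \<epsilon>" "\<epsilon> \<le> 1" and p: "1 \<le> p"
    and r: "0 \<le> r" "r \<le> 1" "r\<^sup>2 = 1 - (1 - 2 / p)\<^sup>2"
  shows "(\<integral>\<^sup>+x. regnorm \<epsilon> p (\<Sum>i<m. c i * exp (herm (b i) (a i) + r * herm x (a i))) \<partial>\<gamma>)
    \<le> (\<integral>\<^sup>+y. regnorm \<epsilon> p (exp_sum m c a b y) \<partial>\<gamma>)"
proof -
  define F where "F = (\<lambda>s. (\<integral>\<^sup>+x. \<integral>\<^sup>+y. ennreal (regnorm \<epsilon> p (interp r m c a b s (sqrt s *\<^sub>R x) (sqrt (1 - s) *\<^sub>R y)))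
     \<partial>\<gamma> \<partial>\<gamma>))"
  obtain K where K: "K \<ge> 0" and step: "\<And>s h. 0 \<le> s \<Longrightarrow> 0 < h \<Longrightarrow> s + h \<le> 1 \<Longrightarrow> F (s + h) \<le> F s + ennreal (K * (h * sqrt h))"
    using interp_step[OF \<epsilon> p r, of m c a b] unfolding F_def by blast
  have N: "F 1 \<le> F 0 + ennreal (K * sqrt (1 / real n))" if n: "n > 0" for n :: nat
  proof -
    let ?h = "1 / real n"
    have "F (real j * ?h) \<le> F 0 + ennreal (real j * (K * (?h * sqrt ?h)))" if "j \<le> n" for j
      using that
    proof (induction j)
      case (Suc j)
      have le: "real j * ?h + ?h \<le> 1" using Suc.prems n by (simp add: field_simps)
      have "F (real (Suc j) * ?h) = F (real j * ?h + ?h)" by (simp add: algebra_simps add_divide_distrib)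
      also have "\<dots> \<le> F (real j * ?h) + ennreal (K * (?h * sqrt ?h))"
        using n le by (intro step) auto
      also have "\<dots> \<le> F 0 + ennreal (real j * (K * (?h * sqrt ?h))) + ennreal (K * (?h * sqrt ?h))"
        using Suc by (intro add_right_mono) auto
      also have "\<dots> = F 0 + ennreal (real (Suc j) * (K * (?h * sqrt ?h)))"
      proof -
        have "K * (?h * sqrt ?h) \<ge> 0" using K by simp
        then show ?thesis
          unfolding add.assoc by (subst ennreal_plus[symmetric]) (use K in \<open>auto simp: algebra_simps add_divide_distrib\<close>)
      qed
      finally show ?case .
    qed simp
    from this[of n] show ?thesis using n by simp
  qed
  have le: "F 1 \<le> F 0"
  proof (rule ennreal_le_epsilon)
    fix e :: real assume "0 < e"
    have "(\<lambda>n. K * sqrt (1 / real n)) \<longlonglongrightarrow> K * sqrt 0"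
      by (intro tendsto_intros lim_const_over_n)
    then have "eventually (\<lambda>n. K * sqrt (1 / real n) < e) sequentially"
      using \<open>0 < e\<close> by (intro order_tendstoD) auto
    then have "eventually (\<lambda>n. K * sqrt (1 / real n) < e \<and> n > 0) sequentially"
      using eventually_gt_at_top[of 0] by eventually_elim simp
    then obtain n where "K * sqrt (1 / real n) < e" "n > 0"
      by (auto simp: eventually_sequentially)
    then show "F 1 \<le> F 0 + ennreal e"
      using N[of n] by (auto intro!: order_trans[OF N[of n]] add_left_mono ennreal_leI)
  qed
  have "F 0 = (\<integral>\<^sup>+y. regnorm \<epsilon> p (exp_sum m c a b y) \<partial>\<gamma>)"
    by (simp add: F_def interp_def exp_sum_def emeasure_gauss_1)
  moreover have "F 1 = (\<integral>\<^sup>+x. regnorm \<epsilon> p (\<Sum>i<m. c i * exp (herm (b i) (a i) + r * herm x (a i))) \<partial>\<gamma>)"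
    by (simp add: F_def interp_def emeasure_gauss_1)
  ultimately show ?thesis using le by simp
qed

section \<open>The contraction on exponential sums\<close>

text \<open>
  For square-integrable \<open>g\<close> this is the orthogonal projection of \<open>g\<close> onto the holomorphic
  functions, evaluated at \<open>r z\<close>.
\<close>

definition holo_part :: "real \<Rightarrow> (complex ^ 'n::finite \<Rightarrow> complex) \<Rightarrow> complex ^ 'n \<Rightarrow> complex" where
  "holo_part r g z = (\<integral>w. exp (r * herm z w) * g w \<partial>\<gamma>)"

lemma holo_part_measurable [measurable]:
  assumes [measurable]: "g \<in> borel_measurable borel"
  shows "holo_part r g \<in> borel_measurable borel"
  unfolding holo_part_def[abs_def] by measurable

text \<open>
  Stated with nonnegative integrals, so that it is meaningful before \<open>holo_part r g\<close> is known
  to have a finite norm.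
\<close>

definition Lp_contracted :: "real \<Rightarrow> real \<Rightarrow> (complex ^ 'n::finite \<Rightarrow> complex) \<Rightarrow> bool" where
  "Lp_contracted r p g \<longleftrightarrow>
     (\<integral>\<^sup>+z. norm (holo_part r g z) powr p \<partial>\<gamma>) \<le> (\<integral>\<^sup>+w. norm (g w) powr p \<partial>\<gamma>)"

lemma holo_part_exp_sum:
  "holo_part r (exp_sum m c a b) z = (\<Sum>i<m. c i * exp (herm (b i) (a i) + r * herm z (a i)))"
proof -
  have e: "exp (r * herm z w) * (c i * exp (herm w (a i) + herm (b i) w))
     = c i * exp (herm w (a i) + herm (b i + r *\<^sub>R z) w)" for i w
    by (simp add: exp_add[symmetric] herm_add_left herm_scaleR_left mult_ac add_ac)
  have int: "integrable \<gamma> (\<lambda>w. c i * exp (herm w (a i) + herm (b i + r *\<^sub>R z) w))" for i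
    using laplace_gauss(1) by (rule integrable_mult_right)
  have val: "(\<integral>w. c i * exp (herm w (a i) + herm (b i + r *\<^sub>R z) w) \<partial>\<gamma>)
     = c i * exp (herm (b i) (a i) + r * herm z (a i))" for i
    unfolding integral_mult_right_zero laplace_gauss(2) by (simp add: herm_add_left herm_scaleR_left)
  show ?thesis
    unfolding holo_part_def exp_sum_def sum_distrib_left e
    by (subst Bochner_Integration.integral_sum) (simp_all only: int val)
qed

lemma Lp_contracted_exp_sum:
  fixes a b :: "nat \<Rightarrow> complex ^ 'n::finite" and c :: "nat \<Rightarrow> complex"
  assumes p: "1 \<le> p" and r: "0 \<le> r" "r \<le> 1" "r\<^sup>2 = 1 - (1 - 2 / p)\<^sup>2"
  shows "Lp_contracted r p (exp_sum m c a b)"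
proof -
  let ?g = "exp_sum m c a b"
  have pw: "((norm u)\<^sup>2) powr (p / 2) = norm u powr p" for u :: complex
    by (simp add: powr_powr flip: powr_numeral)
  define e where "e = (\<lambda>k::nat. 1 / (real k + 1))"
  have e: "0 < e k" "e k \<le> 1" for k by (auto simp: e_def)
  have e0: "e \<longlonglongrightarrow> 0" unfolding e_def using LIMSEQ_inverse_real_of_nat by (simp add: inverse_eq_divide add.commute)
  have le: "(\<integral>\<^sup>+z. norm (holo_part r ?g z) powr p \<partial>\<gamma>) \<le> (\<integral>\<^sup>+y. regnorm (e k) p (?g y) \<partial>\<gamma>)" for k
  proof -
    have "(\<integral>\<^sup>+z. norm (holo_part r ?g z) powr p \<partial>\<gamma>) \<le> (\<integral>\<^sup>+z. regnorm (e k) p (holo_part r ?g z) \<partial>\<gamma>)"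
    proof (intro nn_integral_mono ennreal_leI)
      fix z
      show "norm (holo_part r ?g z) powr p \<le> regnorm (e k) p (holo_part r ?g z)"
        unfolding regnorm_def pw[symmetric] using p e[of k] by (intro powr_mono2) auto
    qed
    also have "\<dots> \<le> (\<integral>\<^sup>+y. regnorm (e k) p (?g y) \<partial>\<gamma>)"
      unfolding holo_part_exp_sum by (rule interp_monotone[OF e p r])
    finally show ?thesis .
  qed
  have lim: "(\<lambda>k. \<integral>\<^sup>+y. regnorm (e k) p (?g y) \<partial>\<gamma>) \<longlonglongrightarrow> (\<integral>\<^sup>+y. norm (?g y) powr p \<partial>\<gamma>)"
  proof (rule nn_integral_dominated_convergence)
    define L where "L = (\<Sum>i<m. norm (a i) + norm (b i))"
    define K where "K = (\<Sum>i<m. norm (c i))"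
    have K0: "K \<ge> 0" unfolding K_def by (intro sum_nonneg) auto
    have L0: "L \<ge> 0" unfolding L_def by (intro sum_nonneg) auto
    let ?w = "\<lambda>y :: complex ^ 'n. (1 + K) powr p * exp ((L * p) * norm y)"
    have gle: "norm (?g y) \<le> K * exp (L * norm y)" for y
    proof -
      have "norm (?g y) \<le> (\<Sum>i<m. norm (c i) * exp (L * norm y))"
        unfolding exp_sum_def
      proof (rule order_trans[OF norm_sum], rule sum_mono)
        fix i assume i: "i \<in> {..<m}"
        have "norm (a i) + norm (b i) \<le> L"
          unfolding L_def using i by (intro member_le_sum[of i "{..<m}" "\<lambda>i. norm (a i) + norm (b i)"]) auto
        then have "(norm (a i) + norm (b i)) * norm y \<le> L * norm y" by (intro mult_right_mono) auto
        then have "norm (herm y (a i) + herm (b i) y) \<le> L * norm y"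
          using norm_herm_le[of y "a i"] norm_herm_le[of "b i" y] norm_triangle_ineq[of "herm y (a i)" "herm (b i) y"]
          by (simp add: algebra_simps)
        then have "norm (exp (herm y (a i) + herm (b i) y)) \<le> exp (L * norm y)"
          by (intro order_trans[OF norm_exp]) simp
        then show "norm (c i * exp (herm y (a i) + herm (b i) y)) \<le> norm (c i) * exp (L * norm y)"
          unfolding norm_mult by (intro mult_left_mono) auto
      qed
      then show ?thesis by (simp add: K_def sum_distrib_right)
    qed
    show "AE y in \<gamma>. ennreal (regnorm (e j) p (?g y)) \<le> ennreal (?w y)" for j
    proof (intro AE_I2 ennreal_leI)
      fix y
      have "regnorm (e j) p (?g y) \<le> (1 + K * exp (L * norm y)) powr p"
        using e[of j] p gle by (intro regnorm_le) auto
      also have "\<dots> \<le> ((1 + K) * exp (L * norm y)) powr p"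
        using p K0 L0 by (intro powr_mono2) (auto simp: algebra_simps)
      also have "\<dots> = ?w y" using K0 by (simp add: powr_mult exp_powr_real mult_ac)
      finally show "regnorm (e j) p (?g y) \<le> ?w y" .
    qed
    have "integrable \<gamma> ?w"
      by (intro integrable_mult_right integrable_exp_norm_gauss)
    then show "(\<integral>\<^sup>+y. ennreal (?w y) \<partial>\<gamma>) < \<infinity>"
      by (subst nn_integral_eq_integral) auto
    show "AE y in \<gamma>. (\<lambda>k. ennreal (regnorm (e k) p (?g y))) \<longlonglongrightarrow> ennreal (norm (?g y) powr p)"
    proof (intro AE_I2 tendsto_ennrealI)
      fix y
      have "(\<lambda>k. ((norm (?g y))\<^sup>2 + e k) powr (p / 2)) \<longlonglongrightarrow> ((norm (?g y))\<^sup>2 + 0) powr (p / 2)"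
        using p e by (intro tendsto_powr2 tendsto_intros e0) (auto intro!: always_eventually less_imp_le)
      then show "(\<lambda>k. regnorm (e k) p (?g y)) \<longlonglongrightarrow> norm (?g y) powr p"
        by (simp add: regnorm_def pw)
    qed
  qed measurable
  show ?thesis unfolding Lp_contracted_def
    by (rule LIMSEQ_le_const[OF lim]) (use le in auto)
qed

section \<open>Passage to arbitrary integrable functions\<close>

text \<open>
  Dominated convergence gives pointwise convergence of the holomorphic parts and convergence of
  the norms of the approximants; Fatou's lemma gives the rest. The closure property is applied
  to pass successively to bounded continuous, to bounded measurable and to \<open>L\<^sup>p\<close> functions.
\<close>

lemma Lp_contracted_limit:
  fixes g :: "nat \<Rightarrow> complex ^ 'n::finite \<Rightarrow> complex"
  assumes [measurable]: "\<And>k. g k \<in> borel_measurable borel" "f \<in> borel_measurable borel" "D \<in> borel_measurable borel"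
    and p: "p > 0"
    and contr: "\<And>k. Lp_contracted r p (g k)"
    and bd: "\<And>k w. norm (g k w) \<le> D w"
    and lim: "AE w in \<gamma>. (\<lambda>k. g k w) \<longlonglongrightarrow> f w"
    and D1: "\<And>c. integrable \<gamma> (\<lambda>w. D w * exp (c * norm w))"
    and Dp: "(\<integral>\<^sup>+w. D w powr p \<partial>\<gamma>) < \<infinity>"
  shows "Lp_contracted r p f"
proof -
  have conv: "(\<lambda>k. holo_part r (g k) z) \<longlonglongrightarrow> holo_part r f z" for z
    unfolding holo_part_def
  proof (rule integral_dominated_convergence)
    show "integrable \<gamma> (\<lambda>w. D w * exp ((\<bar>r\<bar> * norm z) * norm w))" by (rule D1)
    show "AE w in \<gamma>. (\<lambda>k. exp (r * herm z w) * g k w) \<longlonglongrightarrow> exp (r * herm z w) * f w"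
      using lim by eventually_elim (intro tendsto_intros)
    show "AE w in \<gamma>. norm (exp (r * herm z w) * g k w) \<le> D w * exp ((\<bar>r\<bar> * norm z) * norm w)" for k
    proof (intro AE_I2)
      fix w
      have "norm (r * herm z w) \<le> \<bar>r\<bar> * norm z * norm w"
        unfolding norm_mult using mult_left_mono[OF norm_herm_le[of z w], of "\<bar>r\<bar>"] by (simp add: mult.assoc)
      then have "norm (exp (r * herm z w)) \<le> exp (\<bar>r\<bar> * norm z * norm w)"
        by (intro order_trans[OF norm_exp]) simp
      then have "norm (exp (r * herm z w)) * norm (g k w) \<le> exp (\<bar>r\<bar> * norm z * norm w) * D w"
        using bd by (intro mult_mono) auto
      then show "norm (exp (r * herm z w) * g k w) \<le> D w * exp ((\<bar>r\<bar> * norm z) * norm w)"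
        by (simp add: norm_mult mult.commute)
    qed
  qed measurable
  have "(\<integral>\<^sup>+z. norm (holo_part r f z) powr p \<partial>\<gamma>)
     = (\<integral>\<^sup>+z. liminf (\<lambda>k. ennreal (norm (holo_part r (g k) z) powr p)) \<partial>\<gamma>)"
  proof (intro nn_integral_cong)
    fix z
    have "(\<lambda>k. norm (holo_part r (g k) z) powr p) \<longlonglongrightarrow> norm (holo_part r f z) powr p"
      using p by (intro tendsto_powr2 tendsto_norm conv tendsto_const) auto
    then have "(\<lambda>k. ennreal (norm (holo_part r (g k) z) powr p)) \<longlonglongrightarrow> ennreal (norm (holo_part r f z) powr p)"
      by (rule tendsto_ennrealI)
    then show "ennreal (norm (holo_part r f z) powr p) = liminf (\<lambda>k. ennreal (norm (holo_part r (g k) z) powr p))"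
      by (intro lim_imp_Liminf[symmetric]) auto
  qed
  also have "\<dots> \<le> liminf (\<lambda>k. \<integral>\<^sup>+z. norm (holo_part r (g k) z) powr p \<partial>\<gamma>)"
    by (rule nn_integral_liminf) measurable
  also have "\<dots> \<le> liminf (\<lambda>k. \<integral>\<^sup>+w. norm (g k w) powr p \<partial>\<gamma>)"
    using contr by (intro Liminf_mono always_eventually) (simp add: Lp_contracted_def)
  also have "\<dots> = (\<integral>\<^sup>+w. norm (f w) powr p \<partial>\<gamma>)"
  proof (rule lim_imp_Liminf)
    show "(\<lambda>k. \<integral>\<^sup>+w. norm (g k w) powr p \<partial>\<gamma>) \<longlonglongrightarrow> (\<integral>\<^sup>+w. norm (f w) powr p \<partial>\<gamma>)"
    proof (rule nn_integral_dominated_convergence[OF _ _ _ _ Dp])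
      show "AE w in \<gamma>. ennreal (norm (g j w) powr p) \<le> ennreal (D w powr p)" for j
        using bd p by (intro AE_I2 ennreal_leI powr_mono2) auto
      show "AE w in \<gamma>. (\<lambda>k. ennreal (norm (g k w) powr p)) \<longlonglongrightarrow> ennreal (norm (f w) powr p)"
        using lim
      proof eventually_elim
        case (elim w)
        then show ?case using p by (intro tendsto_ennrealI tendsto_powr2 tendsto_norm tendsto_const) auto
      qed
    qed measurable
  qed simp
  finally show ?thesis unfolding Lp_contracted_def .
qed

text \<open>
  Exponential sums, generated one term at a time so that closure under products is a simple
  induction.
\<close>

inductive_set expsums :: "(complex ^ 'n::finite \<Rightarrow> complex) set" where
  zero: "(\<lambda>w. 0) \<in> expsums"
| step: "g \<in> expsums \<Longrightarrow> (\<lambda>w. g w + c * exp (herm w a + herm b w)) \<in> expsums"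

lemma expsums_imp_exp_sum: "g \<in> expsums \<Longrightarrow> \<exists>m c a b. g = exp_sum m c a b"
proof (induction rule: expsums.induct)
  case zero
  have "(\<lambda>w. 0) = exp_sum 0 c a b" for c a b by (simp add: exp_sum_def[abs_def])
  then show ?case by blast
next
  case (step g c a b)
  then obtain m c' a' b' where g: "g = exp_sum m c' a' b'" by blast
  have "(\<lambda>w. g w + c * exp (herm w a + herm b w)) = exp_sum (Suc m) (c'(m := c)) (a'(m := a)) (b'(m := b))"
    unfolding g exp_sum_def by (intro ext) simp
  then show ?case by blast
qed

lemma expsums_add: "g \<in> expsums \<Longrightarrow> h \<in> expsums \<Longrightarrow> (\<lambda>w. g w + h w) \<in> expsums"
proof (induction rule: expsums.induct)
  case (step g c a b)
  then have "(\<lambda>w. (g w + h w) + c * exp (herm w a + herm b w)) \<in> expsums" by (intro expsums.step) auto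
  then show ?case by (simp add: add_ac)
qed simp

lemma expsums_single: "(\<lambda>w. c * exp (herm w a + herm b w)) \<in> expsums"
  using expsums.step[OF expsums.zero, of c a b] by simp

lemma expsums_mult_single: "g \<in> expsums \<Longrightarrow> (\<lambda>w. (c * exp (herm w a + herm b w)) * g w) \<in> expsums"
proof (induction rule: expsums.induct)
  case zero then show ?case by (simp add: expsums.zero)
next
  case (step g c' a' b')
  have "(\<lambda>w. c * exp (herm w a + herm b w) * g w + (c * c') * exp (herm w (a + a') + herm (b + b') w)) \<in> expsums"
    by (rule expsums.step[OF step.IH])
  moreover have "c * exp (herm w a + herm b w) * g w + (c * c') * exp (herm w (a + a') + herm (b + b') w)
     = c * exp (herm w a + herm b w) * (g w + c' * exp (herm w a' + herm b' w))" for w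
    by (simp add: herm_add_left herm_add_right exp_add algebra_simps)
  ultimately show ?case by simp
qed

lemma expsums_mult: "g \<in> expsums \<Longrightarrow> h \<in> expsums \<Longrightarrow> (\<lambda>w. g w * h w) \<in> expsums"
proof (induction rule: expsums.induct)
  case zero then show ?case by (simp add: expsums.zero)
next
  case (step g c a b)
  then have "(\<lambda>w. g w * h w + (c * exp (herm w a + herm b w)) * h w) \<in> expsums"
    by (intro expsums_add expsums_mult_single) auto
  then show ?case by (simp add: distrib_right)
qed

lemma expsums_const: "(\<lambda>w. c) \<in> expsums"
  using expsums_single[of c 0 0] by simp

lemma expsums_sum: "(\<And>b. b \<in> B \<Longrightarrow> g b \<in> expsums) \<Longrightarrow> (\<lambda>w. \<Sum>b\<in>B. g b w) \<in> expsums"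
  by (induction B rule: infinite_finite_induct) (auto simp: expsums.zero expsums_add)

text \<open>
  The imaginary exponentials are among the admissible ones because the exponents are allowed to
  be real-linear. This is what makes bounded approximants available.
\<close>

lemma expsums_sin: "(\<lambda>w. of_real (sin (t * (w \<bullet> e)))) \<in> expsums"
proof -
  define \<kappa> where "\<kappa> = \<i> * of_real t / 2"
  define a where "a = cnj \<kappa> *s e"
  define b where "b = \<kappa> *s e"
  have ip: "herm w a + herm b w = \<i> * of_real (t * (w \<bullet> e))" for w
  proof -
    have "herm w e + herm e w = of_real (2 * (w \<bullet> e))"
      using cnj_herm[of w e] by (simp add: complex_eq_iff Re_herm inner_commute)
    moreover have "herm w a + herm b w = \<kappa> * (herm w e + herm e w)"
      by (simp add: a_def b_def herm_scale_left herm_scale_right distrib_left)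
    ultimately show ?thesis by (simp add: \<kappa>_def)
  qed
  have im: "herm w (- a) + herm (- b) w = - (\<i> * of_real (t * (w \<bullet> e)))" for w
    unfolding ip[symmetric]
    using herm_scaleR_left[of "-1" b w] herm_scaleR_right[of w "-1" a] by simp
  have "(\<lambda>w. (1 / (2 * \<i>)) * exp (herm w a + herm b w) + (- 1 / (2 * \<i>)) * exp (herm w (- a) + herm (- b) w)) \<in> expsums"
    by (intro expsums_add expsums_single)
  moreover have "(1 / (2 * \<i>)) * exp (herm w a + herm b w) + (- 1 / (2 * \<i>)) * exp (herm w (- a) + herm (- b) w)
     = of_real (sin (t * (w \<bullet> e)))" for w
    unfolding ip im by (simp add: sin_of_real[symmetric] sin_exp_eq diff_divide_distrib right_diff_distrib del: of_real_mult)
  ultimately show ?thesis by simp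
qed

text \<open>
  A trigonometric map of the space into a box that tends to the identity as \<open>R\<close> grows.
  Composing with it turns polynomials into exponential sums, and keeps an approximation on the
  box valid, hence bounded, on the whole space.
\<close>

definition sine_map :: "real \<Rightarrow> 'a::euclidean_space \<Rightarrow> 'a" where
  "sine_map R w = (\<Sum>b\<in>Basis. (R * sin (1 / R * (w \<bullet> b))) *\<^sub>R b)"

lemma expsums_real_polynomial:
  assumes "real_polynomial_function q"
  shows "(\<lambda>w :: complex ^ 'n::finite. complex_of_real (q (sine_map R w))) \<in> expsums"
  using assms
proof (induction rule: real_polynomial_function.induct)
  case (linear l)
  have "l (sine_map R w) = (\<Sum>b\<in>Basis. R * sin (1 / R * (w \<bullet> b)) * l b)" for w
    unfolding sine_map_def by (simp add: linear.hyps bounded_linear.linear linear_sum linear_scale)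
  then have "(\<lambda>w. complex_of_real (l (sine_map R w)))
    = (\<lambda>w. \<Sum>b\<in>Basis. of_real (R * l b) * of_real (sin (1 / R * (w \<bullet> b))))"
    by (simp add: mult_ac)
  then show ?case by (simp only: expsums_sum expsums_mult expsums_const expsums_sin)
next
  case (const c) then show ?case by (rule expsums_const)
next
  case (add f g) then show ?case using expsums_add by simp
next
  case (mult f g) then show ?case using expsums_mult by simp
qed

lemma sine_map_tendsto: "(\<lambda>n. sine_map (real n + 1) w) \<longlonglongrightarrow> w"
proof -
  have s: "(\<lambda>n. (real n + 1) * sin (1 / (real n + 1) * x)) \<longlonglongrightarrow> x" for x :: real
    by real_asymp
  have "(\<lambda>n. sine_map (real n + 1) w) \<longlonglongrightarrow> (\<Sum>b\<in>Basis. (w \<bullet> b) *\<^sub>R b)"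
    unfolding sine_map_def by (intro tendsto_intros s)
  then show ?thesis by (simp add: euclidean_representation)
qed

text \<open>
  By Stone-Weierstrass \<open>f\<close> is close to a polynomial on the box of half-width \<open>R\<close>; both are
  composed with \<open>sine_map R\<close>.
\<close>

lemma bounded_continuous_expsums_approx:
  fixes f :: "complex ^ 'n::finite \<Rightarrow> complex"
  assumes f: "continuous_on UNIV f" and M: "\<And>w. norm (f w) \<le> M"
  shows "\<exists>h. (\<forall>k. h k \<in> expsums) \<and> (\<forall>k w. norm (h k w) \<le> M + 1) \<and> (\<forall>w. (\<lambda>k. h k w) \<longlonglongrightarrow> f w)"
proof -
  have "\<exists>h \<in> expsums. \<forall>w. norm (f (sine_map (real k + 1) w) - h w) < 1 / (real k + 1)" for k
  proof -
    define R where "R = real k + 1"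
    have R: "R > 0" by (simp add: R_def)
    let ?S = "cbox (\<Sum>b\<in>Basis. (- R) *\<^sub>R b) (\<Sum>b\<in>Basis. R *\<^sub>R b) :: (complex ^ 'n) set"
    obtain g where g: "polynomial_function g" "\<And>x. x \<in> ?S \<Longrightarrow> norm (f x - g x) < 1 / R"
      using Stone_Weierstrass_polynomial_function[of ?S f "1 / R"] R continuous_on_subset[OF f] by auto
    have S: "sine_map R w \<in> ?S" for w
    proof -
      have "\<bar>R * sin x\<bar> \<le> R" for x using R by (simp add: abs_mult mult_left_le abs_sin_le_one)
      then have "- R \<le> R * sin x \<and> R * sin x \<le> R" for x by (simp add: abs_le_iff minus_le_iff)
      then show ?thesis by (simp add: cbox_def sine_map_def inner_sum_left inner_Basis if_distrib cong: if_cong)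
    qed
    have "real_polynomial_function (Re \<circ> g)" "real_polynomial_function (Im \<circ> g)"
      using g(1) bounded_linear_Re bounded_linear_Im unfolding polynomial_function_def by auto
    then have "(\<lambda>w. of_real ((Re \<circ> g) (sine_map R w)) + \<i> * of_real ((Im \<circ> g) (sine_map R w))) \<in> expsums"
      by (intro expsums_add expsums_mult expsums_const expsums_real_polynomial)
    moreover have "of_real ((Re \<circ> g) (sine_map R w)) + \<i> * of_real ((Im \<circ> g) (sine_map R w)) = g (sine_map R w)" for w
      by (simp add: complex_eq[symmetric])
    ultimately have "(\<lambda>w. g (sine_map R w)) \<in> expsums" by simp
    then show ?thesis unfolding R_def[symmetric] using g(2)[OF S] by (intro bexI[of _ "\<lambda>w. g (sine_map R w)"]) auto
  qed
  then obtain h where h: "\<And>k. h k \<in> expsums"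
     and hf: "\<And>k w. norm (f (sine_map (real k + 1) w) - h k w) < 1 / (real k + 1)"
    by metis
  have "norm (h k w) \<le> M + 1" for k w
  proof -
    have "norm (h k w) \<le> norm (f (sine_map (real k + 1) w)) + norm (f (sine_map (real k + 1) w) - h k w)"
      by (metis add_diff_cancel_left' diff_diff_eq2 diff_add_cancel norm_triangle_sub norm_minus_commute add.commute)
    also have "\<dots> \<le> M + 1" using M[of "sine_map (real k + 1) w"] less_imp_le[OF less_le_trans[OF hf[of k w], of 1]]
      by (intro add_mono) auto
    finally show ?thesis .
  qed
  moreover have "(\<lambda>k. h k w) \<longlonglongrightarrow> f w" for w
  proof -
    have "(\<lambda>k. f (sine_map (real k + 1) w)) \<longlonglongrightarrow> f w"
      using f by (intro continuous_on_tendsto_compose[OF f sine_map_tendsto]) auto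
    moreover have "(\<lambda>k. f (sine_map (real k + 1) w) - h k w) \<longlonglongrightarrow> 0"
    proof (rule Lim_null_comparison)
      show "eventually (\<lambda>k. norm (f (sine_map (real k + 1) w) - h k w) \<le> 1 / (real k + 1)) sequentially"
        using hf by (intro always_eventually) (auto intro: less_imp_le)
      show "(\<lambda>k. 1 / (real k + 1)) \<longlonglongrightarrow> 0" by real_asymp
    qed
    ultimately have "(\<lambda>k. f (sine_map (real k + 1) w) - (f (sine_map (real k + 1) w) - h k w)) \<longlonglongrightarrow> f w - 0"
      by (rule tendsto_diff)
    then show ?thesis by simp
  qed
  ultimately show ?thesis using h by blast
qed

lemma AE_gauss_of_AE_lborel: "AE w in lborel. P w \<Longrightarrow> AE w in gauss_measure \<beta>. P w"
  unfolding gauss_measure_def by (subst AE_density) auto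

text \<open>
  Continuous approximants exist almost everywhere by measurability; projecting their values
  onto the closed disc of radius \<open>M\<close> makes them bounded and keeps their limit.
\<close>

lemma bounded_measurable_continuous_approx:
  fixes f :: "complex ^ 'n::finite \<Rightarrow> complex"
  assumes [measurable]: "f \<in> borel_measurable borel" and M: "\<And>w. norm (f w) \<le> M"
  shows "\<exists>g. (\<forall>k. continuous_on UNIV (g k)) \<and> (\<forall>k w. norm (g k w) \<le> M)
     \<and> (AE w in \<gamma>. (\<lambda>k. g k w) \<longlonglongrightarrow> f w)"
proof -
  have M0: "0 \<le> M" using M[of 0] norm_ge_zero[of "f 0"] by linarith
  have "f \<in> borel_measurable lebesgue"
    by (rule measurable_completion) measurable
  then have "f measurable_on UNIV"
    by (rule lebesgue_measurable_imp_measurable_on) simp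
  then obtain N g where N: "negligible N" and g: "\<And>n. continuous_on UNIV (g n)"
    and lim: "\<And>x. x \<notin> N \<Longrightarrow> (\<lambda>n. g n x) \<longlonglongrightarrow> f x"
    unfolding measurable_on_def by auto
  define clip where "clip = (\<lambda>z :: complex. closest_point (cball 0 M) z)"
  have cl: "continuous_on UNIV clip"
    unfolding clip_def using M0 by (intro continuous_on_closest_point) auto
  have clb: "norm (clip z) \<le> M" for z
    using closest_point_in_set[of "cball (0::complex) M" z] M0 by (auto simp: clip_def)
  have cli: "clip z = z" if "norm z \<le> M" for z
    using that by (simp add: clip_def closest_point_self)
  have "AE x in lebesgue. x \<notin> N"
    using N by (intro AE_not_in) (simp add: negligible_iff_null_sets)
  then have "AE x in lborel. x \<notin> N" by (simp add: AE_completion_iff)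
  then have "AE x in lborel. (\<lambda>k. clip (g k x)) \<longlonglongrightarrow> f x"
  proof eventually_elim
    case (elim x)
    have "(\<lambda>k. clip (g k x)) \<longlonglongrightarrow> clip (f x)"
      using lim[OF elim] by (intro continuous_on_tendsto_compose[OF cl]) auto
    then show ?case using cli[OF M] by simp
  qed
  then have "AE x in \<gamma>. (\<lambda>k. clip (g k x)) \<longlonglongrightarrow> f x"
    by (rule AE_gauss_of_AE_lborel)
  moreover have "continuous_on UNIV (\<lambda>x. clip (g k x))" for k
    using continuous_on_compose2[OF cl g] by auto
  ultimately show ?thesis using clb by (intro exI[of _ "\<lambda>k x. clip (g k x)"]) auto
qed

text \<open>
  The heart of the matter: taking the holomorphic part and dilating by \<open>r = 2 sqrt (p - 1) / p\<close>
  is a contraction of \<open>L\<^sup>p\<close> of the standard Gaussian measure. The assumption \<open>p > 1\<close> guarantees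
  that \<open>f\<close> times an exponential is integrable.
\<close>

lemma Lp_contracted_Lp:
  fixes f :: "complex ^ 'n::finite \<Rightarrow> complex"
  assumes p: "1 < p" and r: "0 \<le> r" "r \<le> 1" "r\<^sup>2 = 1 - (1 - 2 / p)\<^sup>2"
    and [measurable]: "f \<in> borel_measurable borel"
    and fp: "(\<integral>\<^sup>+w. norm (f w) powr p \<partial>\<gamma>) < \<infinity>"
  shows "Lp_contracted r p f"
proof -
  have const_int: "integrable (\<gamma> :: (complex ^ 'n) measure) (\<lambda>w. C * exp (c * norm w))" for C c :: real
    by (intro integrable_mult_right integrable_exp_norm_gauss)
  have const_fin: "(\<integral>\<^sup>+w. ennreal (C powr p) \<partial>(\<gamma> :: (complex ^ 'n) measure)) < \<infinity>" for C
    by (simp add: emeasure_gauss_1)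
  have cont: "Lp_contracted r p g" if g: "continuous_on UNIV g" "\<And>w. norm (g w) \<le> M"
    for g :: "complex ^ 'n \<Rightarrow> complex" and M
  proof -
    obtain h where h: "\<And>k. h k \<in> expsums" "\<And>k w. norm (h k w) \<le> M + 1" "\<And>w. (\<lambda>k. h k w) \<longlonglongrightarrow> g w"
      using bounded_continuous_expsums_approx[OF g] by blast
    have hs: "\<exists>m c a b. h k = exp_sum m c a b" for k using h(1) by (rule expsums_imp_exp_sum)
    have [measurable]: "h k \<in> borel_measurable borel" for k using hs[of k] by (elim exE) simp
    have [measurable]: "g \<in> borel_measurable borel" using g(1) by (rule borel_measurable_continuous_onI)
    show ?thesis
    proof (rule Lp_contracted_limit[where g=h and D="\<lambda>_. M + 1"])
      show "Lp_contracted r p (h k)" for k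
        using hs[of k] p r by (elim exE) (simp add: Lp_contracted_exp_sum)
    qed (use h p const_int const_fin in auto)
  qed
  have bdd: "Lp_contracted r p g" if g[measurable]: "g \<in> borel_measurable borel" and M: "\<And>w. norm (g w) \<le> M"
    for g :: "complex ^ 'n \<Rightarrow> complex" and M
  proof -
    obtain h where h: "\<And>k. continuous_on UNIV (h k)" "\<And>k w. norm (h k w) \<le> M"
        "AE w in \<gamma>. (\<lambda>k. h k w) \<longlonglongrightarrow> g w"
      using bounded_measurable_continuous_approx[OF g M] by blast
    show ?thesis
    proof (rule Lp_contracted_limit[where g=h and D="\<lambda>_. M"])
      show "Lp_contracted r p (h k)" for k by (rule cont[OF h(1,2)])
    qed (use h p const_int const_fin in \<open>auto intro: borel_measurable_continuous_onI\<close>)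
  qed
  define g where "g = (\<lambda>k w. if norm (f w) \<le> real k then f w else 0)"
  have [measurable]: "g k \<in> borel_measurable borel" for k unfolding g_def by measurable
  show ?thesis
  proof (rule Lp_contracted_limit[where g=g and D="\<lambda>w. norm (f w)"])
    show "Lp_contracted r p (g k)" for k by (rule bdd[where M="real k"]) (auto simp: g_def)
    show "AE w in \<gamma>. (\<lambda>k. g k w) \<longlonglongrightarrow> f w"
    proof (intro AE_I2)
      fix w
      obtain n where n: "norm (f w) \<le> real n" using real_arch_simple by blast
      have "eventually (\<lambda>k. g k w = f w) sequentially"
        using eventually_ge_at_top[of n] by eventually_elim (use n in \<open>auto simp: g_def\<close>)
      then show "(\<lambda>k. g k w) \<longlonglongrightarrow> f w" by (rule tendsto_eventually)
    qed
    show "integrable \<gamma> (\<lambda>w. norm (f w) * exp (c * norm w))" for c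
    proof (rule Bochner_Integration.integrable_bound)
      \<comment> \<open>The conjugate exponent of p; a product is at most the sum of the two conjugate powers.\<close>
      let ?q = "1 + 1 / (p - 1)"
      have "integrable \<gamma> (\<lambda>w. norm (f w) powr p)"
        using fp by (intro integrableI_nonneg) auto
      then show "integrable \<gamma> (\<lambda>w. norm (f w) powr p + exp ((c * ?q) * norm w))"
        by (intro Bochner_Integration.integrable_add integrable_exp_norm_gauss)
      show "AE w in \<gamma>. norm (norm (f w) * exp (c * norm w)) \<le> norm (norm (f w) powr p + exp ((c * ?q) * norm w))"
      proof (intro AE_I2)
        fix w
        let ?a = "norm (f w)" and ?b = "exp (c * norm w)"
        have bq: "exp ((c * ?q) * norm w) = ?b powr ?q" by (simp add: exp_powr_real mult_ac)
        have "?a * ?b \<le> ?a powr p + ?b powr ?q"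
        proof (cases "?b \<le> ?a powr (p - 1)")
          case True
          then have "?a * ?b \<le> ?a * ?a powr (p - 1)" by (intro mult_left_mono) auto
          also have "\<dots> = ?a powr p"
            using powr_add[of ?a 1 "p - 1"] by (cases "?a = 0") simp_all
          finally show ?thesis by (simp add: add_increasing2)
        next
          case False
          then have "(?a powr (p - 1)) powr (1 / (p - 1)) \<le> ?b powr (1 / (p - 1))"
            using p by (intro powr_mono2) auto
          then have "?a \<le> ?b powr (1 / (p - 1))" using p by (simp add: powr_powr)
          then have "?a * ?b \<le> ?b powr (1 / (p - 1)) * ?b" by (intro mult_right_mono) auto
          also have "\<dots> = ?b powr ?q" by (simp add: powr_add)
          finally show ?thesis by (simp add: add_increasing)
        qed
        then show "norm (norm (f w) * exp (c * norm w)) \<le> norm (norm (f w) powr p + exp ((c * ?q) * norm w))"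
          unfolding bq by (simp add: abs_mult)
      qed
    qed measurable
  qed (use fp p in \<open>auto simp: g_def\<close>)
qed

section \<open>Change of Gaussian weight\<close>

lemma gauss_measure_scaled_integral:
  fixes f :: "complex ^ 'n::finite \<Rightarrow> 'b::{banach, second_countable_topology}"
  assumes "t > 0" and [measurable]: "f \<in> borel_measurable borel"
  shows "(\<integral>w. f w \<partial>gauss_measure (t\<^sup>2)) = (\<integral>x. f ((1 / t) *\<^sub>R x) \<partial>\<gamma>)"
    and "integrable (gauss_measure (t\<^sup>2)) f \<longleftrightarrow> integrable \<gamma> (\<lambda>x. f ((1 / t) *\<^sub>R x))"
  using assms by (simp_all add: gauss_measure_eq_distr[of "t\<^sup>2"] integral_distr integrable_distr_eq)

lemma gauss_measure_scaled_nn_integral: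
  fixes f :: "complex ^ 'n::finite \<Rightarrow> ennreal"
  assumes "t > 0" and [measurable]: "f \<in> borel_measurable borel"
  shows "(\<integral>\<^sup>+w. f w \<partial>gauss_measure (t\<^sup>2)) = (\<integral>\<^sup>+x. f ((1 / t) *\<^sub>R x) \<partial>\<gamma>)"
  using assms by (simp add: gauss_measure_eq_distr[of "t\<^sup>2"] nn_integral_distr)

lemma integrable_exp_norm_gauss_measure:
  assumes "\<beta> > 0"
  shows "integrable (gauss_measure \<beta> :: (complex ^ 'n::finite) measure) (\<lambda>w. exp (c * norm w))"
proof -
  have "integrable (gauss_measure ((sqrt \<beta>)\<^sup>2) :: (complex ^ 'n) measure) (\<lambda>w. exp (c * norm w))"
    using assms integrable_exp_norm_gauss[of "c / sqrt \<beta>", where 'n='n]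
    by (subst gauss_measure_scaled_integral(2)) (simp_all del: real_sqrt_pow2)
  then show ?thesis using assms by simp
qed

lemma gauss_density_reweight:
  fixes w :: "complex ^ 'n::finite"
  assumes "\<beta>' > 0"
  shows "(\<beta> / pi) ^ CARD('n) * exp (- \<beta> * (norm w)\<^sup>2) * exp ((\<beta> - \<beta>') * (norm w)\<^sup>2)
    = (\<beta> / \<beta>') ^ CARD('n) * ((\<beta>' / pi) ^ CARD('n) * exp (- \<beta>' * (norm w)\<^sup>2))"
  using assms by (simp add: power_divide mult.assoc exp_add[symmetric] left_diff_distrib)

lemma gauss_measure_reweight_integral:
  fixes f :: "complex ^ 'n::finite \<Rightarrow> complex"
  assumes "\<beta> > 0" "\<beta>' > 0" and [measurable]: "f \<in> borel_measurable borel"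
  shows "(\<integral>w. exp ((\<beta> - \<beta>') * (norm w)\<^sup>2) * f w \<partial>gauss_measure \<beta>)
     = of_real ((\<beta> / \<beta>') ^ CARD('n)) * (\<integral>w. f w \<partial>gauss_measure \<beta>')"
proof -
  note gauss_density_reweight[OF assms(2), where 'n='n and \<beta>=\<beta>]
  then have eq: "((\<beta> / pi) ^ CARD('n) * exp (- \<beta> * (norm w)\<^sup>2)) *\<^sub>R (exp ((\<beta> - \<beta>') * (norm w)\<^sup>2) * f w)
     = of_real ((\<beta> / \<beta>') ^ CARD('n)) * (((\<beta>' / pi) ^ CARD('n) * exp (- \<beta>' * (norm w)\<^sup>2)) *\<^sub>R f w)" for w
    unfolding scaleR_conv_of_real mult.assoc[symmetric] of_real_mult[symmetric] by (simp only: mult.assoc)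
  have "(\<integral>w. exp ((\<beta> - \<beta>') * (norm w)\<^sup>2) * f w \<partial>gauss_measure \<beta>)
     = (\<integral>w. ((\<beta> / pi) ^ CARD('n) * exp (- \<beta> * (norm w)\<^sup>2)) *\<^sub>R (exp ((\<beta> - \<beta>') * (norm w)\<^sup>2) * f w) \<partial>lborel)"
    using assms(1) by (intro integral_gauss_measure) measurable
  also have "\<dots> = of_real ((\<beta> / \<beta>') ^ CARD('n)) * (\<integral>w. f w \<partial>gauss_measure \<beta>')"
    unfolding eq integral_mult_right_zero integral_gauss_measure(1)[OF assms(3) assms(2)] ..
  finally show ?thesis .
qed

lemma gauss_measure_reweight_nn_integral:
  fixes f :: "complex ^ 'n::finite \<Rightarrow> ennreal"
  assumes "\<beta> > 0" "\<beta>' > 0" and [measurable]: "f \<in> borel_measurable borel"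
  shows "(\<integral>\<^sup>+w. ennreal (exp ((\<beta> - \<beta>') * (norm w)\<^sup>2)) * f w \<partial>gauss_measure \<beta>)
     = ennreal ((\<beta> / \<beta>') ^ CARD('n)) * (\<integral>\<^sup>+w. f w \<partial>gauss_measure \<beta>')"
proof -
  note gauss_density_reweight[OF assms(2), where 'n='n and \<beta>=\<beta>]
  then have "ennreal ((\<beta> / pi) ^ CARD('n) * exp (- \<beta> * (norm w)\<^sup>2)) * ennreal (exp ((\<beta> - \<beta>') * (norm w)\<^sup>2))
     = ennreal ((\<beta> / \<beta>') ^ CARD('n)) * ennreal ((\<beta>' / pi) ^ CARD('n) * exp (- \<beta>' * (norm w)\<^sup>2))" for w :: "complex ^ 'n"
    using assms by (simp only: ennreal_mult'[symmetric] exp_ge_zero zero_le_power divide_nonneg_nonneg less_imp_le)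
       (simp add: ennreal_mult'[symmetric])
  then have eq: "ennreal ((\<beta> / pi) ^ CARD('n) * exp (- \<beta> * (norm w)\<^sup>2)) * (ennreal (exp ((\<beta> - \<beta>') * (norm w)\<^sup>2)) * f w)
     = ennreal ((\<beta> / \<beta>') ^ CARD('n)) * (ennreal ((\<beta>' / pi) ^ CARD('n) * exp (- \<beta>' * (norm w)\<^sup>2)) * f w)" for w
    by (simp only: mult.assoc[symmetric])
  show ?thesis
    by (simp only: nn_integral_gauss_measure[OF assms(3)]) (subst nn_integral_gauss_measure, measurable, simp only: eq, subst nn_integral_cmult, measurable)
qed

section \<open>Integrability and holomorphy of the projection\<close>

lemma borel_measurable_gauss_measure: "borel_measurable (gauss_measure \<beta>) = borel_measurable borel"
  by (rule measurable_cong_sets) simp_all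


text \<open>
  With respect to Lebesgue measure the hypothesis says that \<open>F = \<bar>f\<bar> exp (- \<alpha> \<bar>w\<bar>\<^sup>2 / 2)\<close> is in
  \<open>L\<^sup>p\<close>, while the weight of the conclusion leaves another Gaussian factor \<open>exp (- \<alpha> \<bar>w\<bar>\<^sup>2 /
  2)\<close>. The latter, multiplied by \<open>exp (K \<bar>w\<bar>)\<close>, is integrable and bounded, and \<open>F \<le> 1 + F powr
  p\<close>.
\<close>

lemma Lp_space_gauss_integrable_exp:
  fixes f :: "complex ^ 'n::finite \<Rightarrow> complex"
  assumes p: "1 \<le> p" and \<alpha>: "0 < \<alpha>" and f: "f \<in> Lp_space p (gauss_measure (\<alpha> * p / 2))"
  shows "integrable (gauss_measure \<alpha>) (\<lambda>w. exp (K * norm w) * norm (f w))"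
proof -
  have [measurable]: "f \<in> borel_measurable borel" using f by (simp add: Lp_space_def borel_measurable_gauss_measure)
  let ?\<beta> = "\<alpha> * p / 2"
  have \<beta>: "?\<beta> > 0" using p \<alpha> by simp
  let ?F = "\<lambda>w. norm (f w) * exp (- (\<alpha> / 2) * (norm w)\<^sup>2)"
  let ?E = "\<lambda>w :: complex ^ 'n. exp (- (\<alpha> / 2) * (norm w)\<^sup>2) * exp (K * norm w)"
  define C where "C = exp (K\<^sup>2 / (2 * \<alpha>))"
  have Fp: "?F w powr p = exp (- ?\<beta> * (norm w)\<^sup>2) * norm (f w) powr p" for w
    by (simp add: powr_mult exp_powr_real mult_ac)
  have "integrable (gauss_measure ?\<beta>) (\<lambda>w. norm (f w) powr p)"
    using f by (simp add: Lp_space_def borel_measurable_gauss_measure)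
  then have "integrable lborel (\<lambda>w. ((?\<beta> / pi) ^ CARD('n) * exp (- ?\<beta> * (norm w)\<^sup>2)) *\<^sub>R (norm (f w) powr p))"
    using \<beta> by (subst (asm) integral_gauss_measure) auto
  then have "integrable lborel (\<lambda>w. (?\<beta> / pi) ^ CARD('n) * (?F w powr p))"
    unfolding Fp by (simp add: mult.assoc)
  then have iF: "integrable lborel (\<lambda>w. ?F w powr p)"
    using \<beta> by (subst (asm) integrable_mult_left_iff) auto
  have "integrable (gauss_measure (\<alpha> / 2) :: (complex ^ 'n) measure) (\<lambda>w. exp (K * norm w))"
    using \<alpha> by (intro integrable_exp_norm_gauss_measure) simp
  then have "integrable lborel (\<lambda>w :: complex ^ 'n. ((\<alpha> / 2 / pi) ^ CARD('n) * exp (- (\<alpha> / 2) * (norm w)\<^sup>2)) *\<^sub>R exp (K * norm w))"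
    using \<alpha> by (subst (asm) integral_gauss_measure) auto
  then have "integrable lborel (\<lambda>w :: complex ^ 'n. (\<alpha> / 2 / pi) ^ CARD('n) * ?E w)"
    by (simp add: mult.assoc)
  then have iE: "integrable lborel ?E"
    using \<alpha> by (subst (asm) integrable_mult_left_iff) auto
  have EC: "?E w \<le> C" for w
  proof -
    have "0 \<le> (K - \<alpha> * norm w)\<^sup>2" by simp
    then have "K * norm w - (\<alpha> / 2) * (norm w)\<^sup>2 \<le> K\<^sup>2 / (2 * \<alpha>)"
      using \<alpha> by (simp add: field_simps power2_eq_square)
    then show ?thesis unfolding C_def exp_add[symmetric] by simp
  qed
  have main: "?F w * ?E w \<le> ?E w + C * (?F w powr p)" for w
  proof (cases "?F w \<le> 1")
    case True
    then have "?F w * ?E w \<le> 1 * ?E w" by (intro mult_right_mono) auto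
    moreover have "0 \<le> C * (?F w powr p)" by (simp add: C_def)
    ultimately show ?thesis by linarith
  next
    case False
    then have "?F w powr 1 \<le> ?F w powr p" using p by (intro powr_mono) auto
    then have "?F w * ?E w \<le> ?F w powr p * C" using EC False by (intro mult_mono) auto
    then have "?F w * ?E w \<le> C * (?F w powr p)" by (simp only: mult.commute)
    moreover have "0 \<le> ?E w" by simp
    ultimately show ?thesis by linarith
  qed
  have "integrable lborel (\<lambda>w. ?F w * ?E w)"
  proof (rule Bochner_Integration.integrable_bound)
    show "integrable lborel (\<lambda>w. ?E w + C * (?F w powr p))"
      using iE iF by (intro Bochner_Integration.integrable_add integrable_mult_right)
    show "AE w in lborel. norm (?F w * ?E w) \<le> norm (?E w + C * (?F w powr p))"
    proof (intro AE_I2)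
      fix w
      have "0 \<le> ?F w * ?E w" by (intro mult_nonneg_nonneg) auto
      then have "norm (?F w * ?E w) \<le> ?E w + C * (?F w powr p)"
        unfolding real_norm_def using main[of w] by (simp only: abs_of_nonneg)
      then show "norm (?F w * ?E w) \<le> norm (?E w + C * (?F w powr p))"
        unfolding real_norm_def[of "?E w + _"] by (rule order_trans[OF _ abs_ge_self])
    qed
  qed measurable
  moreover have "(\<lambda>w. ?F w * ?E w) = (\<lambda>w. exp (- \<alpha> * (norm w)\<^sup>2) * (exp (K * norm w) * norm (f w)))"
  proof
    fix w :: "complex ^ 'n"
    have "exp (- (\<alpha> / 2) * (norm w)\<^sup>2) * exp (- (\<alpha> / 2) * (norm w)\<^sup>2) = exp (- \<alpha> * (norm w)\<^sup>2)"
      by (simp add: exp_add[symmetric])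
    moreover have "?F w * ?E w = (exp (- (\<alpha> / 2) * (norm w)\<^sup>2) * exp (- (\<alpha> / 2) * (norm w)\<^sup>2)) * (exp (K * norm w) * norm (f w))"
      by (simp only: mult_ac)
    ultimately show "?F w * ?E w = exp (- \<alpha> * (norm w)\<^sup>2) * (exp (K * norm w) * norm (f w))"
      by (simp only:)
  qed
  ultimately have "integrable lborel (\<lambda>w. exp (- \<alpha> * (norm w)\<^sup>2) * (exp (K * norm w) * norm (f w)))"
    by (simp only:)
  then have "integrable lborel (\<lambda>w. (\<alpha> / pi) ^ CARD('n) * (exp (- \<alpha> * (norm w)\<^sup>2) * (exp (K * norm w) * norm (f w))))"
    by (rule integrable_mult_right)
  then show ?thesis
    using \<alpha> by (subst integral_gauss_measure) (simp_all add: mult.assoc)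
qed

lemma norm_exp_herm_le: "0 \<le> \<alpha> \<Longrightarrow> norm (exp (of_real \<alpha> * herm z w)) \<le> exp (\<alpha> * norm z * norm w)"
proof -
  assume a: "0 \<le> \<alpha>"
  have "norm (of_real \<alpha> * herm z w) \<le> \<alpha> * norm z * norm w"
    unfolding norm_mult using a mult_left_mono[OF norm_herm_le[of z w], of \<alpha>] by (simp add: mult.assoc)
  then show ?thesis by (intro order_trans[OF norm_exp]) simp
qed

lemma bargmann_integrand_integrable:
  fixes f :: "complex ^ 'n::finite \<Rightarrow> complex"
  assumes p: "1 \<le> p" and \<alpha>: "0 < \<alpha>" and f: "f \<in> Lp_space p (gauss_measure (\<alpha> * p / 2))"
  shows "integrable (gauss_measure \<alpha>) (bargmann_integrand \<alpha> f z)"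
proof (rule Bochner_Integration.integrable_bound)
  have [measurable]: "f \<in> borel_measurable borel" using f by (simp add: Lp_space_def borel_measurable_gauss_measure)
  show "integrable (gauss_measure \<alpha>) (\<lambda>w. exp (\<alpha> * norm z * norm w) * norm (f w))"
    by (rule Lp_space_gauss_integrable_exp[OF assms])
  show "bargmann_integrand \<alpha> f z \<in> borel_measurable (gauss_measure \<alpha>)"
    unfolding bargmann_integrand_def[abs_def] by measurable
  show "AE w in gauss_measure \<alpha>. norm (bargmann_integrand \<alpha> f z w) \<le> norm (exp (\<alpha> * norm z * norm w) * norm (f w))"
    using norm_exp_herm_le[of \<alpha> z] \<alpha> by (intro AE_I2) (auto simp: bargmann_integrand_def norm_mult intro!: mult_right_mono)
qed

text \<open>
  Differentiation under the integral sign, with \<open>\<bar>exp x - 1 - x\<bar> \<le> \<bar>x\<bar>\<^sup>2 exp \<bar>x\<bar>\<close> as the bound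
  for the remainder. The derivative is complex linear because \<open>herm\<close> is in its first argument.
\<close>

lemma entire_bargmann:
  fixes f :: "complex ^ 'n::finite \<Rightarrow> complex"
  assumes p: "1 \<le> p" and \<alpha>: "0 < \<alpha>" and f: "f \<in> Lp_space p (gauss_measure (\<alpha> * p / 2))"
  shows "entire_fun (bargmann \<alpha> f)"
  unfolding entire_fun_def
proof
  fix z :: "complex ^ 'n"
  have [measurable]: "f \<in> borel_measurable borel" using f by (simp add: Lp_space_def borel_measurable_gauss_measure)
  let ?G = "gauss_measure \<alpha> :: (complex ^ 'n) measure"
  define k where "k = (\<lambda>v w. of_real \<alpha> * herm v w * bargmann_integrand \<alpha> f z w)"
  define D where "D = (\<lambda>v. \<integral>w. k v w \<partial>?G)"
  define B where "B = (\<lambda>w. exp ((\<alpha> * norm z + 3 * \<alpha>) * norm w) * norm (f w))"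
  define C where "C = (\<integral>w. B w \<partial>?G)"
  have Bint: "integrable ?G B" unfolding B_def by (rule Lp_space_gauss_integrable_exp[OF assms])
  have bi: "integrable ?G (bargmann_integrand \<alpha> f x)" for x by (rule bargmann_integrand_integrable[OF assms])
  have [measurable]: "bargmann_integrand \<alpha> f x \<in> borel_measurable borel" for x
    unfolding bargmann_integrand_def[abs_def] by measurable
  have kle: "norm (k v w) \<le> norm v * B w" for v w
  proof -
    have "norm (k v w) = \<alpha> * norm (herm v w) * (norm (exp (of_real \<alpha> * herm z w)) * norm (f w))"
      using \<alpha> by (simp add: k_def bargmann_integrand_def norm_mult)
    also have "\<dots> \<le> \<alpha> * (norm v * norm w) * (exp (\<alpha> * norm z * norm w) * norm (f w))"
      using norm_herm_le norm_exp_herm_le[of \<alpha> z w] \<alpha> by (intro mult_mono) auto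
    also have "\<dots> = norm v * ((\<alpha> * norm w) * exp (\<alpha> * norm z * norm w) * norm (f w))" by (simp add: mult_ac)
    also have "\<dots> \<le> norm v * (exp (3 * \<alpha> * norm w) * exp (\<alpha> * norm z * norm w) * norm (f w))"
    proof (intro mult_left_mono mult_right_mono)
      have "\<alpha> * norm w \<le> exp (\<alpha> * norm w)" using exp_ge_add_one_self[of "\<alpha> * norm w"] by linarith
      also have "\<dots> \<le> exp (3 * \<alpha> * norm w)" using \<alpha> by simp
      finally show "\<alpha> * norm w \<le> exp (3 * \<alpha> * norm w)" .
    qed auto
    finally show ?thesis by (simp add: B_def exp_add[symmetric] algebra_simps)
  qed
  have kint: "integrable ?G (k v)" for v
  proof (rule Bochner_Integration.integrable_bound)
    show "integrable ?G (\<lambda>w. norm v * B w)" using Bint by simp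
    show "k v \<in> borel_measurable ?G" unfolding k_def by measurable
    show "AE w in ?G. norm (k v w) \<le> norm (norm v * B w)"
      unfolding real_norm_def by (intro AE_I2 order_trans[OF kle abs_ge_self])
  qed
  have bl: "bounded_linear D"
  proof (rule bounded_linear_intro[where K=C])
    show "D (x + y) = D x + D y" for x y
    proof -
      have "k (x + y) = (\<lambda>w. k x w + k y w)" by (intro ext) (simp add: k_def herm_add_left algebra_simps)
      then show ?thesis unfolding D_def using kint by simp
    qed
    show "D (t *\<^sub>R x) = t *\<^sub>R D x" for t x
    proof -
      have "k (t *\<^sub>R x) = (\<lambda>w. t *\<^sub>R k x w)" by (intro ext) (simp add: k_def herm_scaleR_left scaleR_conv_of_real[where 'a=complex])
      then show ?thesis unfolding D_def by simp
    qed
    show "norm (D x) \<le> norm x * C" for x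
    proof -
      have "norm (D x) \<le> (\<integral>w. norm x * B w \<partial>?G)"
        unfolding D_def using kint Bint kle by (intro order_trans[OF integral_norm_bound] integral_mono integrable_norm) auto
      then show ?thesis by (simp add: C_def)
    qed
  qed
  have rem: "norm (bargmann \<alpha> f (z + v) - bargmann \<alpha> f z - D v) \<le> (norm v)\<^sup>2 * C" if v: "norm v \<le> 1" for v
  proof -
    have pt: "norm (bargmann_integrand \<alpha> f (z + v) w - bargmann_integrand \<alpha> f z w - k v w) \<le> (norm v)\<^sup>2 * B w" for w
    proof -
      let ?x = "of_real \<alpha> * herm v w"
      have "bargmann_integrand \<alpha> f (z + v) w - bargmann_integrand \<alpha> f z w - k v w
         = (exp ?x - 1 - ?x) * (exp (of_real \<alpha> * herm z w) * f w)"
        by (simp add: bargmann_integrand_def k_def herm_add_left distrib_left exp_add algebra_simps)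
      then have "norm (bargmann_integrand \<alpha> f (z + v) w - bargmann_integrand \<alpha> f z w - k v w)
         \<le> ((norm ?x)\<^sup>2 * exp (norm ?x)) * (exp (\<alpha> * norm z * norm w) * norm (f w))"
        using norm_exp_minus_one_minus_le[of ?x] norm_exp_herm_le[of \<alpha> z w] \<alpha>
        by (simp only: norm_mult) (intro mult_mono; simp)
      also have "\<dots> \<le> ((norm v)\<^sup>2 * exp (3 * \<alpha> * norm w)) * (exp (\<alpha> * norm z * norm w) * norm (f w))"
      proof (intro mult_right_mono)
        have x: "norm ?x \<le> norm v * (\<alpha> * norm w)"
          unfolding norm_mult using \<alpha> mult_left_mono[OF norm_herm_le[of v w], of \<alpha>] by (simp add: mult_ac)
        also have "\<dots> \<le> 1 * (\<alpha> * norm w)" using v \<alpha> by (intro mult_right_mono) auto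
        finally have x1: "norm ?x \<le> \<alpha> * norm w" by simp
        have e: "\<alpha> * norm w \<le> exp (\<alpha> * norm w)" using exp_ge_add_one_self[of "\<alpha> * norm w"] by linarith
        have "(norm ?x)\<^sup>2 * exp (norm ?x) \<le> (norm v * exp (\<alpha> * norm w))\<^sup>2 * exp (\<alpha> * norm w)"
          using order_trans[OF x mult_left_mono[OF e]] x1 by (intro mult_mono power_mono) auto
        also have "\<dots> = (norm v)\<^sup>2 * exp (3 * \<alpha> * norm w)"
          by (simp add: power_mult_distrib power2_eq_square exp_add[symmetric] mult.assoc)
        finally show "(norm ?x)\<^sup>2 * exp (norm ?x) \<le> (norm v)\<^sup>2 * exp (3 * \<alpha> * norm w)" .
      qed simp
      also have "\<dots> = (norm v)\<^sup>2 * B w" by (simp add: B_def exp_add[symmetric] algebra_simps)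
      finally show ?thesis .
    qed
    have "bargmann \<alpha> f (z + v) - bargmann \<alpha> f z - D v
      = (\<integral>w. bargmann_integrand \<alpha> f (z + v) w - bargmann_integrand \<alpha> f z w - k v w \<partial>?G)"
      unfolding bargmann_def D_def using bi kint by simp
    also have "norm \<dots> \<le> (\<integral>w. (norm v)\<^sup>2 * B w \<partial>?G)"
      using bi kint Bint pt by (intro order_trans[OF integral_norm_bound] integral_mono integrable_norm) auto
    finally show ?thesis by (simp add: C_def)
  qed
  have "(bargmann \<alpha> f has_derivative D) (at z)"
    unfolding has_derivative_at
  proof (intro conjI bl)
    show "(\<lambda>v. norm (bargmann \<alpha> f (z + v) - bargmann \<alpha> f z - D v) / norm v) \<midarrow>0\<rightarrow> 0"
    proof (rule Lim_null_comparison)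
      have "eventually (\<lambda>v :: complex ^ 'n. v \<in> ball 0 1) (at 0)"
        by (rule eventually_at_in_open') auto
      moreover have "eventually (\<lambda>v :: complex ^ 'n. v \<noteq> 0) (at 0)"
        by (simp add: eventually_at_filter)
      ultimately show "eventually (\<lambda>v. norm (norm (bargmann \<alpha> f (z + v) - bargmann \<alpha> f z - D v) / norm v) \<le> norm v * C) (at 0)"
      proof eventually_elim
        case (elim v)
        then show ?case using rem[of v] by (simp add: divide_simps power2_eq_square mult_ac)
      qed
      show "(\<lambda>v :: complex ^ 'n. norm v * C) \<midarrow>0\<rightarrow> 0"
        by (intro tendsto_eq_intros) auto
    qed
  qed
  moreover have "D (c *s v) = c * D v" for c v
  proof -
    have "k (c *s v) = (\<lambda>w. c * k v w)" by (intro ext) (simp add: k_def herm_scale_left)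
    then show ?thesis unfolding D_def by simp
  qed
  ultimately show "\<exists>D. (bargmann \<alpha> f has_derivative D) (at z) \<and> (\<forall>c v. D (c *s v) = c * D v)" by blast
qed

lemma entire_fun_measurable:
  fixes f :: "complex ^ 'n::finite \<Rightarrow> complex"
  assumes "entire_fun f"
  shows "f \<in> borel_measurable borel"
proof (rule borel_measurable_continuous_onI)
  show "continuous_on UNIV f"
    using assms unfolding entire_fun_def
    by (auto simp: continuous_on_eq_continuous_at intro: has_derivative_continuous)
qed

section \<open>Bounds for the projection\<close>

text \<open>
  Factoring a Gaussian out of the argument of the projection turns it into the holomorphic part
  with respect to another Gaussian measure.
\<close>

lemma bargmann_reweight:
  fixes g :: "complex ^ 'n::finite \<Rightarrow> complex"
  assumes \<alpha>: "\<alpha> > 0" and l: "l > 0" and [measurable]: "g \<in> borel_measurable borel"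
  shows "bargmann \<alpha> (\<lambda>w. exp ((\<alpha> - l\<^sup>2) * (norm w)\<^sup>2) * g (l *\<^sub>R w)) z
     = of_real ((\<alpha> / l\<^sup>2) ^ CARD('n)) * holo_part (\<alpha> / l) g z"
proof -
  have "bargmann \<alpha> (\<lambda>w. exp ((\<alpha> - l\<^sup>2) * (norm w)\<^sup>2) * g (l *\<^sub>R w)) z
    = (\<integral>w. exp ((\<alpha> - l\<^sup>2) * (norm w)\<^sup>2) * (exp (of_real \<alpha> * herm z w) * g (l *\<^sub>R w)) \<partial>gauss_measure \<alpha>)"
    unfolding bargmann_def bargmann_integrand_def by (simp add: mult_ac)
  also have "\<dots> = of_real ((\<alpha> / l\<^sup>2) ^ CARD('n)) * (\<integral>w. exp (of_real \<alpha> * herm z w) * g (l *\<^sub>R w) \<partial>gauss_measure (l\<^sup>2))"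
    using \<alpha> l by (intro gauss_measure_reweight_integral) auto
  also have "(\<integral>w. exp (of_real \<alpha> * herm z w) * g (l *\<^sub>R w) \<partial>gauss_measure (l\<^sup>2)) = holo_part (\<alpha> / l) g z"
    unfolding holo_part_def using l
    by (subst gauss_measure_scaled_integral) (simp_all add: herm_scaleR_right)
  finally show ?thesis .
qed

lemma nn_integral_gauss_exp:
  assumes "\<beta> > 0" "\<beta> > \<delta>"
  shows "(\<integral>\<^sup>+w. ennreal (exp (\<delta> * (norm w)\<^sup>2)) \<partial>(gauss_measure \<beta> :: (complex ^ 'n::finite) measure))
     = ennreal ((\<beta> / (\<beta> - \<delta>)) ^ CARD('n))"
proof -
  have "(\<integral>\<^sup>+w. ennreal (exp ((\<beta> - (\<beta> - \<delta>)) * (norm w)\<^sup>2)) * 1 \<partial>(gauss_measure \<beta> :: (complex ^ 'n) measure))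
     = ennreal ((\<beta> / (\<beta> - \<delta>)) ^ CARD('n)) * (\<integral>\<^sup>+w. 1 \<partial>(gauss_measure (\<beta> - \<delta>) :: (complex ^ 'n) measure))"
    using assms by (intro gauss_measure_reweight_nn_integral) auto
  then show ?thesis
    using prob_space.emeasure_space_1[OF prob_space_gauss_measure[of "\<beta> - \<delta>", where 'n='n]] assms by simp
qed

lemma holo_part_one: "holo_part r (\<lambda>w. 1) z = 1"
  using laplace_gauss(2)[of 0 "r *\<^sub>R z"] by (simp add: holo_part_def herm_scaleR_left)

text \<open>
  Write \<open>f(w) = exp ((\<alpha> - l\<^sup>2) \<bar>w\<bar>\<^sup>2) g(l w)\<close>, where \<open>l\<^sup>2 = \<alpha> p / (2 (p - 1))\<close> is chosen such
  that the norm of \<open>f\<close> is a multiple of the norm of \<open>g\<close> with respect to the standard Gaussian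
  measure. With \<open>t\<^sup>2 = \<alpha> p / 2\<close> the projection of \<open>f\<close> is then a multiple of the holomorphic
  part of \<open>g\<close> dilated by \<open>\<alpha> / (l t)\<close>, and this number is exactly the contracting dilation \<open>r =
  2 sqrt (p - 1) / p\<close>. The two multiples produce the constant.
\<close>

lemma bargmann_nn_bound:
  fixes f :: "complex ^ 'n::finite \<Rightarrow> complex"
  assumes p: "1 < p" and \<alpha>: "0 < \<alpha>" and f: "f \<in> Lp_space p (gauss_measure (\<alpha> * p / 2))"
  shows "(\<integral>\<^sup>+z. norm (bargmann \<alpha> f z) powr p \<partial>gauss_measure (\<alpha> * p / 2))
     \<le> ennreal (((2 * (p - 1) / p) powr p / (p - 1)) ^ CARD('n)) * (\<integral>\<^sup>+w. norm (f w) powr p \<partial>gauss_measure (\<alpha> * p / 2))"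
proof -
  have [measurable]: "f \<in> borel_measurable borel" using f by (simp add: Lp_space_def borel_measurable_gauss_measure)
  define l where "l = sqrt (\<alpha> * p / (2 * (p - 1)))"
  define t where "t = sqrt (\<alpha> * p / 2)"
  define r where "r = 2 * sqrt (p - 1) / p"
  have l: "l > 0" "l\<^sup>2 = \<alpha> * p / (2 * (p - 1))" using p \<alpha> by (simp_all add: l_def)
  have t: "t > 0" "t\<^sup>2 = \<alpha> * p / 2" using p \<alpha> by (simp_all add: t_def)
  have "r\<^sup>2 = 4 * (p - 1) / p\<^sup>2" using p by (simp add: r_def power_divide power_mult_distrib)
  also have "\<dots> = 1 - (1 - 2 / p)\<^sup>2" using p by (simp add: field_simps power2_eq_square)
  finally have r2: "r\<^sup>2 = 1 - (1 - 2 / p)\<^sup>2" .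
  have r: "0 \<le> r" "r \<le> 1"
  proof -
    show "0 \<le> r" using p by (simp add: r_def)
    have "r\<^sup>2 \<le> 1\<^sup>2" unfolding r2 by simp
    then show "r \<le> 1" by (rule power2_le_imp_le) simp
  qed
  have al: "\<alpha> / l = r * t"
  proof -
    have "\<alpha> * p / (2 * d) * d = \<alpha> * p / 2" if "d > 0" for d
      using that by simp
    from this[of "p - 1"] have "t = sqrt (l\<^sup>2 * (p - 1))"
      using p unfolding l(2) t_def by simp
    also have "\<dots> = l * sqrt (p - 1)" using l(1) by (simp add: real_sqrt_mult)
    finally have "r * t = 2 * (p - 1) / p * l" using p by (simp add: r_def)
    have gen: "\<alpha> = 2 * d / p * (\<alpha> * p / (2 * d))" if "d > 0" for d
      using p that by (simp add: field_simps)
    have "\<alpha> = 2 * (p - 1) / p * l\<^sup>2" unfolding l(2) using p by (intro gen) simp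
    then show ?thesis using \<open>r * t = _\<close> l(1) by (simp add: power2_eq_square)
  qed
  have "\<alpha> / (\<alpha> * p / (2 * d)) = 2 * d / p" if "d > 0" for d
    using p \<alpha> that by (simp add: field_simps)
  from this[of "p - 1"] have al2: "\<alpha> / l\<^sup>2 = 2 * (p - 1) / p" unfolding l(2) using p by simp
  define g where "g = (\<lambda>x. exp (- ((\<alpha> - l\<^sup>2) / l\<^sup>2) * (norm x)\<^sup>2) * f ((1 / l) *\<^sub>R x))"
  have [measurable]: "g \<in> borel_measurable borel" unfolding g_def by measurable
  have fg: "f = (\<lambda>w. exp ((\<alpha> - l\<^sup>2) * (norm w)\<^sup>2) * g (l *\<^sub>R w))"
  proof
    fix w :: "complex ^ 'n"
    have "exp ((\<alpha> - l\<^sup>2) * (norm w)\<^sup>2) * exp (- ((\<alpha> - l\<^sup>2) / l\<^sup>2) * (norm (l *\<^sub>R w))\<^sup>2) = 1"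
      using l(1) by (simp add: exp_add[symmetric] power_mult_distrib)
    then show "f w = exp ((\<alpha> - l\<^sup>2) * (norm w)\<^sup>2) * g (l *\<^sub>R w)"
      unfolding g_def mult.assoc[symmetric] of_real_mult[symmetric] using l(1) by simp
  qed
  have P: "bargmann \<alpha> f z = of_real ((2 * (p - 1) / p) ^ CARD('n)) * holo_part r g (t *\<^sub>R z)" for z
  proof -
    have "bargmann \<alpha> f z = of_real ((\<alpha> / l\<^sup>2) ^ CARD('n)) * holo_part (\<alpha> / l) g z"
      by (subst fg, rule bargmann_reweight) (use \<alpha> l in auto)
    also have "holo_part (\<alpha> / l) g z = holo_part r g (t *\<^sub>R z)"
      unfolding holo_part_def al by (simp add: herm_scaleR_left mult.assoc)
    finally show ?thesis unfolding al2 .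
  qed
  let ?c = "2 * (p - 1) / p"
  have c0: "?c > 0" using p by simp
  have F: "(\<integral>\<^sup>+w. norm (f w) powr p \<partial>gauss_measure (\<alpha> * p / 2)) = ennreal ((p - 1) ^ CARD('n)) * (\<integral>\<^sup>+x. norm (g x) powr p \<partial>\<gamma>)"
  proof -
    have e: "p * (\<alpha> - l\<^sup>2) = t\<^sup>2 - l\<^sup>2" using p by (simp add: l t field_simps)
    have "norm (f w) powr p = exp ((t\<^sup>2 - l\<^sup>2) * (norm w)\<^sup>2) * norm (g (l *\<^sub>R w)) powr p" for w
      by (subst fg) (simp add: norm_mult powr_mult exp_powr_real e[symmetric] mult_ac)
    then have "(\<integral>\<^sup>+w. norm (f w) powr p \<partial>gauss_measure (t\<^sup>2))
       = (\<integral>\<^sup>+w. ennreal (exp ((t\<^sup>2 - l\<^sup>2) * (norm w)\<^sup>2)) * ennreal (norm (g (l *\<^sub>R w)) powr p) \<partial>gauss_measure (t\<^sup>2))"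
      by (simp add: ennreal_mult')
    also have "\<dots> = ennreal ((t\<^sup>2 / l\<^sup>2) ^ CARD('n)) * (\<integral>\<^sup>+w. ennreal (norm (g (l *\<^sub>R w)) powr p) \<partial>gauss_measure (l\<^sup>2))"
      using t(1) l(1) by (intro gauss_measure_reweight_nn_integral) auto
    also have "(\<integral>\<^sup>+w. ennreal (norm (g (l *\<^sub>R w)) powr p) \<partial>gauss_measure (l\<^sup>2)) = (\<integral>\<^sup>+x. norm (g x) powr p \<partial>\<gamma>)"
      using l(1) by (subst gauss_measure_scaled_nn_integral) auto
    also have "t\<^sup>2 / l\<^sup>2 = p - 1" using p \<alpha> by (simp add: t l)
    finally show ?thesis by (simp add: t)
  qed
  have fin: "(\<integral>\<^sup>+w. norm (f w) powr p \<partial>gauss_measure (\<alpha> * p / 2)) < \<infinity>"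
    using f by (subst nn_integral_eq_integral) (auto simp: Lp_space_def)
  have "(\<integral>\<^sup>+x. norm (g x) powr p \<partial>\<gamma>) < \<infinity>"
    using fin p unfolding F by (auto simp: ennreal_mult_less_top)
  then have contr: "(\<integral>\<^sup>+z. norm (holo_part r g z) powr p \<partial>\<gamma>) \<le> (\<integral>\<^sup>+x. norm (g x) powr p \<partial>\<gamma>)"
    using Lp_contracted_Lp[OF p r r2, of g] by (simp add: Lp_contracted_def)
  have "norm (bargmann \<alpha> f z) powr p = (?c powr p) ^ CARD('n) * norm (holo_part r g (t *\<^sub>R z)) powr p" for z
  proof -
    have "(?c ^ CARD('n)) powr p = (?c powr p) ^ CARD('n)"
      using c0 by (simp only: powr_realpow[symmetric] powr_powr powr_gt_zero) (simp add: mult.commute)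
    moreover have "norm (bargmann \<alpha> f z) = ?c ^ CARD('n) * norm (holo_part r g (t *\<^sub>R z))"
      unfolding P norm_mult norm_of_real using c0 by simp
    ultimately show ?thesis using c0 by (simp only: powr_mult zero_le_power less_imp_le norm_ge_zero)
  qed
  then have "(\<integral>\<^sup>+z. norm (bargmann \<alpha> f z) powr p \<partial>gauss_measure (t\<^sup>2))
     = ennreal ((?c powr p) ^ CARD('n)) * (\<integral>\<^sup>+z. norm (holo_part r g (t *\<^sub>R z)) powr p \<partial>gauss_measure (t\<^sup>2))"
    by (simp add: ennreal_mult' nn_integral_cmult)
  also have "(\<integral>\<^sup>+z. norm (holo_part r g (t *\<^sub>R z)) powr p \<partial>gauss_measure (t\<^sup>2)) = (\<integral>\<^sup>+z. norm (holo_part r g z) powr p \<partial>\<gamma>)"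
    using t(1) by (subst gauss_measure_scaled_nn_integral) auto
  also have "ennreal ((?c powr p) ^ CARD('n)) * \<dots> \<le> ennreal ((?c powr p) ^ CARD('n)) * (\<integral>\<^sup>+x. norm (g x) powr p \<partial>\<gamma>)"
    using contr by (intro mult_left_mono) auto
  also have "(?c powr p) ^ CARD('n) = (?c powr p / (p - 1)) ^ CARD('n) * (p - 1) ^ CARD('n)"
    using p by (simp add: power_divide)
  also have "ennreal \<dots> * (\<integral>\<^sup>+x. norm (g x) powr p \<partial>\<gamma>)
     = ennreal ((?c powr p / (p - 1)) ^ CARD('n)) * (\<integral>\<^sup>+w. norm (f w) powr p \<partial>gauss_measure (\<alpha> * p / 2))"
    unfolding F using p by (simp add: ennreal_mult' mult.assoc)
  finally show ?thesis unfolding t(2) .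
qed

text \<open>
  For \<open>p = 1\<close> no cancellation is involved: the kernel may be replaced by its modulus, and
  Tonelli's theorem and the real Laplace transform give the bound.
\<close>

lemma bargmann_nn_bound_1:
  fixes f :: "complex ^ 'n::finite \<Rightarrow> complex"
  assumes \<alpha>: "0 < \<alpha>" and [measurable]: "f \<in> borel_measurable borel"
  shows "(\<integral>\<^sup>+z. norm (bargmann \<alpha> f z) \<partial>gauss_measure (\<alpha> / 2))
     \<le> ennreal (2 ^ CARD('n)) * (\<integral>\<^sup>+w. norm (f w) \<partial>gauss_measure (\<alpha> / 2))"
proof -
  let ?A = "gauss_measure \<alpha> :: (complex ^ 'n) measure" and ?H = "gauss_measure (\<alpha> / 2) :: (complex ^ 'n) measure"
  interpret A: prob_space ?A using \<alpha> by (rule prob_space_gauss_measure)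
  interpret H: prob_space ?H using \<alpha> by (intro prob_space_gauss_measure) simp
  interpret pair_sigma_finite ?A ?H ..
  have lap: "(\<integral>\<^sup>+z. ennreal (exp (\<alpha> * (z \<bullet> w))) \<partial>?H) = ennreal (exp ((\<alpha> - \<alpha> / 2) * (norm w)\<^sup>2))" for w
  proof -
    define t where "t = sqrt (\<alpha> / 2)"
    have t: "t > 0" "t\<^sup>2 = \<alpha> / 2" using \<alpha> by (simp_all add: t_def)
    define a where "a = t *\<^sub>R w"
    have ex: "exp (herm x a + herm a x) = of_real (exp (2 * (x \<bullet> a)))" for x
    proof -
      have "herm x a + herm a x = of_real (2 * (x \<bullet> a))"
        using cnj_herm[of x a] by (simp add: complex_eq_iff Re_herm inner_commute)
      then show ?thesis by (simp only: exp_of_real)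
    qed
    have i: "integrable \<gamma> (\<lambda>x. exp (2 * (x \<bullet> a)))"
      using integrable_Re[OF laplace_gauss(1)[of a a, unfolded ex]] by simp
    have v: "(\<integral>x. exp (2 * (x \<bullet> a)) \<partial>\<gamma>) = exp ((norm a)\<^sup>2)"
    proof -
      have "complex_of_real (\<integral>x. exp (2 * (x \<bullet> a)) \<partial>\<gamma>) = of_real (exp ((norm a)\<^sup>2))"
        using laplace_gauss(2)[of a a] unfolding ex herm_self exp_of_real integral_complex_of_real .
      then show ?thesis by (simp only: of_real_eq_iff)
    qed
    have "(\<integral>\<^sup>+z. ennreal (exp (\<alpha> * (z \<bullet> w))) \<partial>gauss_measure (t\<^sup>2)) = (\<integral>\<^sup>+x. ennreal (exp (2 * (x \<bullet> a))) \<partial>\<gamma>)"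
    proof (subst gauss_measure_scaled_nn_integral[OF t(1)], measurable, intro nn_integral_cong)
      fix x
      have "\<alpha> * ((1 / t) *\<^sub>R x \<bullet> w) = 2 * (x \<bullet> a)"
        using t by (simp add: a_def field_simps power2_eq_square)
      then show "ennreal (exp (\<alpha> * ((1 / t) *\<^sub>R x \<bullet> w))) = ennreal (exp (2 * (x \<bullet> a)))" by simp
    qed
    also have "\<dots> = ennreal (exp ((norm a)\<^sup>2))"
      by (subst nn_integral_eq_integral[OF i]) (simp_all add: v)
    also have "(norm a)\<^sup>2 = (\<alpha> - \<alpha> / 2) * (norm w)\<^sup>2"
      by (simp add: a_def power_mult_distrib t)
    finally show ?thesis unfolding t .
  qed
  have "(\<integral>\<^sup>+z. norm (bargmann \<alpha> f z) \<partial>?H) \<le> (\<integral>\<^sup>+z. \<integral>\<^sup>+w. ennreal (exp (\<alpha> * (z \<bullet> w))) * ennreal (norm (f w)) \<partial>?A \<partial>?H)"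
  proof (intro nn_integral_mono)
    fix z
    have "ennreal (norm (bargmann \<alpha> f z)) \<le> (\<integral>\<^sup>+w. norm (bargmann_integrand \<alpha> f z w) \<partial>?A)"
      unfolding bargmann_def
      by (cases "integrable ?A (bargmann_integrand \<alpha> f z)")
         (simp_all add: integral_norm_bound_ennreal not_integrable_integral_eq)
    also have "\<dots> = (\<integral>\<^sup>+w. ennreal (exp (\<alpha> * (z \<bullet> w))) * ennreal (norm (f w)) \<partial>?A)"
      by (simp add: bargmann_integrand_def norm_mult Re_herm ennreal_mult')
    finally show "ennreal (norm (bargmann \<alpha> f z)) \<le> (\<integral>\<^sup>+w. ennreal (exp (\<alpha> * (z \<bullet> w))) * ennreal (norm (f w)) \<partial>?A)" .
  qed
  also have "\<dots> = (\<integral>\<^sup>+w. \<integral>\<^sup>+z. ennreal (exp (\<alpha> * (z \<bullet> w))) * ennreal (norm (f w)) \<partial>?H \<partial>?A)"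
    by (rule Fubini') measurable
  also have "\<dots> = (\<integral>\<^sup>+w. ennreal (exp ((\<alpha> - \<alpha> / 2) * (norm w)\<^sup>2)) * ennreal (norm (f w)) \<partial>?A)"
    by (simp add: nn_integral_multc lap)
  also have "\<dots> = ennreal ((\<alpha> / (\<alpha> / 2)) ^ CARD('n)) * (\<integral>\<^sup>+w. norm (f w) \<partial>?H)"
    using \<alpha> by (intro gauss_measure_reweight_nn_integral) auto
  finally show ?thesis using \<alpha> by simp
qed

lemma Lp_bound_of_nn_bound:
  assumes p: "p > 0" and A: "A \<ge> 0" and f: "f \<in> Lp_space p M" and [measurable]: "g \<in> borel_measurable M"
    and le: "(\<integral>\<^sup>+z. norm (g z) powr p \<partial>M) \<le> ennreal (A powr p) * (\<integral>\<^sup>+z. norm (f z) powr p \<partial>M)"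
  shows "g \<in> Lp_space p M" "Lp_norm p M g \<le> A * Lp_norm p M f"
proof -
  have fi: "integrable M (\<lambda>x. norm (f x) powr p)" using f by (simp add: Lp_space_def)
  have fe: "(\<integral>\<^sup>+z. norm (f z) powr p \<partial>M) = ennreal (\<integral>z. norm (f z) powr p \<partial>M)"
    by (rule nn_integral_eq_integral[OF fi]) simp
  have I0: "0 \<le> (\<integral>z. norm (f z) powr p \<partial>M)" "0 \<le> (\<integral>z. norm (g z) powr p \<partial>M)"
    by (intro integral_nonneg_AE; simp)+
  have "(\<integral>\<^sup>+z. norm (g z) powr p \<partial>M) < \<infinity>"
    using le unfolding fe by (auto simp: ennreal_mult'[symmetric] intro: order_le_less_trans)
  then have gi: "integrable M (\<lambda>x. norm (g x) powr p)" by (intro integrableI_nonneg) auto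
  then show "g \<in> Lp_space p M" by (simp add: Lp_space_def)
  have "(\<integral>\<^sup>+z. norm (g z) powr p \<partial>M) = ennreal (\<integral>z. norm (g z) powr p \<partial>M)"
    by (rule nn_integral_eq_integral[OF gi]) simp
  then have "(\<integral>z. norm (g z) powr p \<partial>M) \<le> A powr p * (\<integral>z. norm (f z) powr p \<partial>M)"
    using le I0 unfolding fe by (simp add: ennreal_mult'[symmetric])
  then have "(\<integral>z. norm (g z) powr p \<partial>M) powr (1 / p) \<le> (A powr p * (\<integral>z. norm (f z) powr p \<partial>M)) powr (1 / p)"
    using p I0 by (intro powr_mono2) auto
  also have "\<dots> = A * (\<integral>z. norm (f z) powr p \<partial>M) powr (1 / p)"
    using p A I0 by (simp add: powr_mult powr_powr)
  finally show "Lp_norm p M g \<le> A * Lp_norm p M f" by (simp add: Lp_norm_def)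
qed

lemma Lp_op_norm_eqI:
  assumes ub: "\<And>f. f \<in> Lp_space p M \<Longrightarrow> Lp_norm p M (T f) \<le> A * Lp_norm p M f"
    and f: "\<And>k::nat. f k \<in> Lp_space p M"
    and lim: "(\<lambda>k. Lp_norm p M (T (f k)) / Lp_norm p M (f k)) \<longlonglongrightarrow> A" and A: "0 \<le> A"
  shows "Lp_op_norm p M T = A"
proof -
  let ?q = "\<lambda>f. Lp_norm p M (T f) / Lp_norm p M f"
  have q: "?q g \<le> A" if "g \<in> Lp_space p M" for g
  proof (cases "Lp_norm p M g = 0")
    case False
    then have "Lp_norm p M g > 0" by (simp add: Lp_norm_def)
    then show ?thesis using ub[OF that] by (simp add: divide_le_eq)
  qed (use A in simp)
  have "Lp_op_norm p M T \<le> A"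
    unfolding Lp_op_norm_def using f q by (intro cSUP_least) auto
  moreover have "A \<le> Lp_op_norm p M T"
  proof (rule LIMSEQ_le_const2[OF lim], intro exI allI impI)
    fix k
    show "?q (f k) \<le> Lp_op_norm p M T"
      unfolding Lp_op_norm_def using q by (intro cSUP_upper f bdd_aboveI2) auto
  qed
  ultimately show ?thesis by simp
qed

text \<open>
  The projection of a Gaussian is constant by \<open>bargmann_reweight\<close>, since the holomorphic part
  of \<open>1\<close> is \<open>1\<close>. The inequality \<open>pl\<close> says that the Gaussian has a finite norm.
\<close>

lemma gaussian_test_function:
  assumes \<alpha>: "\<alpha> > 0" and p: "p \<ge> 1" and l: "l > 0" and pl: "\<alpha> * p / 2 > p * (\<alpha> - l\<^sup>2)"
  defines "f \<equiv> \<lambda>w :: complex ^ 'n::finite. complex_of_real (exp ((\<alpha> - l\<^sup>2) * (norm w)\<^sup>2))"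
    and "M \<equiv> gauss_measure (\<alpha> * p / 2)"
  shows "f \<in> Lp_space p M"
    and "Lp_norm p M (bargmann \<alpha> f) / Lp_norm p M f
      = (\<alpha> / l\<^sup>2 * ((\<alpha> * p / 2 - p * (\<alpha> - l\<^sup>2)) / (\<alpha> * p / 2)) powr (1 / p)) ^ CARD('n)"
proof -
  let ?\<beta> = "\<alpha> * p / 2" and ?n = "CARD('n)"
  define D where "D = ?\<beta> - p * (\<alpha> - l\<^sup>2)"
  have \<beta>: "?\<beta> > 0" using \<alpha> p by simp
  have D: "D > 0" using pl by (simp add: D_def)
  have fp: "norm (f w) powr p = exp (p * (\<alpha> - l\<^sup>2) * (norm w)\<^sup>2)" for w
    by (simp add: f_def exp_powr_real mult_ac)
  have nn: "(\<integral>\<^sup>+w. norm (f w) powr p \<partial>M) = ennreal ((?\<beta> / D) ^ ?n)"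
    unfolding fp M_def D_def by (rule nn_integral_gauss_exp[OF \<beta> pl])
  have [measurable]: "f \<in> borel_measurable borel" unfolding f_def by measurable
  have "integrable M (\<lambda>w. norm (f w) powr p)"
    using nn by (intro integrableI_nonneg) (auto simp: M_def)
  then show "f \<in> Lp_space p M" by (simp add: Lp_space_def M_def borel_measurable_gauss_measure)
  have "(\<integral>w. norm (f w) powr p \<partial>M) = (?\<beta> / D) ^ ?n"
    using nn \<beta> D by (intro integral_eq_nn_integral[THEN trans]) (auto simp: M_def)
  moreover have "(X ^ ?n) powr (1 / p) = (X powr (1 / p)) ^ ?n" if "X > 0" for X
  proof -
    have "(X ^ ?n) powr (1 / p) = (X powr real ?n) powr (1 / p)" by (simp only: powr_realpow[OF that])
    also have "\<dots> = (X powr (1 / p)) powr real ?n" by (simp only: powr_powr mult.commute)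
    also have "\<dots> = (X powr (1 / p)) ^ ?n" using that by (intro powr_realpow) simp
    finally show ?thesis .
  qed
  ultimately have nf: "Lp_norm p M f = ((?\<beta> / D) powr (1 / p)) ^ ?n"
    using \<beta> D by (simp only: Lp_norm_def divide_pos_pos)
  have P: "bargmann \<alpha> f z = of_real ((\<alpha> / l\<^sup>2) ^ ?n)" for z
    using bargmann_reweight[OF \<alpha> l, of "\<lambda>_. 1" z] by (simp add: f_def holo_part_one)
  interpret prob_space M unfolding M_def using \<beta> by (rule prob_space_gauss_measure)
  have nP: "Lp_norm p M (bargmann \<alpha> f) = (\<alpha> / l\<^sup>2) ^ ?n"
    unfolding Lp_norm_def P norm_of_real using \<alpha> l p by (simp add: prob_space powr_powr)
  have "1 / (x / y) powr (1 / p) = (y / x) powr (1 / p)" if "x > 0" "y > 0" for x y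
    using that by (simp add: powr_divide)
  from this[OF \<beta> D] have "\<alpha> / l\<^sup>2 / (?\<beta> / D) powr (1 / p) = \<alpha> / l\<^sup>2 * (D / ?\<beta>) powr (1 / p)"
    by (metis times_divide_eq_right mult_1_right)
  then show "Lp_norm p M (bargmann \<alpha> f) / Lp_norm p M f
      = (\<alpha> / l\<^sup>2 * ((\<alpha> * p / 2 - p * (\<alpha> - l\<^sup>2)) / (\<alpha> * p / 2)) powr (1 / p)) ^ ?n"
    unfolding nf nP D_def[symmetric] power_divide[symmetric] by (simp only:)
qed

section \<open>The norm of the Bargmann projection\<close>

theorem theorem1p1:
  fixes p \<alpha> :: real and p' :: ennreal
  assumes "1 \<le> p" and "0 < \<alpha>"
    and "1 / ennreal p + 1 / p' = 1"
  shows "let M = (gauss_measure (\<alpha> * p / 2) :: (complex ^ 'n::finite) measure) in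
    (\<forall>f\<in>Lp_space p M. \<forall>z. integrable (gauss_measure \<alpha>) (bargmann_integrand \<alpha> f z)) \<and>
    Lp_bounded_op p M (Lp_hol p M) (bargmann \<alpha>) \<and>
    Lp_op_norm p M (bargmann \<alpha>) = (2 * (1 / p powr (1 / p)) * (1 / self_root p')) ^ CARD('n)"
proof -
  note p = assms(1) and \<alpha> = assms(2)
  define M where "M = (gauss_measure (\<alpha> * p / 2) :: (complex ^ 'n) measure)"
  define A where "A = 2 * (1 / p powr (1 / p)) * (1 / self_root p')"
  let ?n = "CARD('n)"
  have A0: "A \<ge> 0" using p by (simp add: A_def self_root_def)
  have int: "integrable (gauss_measure \<alpha>) (bargmann_integrand \<alpha> f z)" if "f \<in> Lp_space p M" for f z
    using that unfolding M_def by (rule bargmann_integrand_integrable[OF p \<alpha>])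
  have ent: "entire_fun (bargmann \<alpha> f)" if "f \<in> Lp_space p M" for f
    using that unfolding M_def by (rule entire_bargmann[OF p \<alpha>])
  have meas: "bargmann \<alpha> f \<in> borel_measurable M" if "f \<in> Lp_space p M" for f
    using entire_fun_measurable[OF ent[OF that]] by (simp add: M_def borel_measurable_gauss_measure)
  \<comment> \<open>At p = 1 the conjugate exponent is infinite and contributes the factor 1.\<close>
  have A1: "A = 2" if "p = 1"
  proof -
    have "1 + 1 / p' = 1" using assms(3) that by simp
    then have "1 / p' = 0" using ennreal_add_left_cancel[of 1 "1 / p'" 0] by simp
    then have "p' = top" by (simp add: ennreal_divide_eq_0_iff)
    then show ?thesis using that by (simp add: A_def self_root_def)
  qed
  have A2: "A = 2 * (p - 1) / p * (1 / (p - 1) powr (1 / p))" if p1: "p > 1"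
  proof -
    define q where "q = p / (p - 1)"
    have q: "q > 0" using p1 by (simp add: q_def)
    have iq: "1 / q = 1 - 1 / p" using p1 by (simp add: q_def field_simps)
    have "1 / ennreal p = ennreal (1 / p)" using p1 by (simp add: divide_ennreal[symmetric])
    moreover have "(1 :: ennreal) = ennreal (1 / p) + ennreal (1 / q)"
      unfolding iq using p1 by (subst ennreal_plus[symmetric]) auto
    ultimately have "ennreal (1 / p) + 1 / p' = ennreal (1 / p) + ennreal (1 / q)"
      using assms(3) by simp
    then have "1 / p' = ennreal (1 / q)" by (simp add: ennreal_add_left_cancel)
    then have "p' = ennreal q"
    proof (cases p' rule: ennreal_cases)
      case (real x)
      show ?thesis
      proof (cases "x = 0")
        case True
        then show ?thesis using \<open>1 / p' = ennreal (1 / q)\<close> real by simp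
      next
        case False
        then have "1 / p' = ennreal (1 / x)" using real by (simp add: divide_ennreal[symmetric])
        then have "1 / x = 1 / q" using \<open>1 / p' = ennreal (1 / q)\<close> q real by simp
        then show ?thesis using real by simp
      qed
    next
      case top
      then show ?thesis using \<open>1 / p' = ennreal (1 / q)\<close> q by simp
    qed
    then have "self_root p' = q powr (1 / q)" using q by (simp add: self_root_def)
    also have "\<dots> = q / q powr (1 / p)" unfolding iq using q by (simp add: powr_diff)
    also have "q powr (1 / p) = p powr (1 / p) / (p - 1) powr (1 / p)"
      unfolding q_def using p1 by (simp add: powr_divide)
    finally show ?thesis using p1 by (simp add: A_def q_def)
  qed
  have bound: "bargmann \<alpha> f \<in> Lp_space p M \<and> Lp_norm p M (bargmann \<alpha> f) \<le> A ^ ?n * Lp_norm p M f"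
    if f: "f \<in> Lp_space p M" for f
  proof -
    have "(\<integral>\<^sup>+z. norm (bargmann \<alpha> f z) powr p \<partial>M) \<le> ennreal ((A ^ ?n) powr p) * (\<integral>\<^sup>+w. norm (f w) powr p \<partial>M)"
    proof (cases "p = 1")
      case True
      have "f \<in> borel_measurable borel" using f by (simp add: Lp_space_def M_def borel_measurable_gauss_measure)
      then show ?thesis using bargmann_nn_bound_1[OF \<alpha>, of f] True A1 by (simp add: M_def)
    next
      case False
      then have p1: "p > 1" using p by simp
      have pos: "A > 0" unfolding A2[OF p1] using p1 by simp
      have "(A ^ ?n) powr p = (A powr p) ^ ?n"
      proof -
        have "(A ^ ?n) powr p = (A powr real ?n) powr p" by (simp only: powr_realpow[OF pos])
        also have "\<dots> = (A powr p) powr real ?n" by (simp only: powr_powr mult.commute)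
        also have "\<dots> = (A powr p) ^ ?n" using pos by (intro powr_realpow) simp
        finally show ?thesis .
      qed
      also have "A powr p = (2 * (p - 1) / p) powr p * (1 / (p - 1) powr (1 / p)) powr p"
        unfolding A2[OF p1] using p1 by (subst powr_mult) auto
      also have "(1 / (p - 1) powr (1 / p)) powr p = 1 / (p - 1)"
        using p1 by (simp add: powr_divide powr_powr)
      finally show ?thesis
        using bargmann_nn_bound[OF p1 \<alpha>, of f] f by (simp add: M_def)
    qed
    then show ?thesis
      using Lp_bound_of_nn_bound[of p "A ^ ?n" f M "bargmann \<alpha> f"] p A0 f meas[OF f] by auto
  qed
  have "Lp_bounded_op p M (Lp_hol p M) (bargmann \<alpha>)"
    unfolding Lp_bounded_op_def
  proof (intro conjI ballI allI)
    show "bargmann \<alpha> f \<in> Lp_hol p M" if "f \<in> Lp_space p M" for f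
      using bound[OF that] ent[OF that] by (simp add: Lp_hol_def)
    show "bargmann \<alpha> (\<lambda>x. f x + g x) = (\<lambda>x. bargmann \<alpha> f x + bargmann \<alpha> g x)"
      if "f \<in> Lp_space p M" "g \<in> Lp_space p M" for f g
    proof
      fix z
      have "bargmann_integrand \<alpha> (\<lambda>x. f x + g x) z = (\<lambda>w. bargmann_integrand \<alpha> f z w + bargmann_integrand \<alpha> g z w)"
        by (intro ext) (simp add: bargmann_integrand_def distrib_left)
      then show "bargmann \<alpha> (\<lambda>x. f x + g x) z = bargmann \<alpha> f z + bargmann \<alpha> g z"
        unfolding bargmann_def using int[OF that(1)] int[OF that(2)] by simp
    qed
    show "bargmann \<alpha> (\<lambda>x. c * f x) = (\<lambda>x. c * bargmann \<alpha> f x)" for c f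
    proof
      fix z
      have "bargmann_integrand \<alpha> (\<lambda>x. c * f x) z = (\<lambda>w. c * bargmann_integrand \<alpha> f z w)"
        by (intro ext) (simp add: bargmann_integrand_def)
      then show "bargmann \<alpha> (\<lambda>x. c * f x) z = c * bargmann \<alpha> f z"
        unfolding bargmann_def by simp
    qed
    show "\<exists>C. \<forall>f\<in>Lp_space p M. Lp_norm p M (bargmann \<alpha> f) \<le> C * Lp_norm p M f"
      using bound by blast
  qed
  moreover have "Lp_op_norm p M (bargmann \<alpha>) = A ^ ?n"
  proof -
    define f where "f = (\<lambda>l (w :: complex ^ 'n). complex_of_real (exp ((\<alpha> - l\<^sup>2) * (norm w)\<^sup>2)))"
    define ratio where "ratio = (\<lambda>l. \<alpha> / l\<^sup>2 * ((\<alpha> * p / 2 - p * (\<alpha> - l\<^sup>2)) / (\<alpha> * p / 2)) powr (1 / p))"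
    have test: "f l \<in> Lp_space p M" "Lp_norm p M (bargmann \<alpha> (f l)) / Lp_norm p M (f l) = ratio l ^ ?n"
      if "l > 0" "2 * l\<^sup>2 > \<alpha>" for l
    proof -
      have "p * (\<alpha> - l\<^sup>2) < p * (\<alpha> / 2)" using p that by (intro mult_strict_left_mono) auto
      then have "\<alpha> * p / 2 > p * (\<alpha> - l\<^sup>2)" by (simp add: mult.commute)
      then show "f l \<in> Lp_space p M" "Lp_norm p M (bargmann \<alpha> (f l)) / Lp_norm p M (f l) = ratio l ^ ?n"
        unfolding f_def M_def ratio_def using gaussian_test_function[OF \<alpha> p that(1), where 'n='n] by blast+
    qed
    have "\<exists>l. (\<forall>k::nat. l k > 0 \<and> 2 * (l k)\<^sup>2 > \<alpha>) \<and> (\<lambda>k. ratio (l k)) \<longlonglongrightarrow> A"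
    proof (cases "p = 1")
      case True
      \<comment> \<open>The supremum is not attained by Gaussians here; increasingly concentrated ones approach it.\<close>
      define l where "l = (\<lambda>k::nat. sqrt (\<alpha> * (real k + 1)))"
      have l2: "(l k)\<^sup>2 = \<alpha> * (real k + 1)" for k using \<alpha> by (simp add: l_def)
      have "ratio (l k) = 2 - 1 / (real k + 1)" for k
      proof -
        define K where "K = real k + 1"
        have K: "K > 0" by (simp add: K_def)
        have "ratio (l k) = \<alpha> / (\<alpha> * K) * (\<alpha> * (K - 1 / 2) / (\<alpha> / 2))"
          unfolding ratio_def l2 True K_def[symmetric] using \<alpha> K by (simp add: algebra_simps K_def)
        also have "\<dots> = 2 - 1 / K" using \<alpha> K by (simp add: field_simps)
        finally show ?thesis unfolding K_def .
      qed
      moreover have "(\<lambda>k. 2 - 1 / (real k + 1)) \<longlonglongrightarrow> 2" by real_asymp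
      moreover have "l k > 0 \<and> 2 * (l k)\<^sup>2 > \<alpha>" for k
        unfolding l2 using \<alpha> by (simp add: l_def algebra_simps add_pos_nonneg)
      ultimately show ?thesis using A1[OF True] by (intro exI[of _ l]) simp
    next
      case False
      then have p1: "p > 1" using p by simp
      define l where "l = sqrt (\<alpha> * p / (2 * (p - 1)))"
      have l: "l > 0" "l\<^sup>2 = \<alpha> * p / (2 * (p - 1))" using p1 \<alpha> by (simp_all add: l_def)
      \<comment> \<open>For this l the function g of the reweighting is the constant 1, whose holomorphic part has the same norm.\<close>
      have alg: "\<alpha> / (\<alpha> * p / (2 * d)) = 2 * d / p"
        "(\<alpha> * p / 2 - p * (\<alpha> - \<alpha> * p / (2 * d))) / (\<alpha> * p / 2) = 1 / d"
        "\<alpha> < 2 * (\<alpha> * p / (2 * d))"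
        if "d > 0" "p = d + 1" for d
      proof -
        show "\<alpha> / (\<alpha> * p / (2 * d)) = 2 * d / p" using \<alpha> p1 that(1) by (simp add: field_simps)
        have "(\<alpha> * p / 2 - p * (\<alpha> - \<alpha> * p / (2 * d))) / (\<alpha> * p / 2) = p / d - 1"
          using \<alpha> p1 that(1) by (simp add: field_simps)
        also have "\<dots> = 1 / d" using that by (simp add: field_simps)
        finally show "(\<alpha> * p / 2 - p * (\<alpha> - \<alpha> * p / (2 * d))) / (\<alpha> * p / 2) = 1 / d" .
        show "\<alpha> < 2 * (\<alpha> * p / (2 * d))" using \<alpha> that by (simp add: field_simps)
      qed
      have "ratio l = A"
        unfolding ratio_def l(2) A2[OF p1] using alg(1,2)[of "p - 1"] p1 by (simp add: powr_divide)
      moreover have "\<alpha> < 2 * l\<^sup>2" unfolding l(2) using alg(3)[of "p - 1"] p1 by simp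
      ultimately show ?thesis using l(1) by (intro exI[of _ "\<lambda>_. l"]) simp
    qed
    then obtain l where l: "\<And>k::nat. l k > 0" "\<And>k. 2 * (l k)\<^sup>2 > \<alpha>" "(\<lambda>k. ratio (l k)) \<longlonglongrightarrow> A" by blast
    show ?thesis
    proof (rule Lp_op_norm_eqI[where f="\<lambda>k. f (l k)"])
      show "(\<lambda>k. Lp_norm p M (bargmann \<alpha> (f (l k))) / Lp_norm p M (f (l k))) \<longlonglongrightarrow> A ^ ?n"
        unfolding test(2)[OF l(1,2)] by (intro tendsto_power l(3))
    qed (use bound test(1)[OF l(1,2)] A0 in auto)
  qed
  ultimately show ?thesis
    unfolding Let_def M_def[symmetric] A_def[symmetric] using int by blast
qed

end
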